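(* Let $L$ be an integral unimodular lattice in $\mathbb{R}^n$ with no vectors of norm $1$. Then: (i) $L$ has at least $2n(23-n)$ vectors of norm $2$. (ii) Equality holds in (i) (that is, $L$ has exactly $2n(23-n)$ vectors of norm $2$) if and only if $L$ has no characteristic vectors of norm $<n-8$. (iii) In that case (i.e. when the equivalent conditions of (ii) hold), the number of characteristic vectors of $L$ of norm exactly $n-8$ is $2^{n-11}\,n$.
   Context: An integral unimodular lattice $L\subset\mathbb{R}^n$ is a lattice of rank $n$ with $(v,w)\in\mathbb{Z}$ for all $v,w\in L$ and equal to its own dual lattice under the standard inner product $(\cdot,\cdot)$ of $\mathbb{R}^n$. The norm of a vector $v$ is $(v,v)=|v|^2$. A characteristic vector of $L$ is a vector $w\in L$ such that $(v,w)\equiv (v,v) \pmod 2$ for all $v\in L$. *)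

theory Defs
  imports "HOL-Analysis.Analysis"
begin

definition full_rank_lattice :: "(real ^ 'n) set \<Rightarrow> bool" where
  "full_rank_lattice L \<longleftrightarrow>
     (\<exists>B. independent B \<and> card B = CARD('n) \<and>
          L = range (\<lambda>c :: real ^ 'n \<Rightarrow> int. \<Sum>b\<in>B. of_int (c b) *\<^sub>R b))"

definition dual_lattice :: "(real ^ 'n) set \<Rightarrow> (real ^ 'n) set" where
  "dual_lattice L = {w. \<forall>v\<in>L. v \<bullet> w \<in> \<int>}"

definition integral_unimodular_lattice :: "(real ^ 'n) set \<Rightarrow> bool" where
  "integral_unimodular_lattice L \<longleftrightarrow>
     full_rank_lattice L \<and> (\<forall>v\<in>L. \<forall>w\<in>L. v \<bullet> w \<in> \<int>) \<and> dual_lattice L = L"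

definition characteristic_vectors :: "(real ^ 'n) set \<Rightarrow> (real ^ 'n) set" where
  "characteristic_vectors L =
     {w \<in> L. \<forall>v\<in>L. \<exists>k::int. v \<bullet> w - v \<bullet> v = 2 * of_int k}"

(* Following the lattice literature, the norm of v is v \<bullet> v, the square of the
   Euclidean length. *)
definition vectors_of_norm :: "(real ^ 'n) set \<Rightarrow> real \<Rightarrow> (real ^ 'n) set" where
  "vectors_of_norm S r = {v \<in> S. v \<bullet> v = r}"

(* Ensures that card (vectors_of_norm L r) is a genuine count. *)
lemma finite_vectors_of_norm:
  fixes L :: "(real ^ 'n) set"
  assumes "full_rank_lattice L" and "S \<subseteq> L"
  shows "finite (vectors_of_norm S r)"
proof -
  obtain B where B: "independent B" "card B = CARD('n)"
    and L: "L = range (\<lambda>c :: real ^ 'n \<Rightarrow> int. \<Sum>b\<in>B. of_int (c b) *\<^sub>R b)"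
    using assms(1) unfolding full_rank_lattice_def by blast
  have fin: "finite B" using B(1) by (rule independent_imp_finite)
  have span: "span B = UNIV"
    using B by (metis DIM_cart DIM_real card_eq_dim dim_UNIV fin independent_imp_finite
        mult.right_neutral subset_UNIV top.extremum_uniqueI)
  have "\<exists>K. \<forall>v. \<bar>representation B v b\<bar> \<le> norm v * K" for b
  proof -
    have "linear (\<lambda>v. representation B v b)"
      by (rule linearI) (use B span in \<open>auto simp: representation_add representation_scale\<close>)
    then have "bounded_linear (\<lambda>v. representation B v b)"
      by (simp add: linear_conv_bounded_linear)
    from bounded_linear.bounded[OF this] show ?thesis by auto
  qed
  then obtain K where K: "\<And>b v. \<bar>representation B v b\<bar> \<le> norm v * K b" by metis
  define C where "C b = {k::int. \<bar>of_int k\<bar> \<le> sqrt r * K b}" for b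
  have "finite (C b)" for b
  proof (rule finite_subset)
    show "C b \<subseteq> {- \<lfloor>sqrt r * K b\<rfloor> .. \<lfloor>sqrt r * K b\<rfloor>}"
      unfolding C_def by (auto simp: le_floor_iff abs_le_iff minus_le_iff)
  qed simp
  then have "finite ((\<lambda>c. \<Sum>b\<in>B. of_int (c b) *\<^sub>R b) ` (\<Pi>\<^sub>E b\<in>B. C b))"
    using fin by (intro finite_imageI finite_PiE) auto
  moreover have "vectors_of_norm S r \<subseteq> (\<lambda>c. \<Sum>b\<in>B. of_int (c b) *\<^sub>R b) ` (\<Pi>\<^sub>E b\<in>B. C b)"
  proof
    fix v assume "v \<in> vectors_of_norm S r"
    then have v: "v \<in> L" "v \<bullet> v = r" using assms(2) by (auto simp: vectors_of_norm_def)
    from v(1) L obtain c :: "real ^ 'n \<Rightarrow> int" where c: "v = (\<Sum>b\<in>B. of_int (c b) *\<^sub>R b)" by auto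
    have "representation B v b = of_int (c b)" if "b \<in> B" for b
    proof -
      have "representation B v b = (\<Sum>x\<in>B. of_int (c x) * representation B x b)"
        unfolding c using B span
        by (simp add: representation_sum representation_scale)
      also have "\<dots> = (\<Sum>x\<in>B. if x = b then of_int (c x) else 0)"
        by (rule sum.cong) (use B in \<open>auto simp: representation_basis\<close>)
      finally show ?thesis using that fin by simp
    qed
    moreover have "norm v = sqrt r" using v(2) by (simp add: norm_eq_sqrt_inner)
    ultimately have "c b \<in> C b" if "b \<in> B" for b
      using K[of v b] that by (simp add: C_def)
    then have "restrict c B \<in> (\<Pi>\<^sub>E b\<in>B. C b)" by auto
    moreover have "v = (\<Sum>b\<in>B. of_int (restrict c B b) *\<^sub>R b)"
      unfolding c by (rule sum.cong) auto
    ultimately show "v \<in> (\<lambda>c. \<Sum>b\<in>B. of_int (c b) *\<^sub>R b) ` (\<Pi>\<^sub>E b\<in>B. C b)"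
      by blast
  qed
  ultimately show ?thesis by (rule finite_subset[rotated])
qed

end

theory Submission
  imports Defs "HOL-Probability.Probability" "HOL-Complex_Analysis.Complex_Analysis"
begin

text \<open>
  Write q for exp(pi i z) and let A(q) be the sum of q^(v . v) over the vectors v of L. The
  lattice Z^n has the theta series theta(q)^n, where theta(q) is the sum of q^(k^2) over the
  integers k, and the proof compares L with Z^n through the quotient h = A / theta^n.

  Poisson summation for the self-dual lattice L (unimodular_poisson) says that A transforms
  under z -> -1/z by the same factor as theta^n. Hence h is invariant under the group generated
  by z -> z + 2 and z -> -1/z, which has the two cusps infinity and 1. At the cusp 1 the function
  A turns into the generating series of the characteristic vectors
  (lattice_theta_inversion), so that h(1 - 1/z) has the expansion
  2^(-n) (sum over w of X^(w . w - n)) (1 + ...) with X = exp(pi i z / 4). Invariance at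
  this cusp forces w . w = n mod 8 (characteristic_norm_mod_8), and short characteristic
  vectors are exactly the poles of h there.

  The function J = q - 24 q^2 + ... (hauptmodul) has the same invariance, vanishes at infinity,
  and its only pole is a simple one at the cusp 1, since theta has no zeros in the half-plane
  (theta_sq_nonzero). If no characteristic vector has norm below n - 16, then constants b and c
  can be chosen such that h - 1 - b J - c J^2 has no pole at the cusp 1. This difference vanishes
  at infinity, and an invariant function without poles that vanishes at a cusp is zero
  (modular_function_zero). So A = theta^n (1 + b J + c J^2), where c is 2^(24 - n) times the number
  of characteristic vectors of norm n - 16, and b is determined by the numbers for the norms
  n - 16 and n - 8 (lattice_theta_identity).

  Comparing coefficients of q and q^2 finishes the proof (theta_coefficients): as L has no vectors
  of norm 1, b = -2n, and the number of vectors of norm 2 is 2n(23 - n) + c. For n at most 23 the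
  congruence mod 8 excludes characteristic vectors of norm below n - 16, so (i) holds because
  c is nonnegative, and equality means c = 0, that is, no characteristic vectors of norm n - 16. For
  n at least 24 the bound (i) is negative; if there were no characteristic vectors of norm
  below n - 8, then the identity with c = 0 would yield a negative number of vectors of norm 2.
  When c = 0, the formula for b turns b = -2n into the count in (iii).
\<close>

section \<open>Poisson summation for Gaussians on the line\<close>

lemma summable_on_power_nat_abs_int:
  fixes r :: real
  assumes "0 < r" "r < 1"
  shows "(\<lambda>k::int. r ^ nat \<bar>k\<bar>) summable_on UNIV"
proof -
  have s: "(\<lambda>n::nat. r ^ n) summable_on UNIV"
    using assms by (intro summable_on_UNIV_nonneg_real_iff[THEN iffD2] summable_geometric) auto
  have "(\<lambda>k::int. r ^ nat \<bar>k\<bar>) summable_on range int"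
    by (subst summable_on_reindex) (auto simp: o_def s)
  moreover have "(\<lambda>k::int. r ^ nat \<bar>k\<bar>) summable_on range (\<lambda>n. - int n)"
    by (subst summable_on_reindex) (auto simp: o_def s inj_def)
  ultimately have "(\<lambda>k::int. r ^ nat \<bar>k\<bar>) summable_on (range int \<union> range (\<lambda>n. - int n))"
    by (rule summable_on_union)
  moreover have "range int \<union> range (\<lambda>n. - int n) = UNIV"
    by (auto simp: image_iff) (metis int_cases2)
  ultimately show ?thesis by simp
qed

lemma gauss_le_geometric:
  fixes a x C :: real and k :: int
  assumes "0 < a" "\<bar>x\<bar> \<le> C"
  shows "exp (- a * (of_int k + x)\<^sup>2) \<le> exp (a * (C + 1)) * exp (- a) ^ nat \<bar>k\<bar>"
proof -
  have "0 \<le> (\<bar>of_int k + x\<bar> - 1/2)\<^sup>2" by simp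
  then have "(of_int k + x)\<^sup>2 \<ge> \<bar>of_int k + x\<bar> - 1"
    by (simp add: power2_eq_square algebra_simps abs_if split: if_splits)
  moreover have "\<bar>of_int k + x\<bar> \<ge> \<bar>of_int k\<bar> - C" using assms(2) by linarith
  ultimately have "\<bar>of_int k\<bar> - (C + 1) \<le> (of_int k + x)\<^sup>2" by linarith
  then have "a * (\<bar>of_int k\<bar> - (C + 1)) \<le> a * (of_int k + x)\<^sup>2"
    using assms(1) by (intro mult_left_mono) auto
  then have "- a * (of_int k + x)\<^sup>2 \<le> a * (C + 1) + real (nat \<bar>k\<bar>) * - a"
    by (simp add: algebra_simps)
  then show ?thesis
    by (metis exp_add exp_le_cancel_iff exp_of_nat_mult)
qed

lemma gauss_summable:
  fixes a x :: real
  assumes "0 < a"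
  shows "(\<lambda>k::int. exp (- a * (of_int k + x)\<^sup>2)) summable_on UNIV"
proof (rule summable_on_comparison_test)
  show "(\<lambda>k::int. exp (a * (\<bar>x\<bar> + 1)) * exp (- a) ^ nat \<bar>k\<bar>) summable_on UNIV"
    by (intro summable_on_cmult_right summable_on_power_nat_abs_int) (use assms in auto)
  show "exp (- a * (of_int k + x)\<^sup>2) \<le> exp (a * (\<bar>x\<bar> + 1)) * exp (- a) ^ nat \<bar>k\<bar>" for k :: int
    by (rule gauss_le_geometric) (use assms in auto)
qed auto

text \<open>
  The kernels cos^(2N) (pi (x - p)) concentrate at p when N grows: a positive value of D near p
  contributes more than the rest of the interval can cancel.
\<close>

lemma fourier_unique_real:
  fixes D :: "real \<Rightarrow> real"
  assumes cont: "continuous_on {0..1} D"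
    and orth: "\<And>N. integral {0..1} (\<lambda>x. D x * cos (pi * (x - p)) ^ (2*N)) = 0"
    and p: "0 < p" "p < 1"
  shows "D p \<le> 0"
proof (rule ccontr)
  assume "\<not> D p \<le> 0"
  define e where "e = D p / 2"
  have e: "e > 0" "D p = 2 * e" using \<open>\<not> D p \<le> 0\<close> by (auto simp: e_def)
  obtain d0 where d0: "d0 > 0" "\<And>x. x \<in> {0..1} \<Longrightarrow> \<bar>x - p\<bar> < d0 \<Longrightarrow> \<bar>D x - D p\<bar> < e"
    using cont[unfolded continuous_on_iff, rule_format, of p e] p e(1)
    by (auto simp: dist_real_def)
  (* d is so small that D > e on [p - d, p + d] and that |x - p| is at most 1 - d on [0, 1]. *)
  define d where "d = min (d0/2) (min p (1 - p)) / 2"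
  have d: "d > 0" "d < d0" "2 * d \<le> p" "2 * d \<le> 1 - p" "d \<le> 1/4"
    using d0(1) p by (auto simp: d_def min_def)
  obtain M where M: "\<And>x. x \<in> {0..1} \<Longrightarrow> \<bar>D x\<bar> \<le> M" "M > 0"
    using compact_imp_bounded[OF compact_continuous_image[OF cont compact_Icc]]
    by (auto simp: bounded_pos) (metis atLeastAtMost_iff)
  (* The kernel is at most c1^(2N) at distance d or more from p, and at least c2^(2N) on [p, p + d/2]. *)
  define c1 where "c1 = cos (pi * d)"
  define c2 where "c2 = cos (pi * (d/2))"
  have pd: "0 < pi * d" "pi * d < pi / 2"
    using d mult_strict_left_mono[OF _ pi_gt_zero, of d "1/2"] by auto
  have c: "0 < c1" "c1 < c2"
    unfolding c1_def c2_def using pd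
    by (intro cos_gt_zero_pi cos_monotone_0_pi; linarith)+
  have cd: "\<bar>cos (pi * (x - p))\<bar> \<le> c1" if "x \<in> {0..1}" "\<bar>x - p\<bar> \<ge> d" for x
  proof -
    have x: "\<bar>x - p\<bar> \<le> 1 - d" using that p d by auto
    have 1: "cos (pi * (x - p)) = cos (pi * \<bar>x - p\<bar>)"
      using cos_minus[of "pi * (x - p)"] by (cases "x \<le> p") (simp_all add: algebra_simps)
    have "cos (pi * \<bar>x - p\<bar>) \<le> c1" unfolding c1_def
      using that x d by (intro cos_monotone_0_pi_le) (auto intro: mult_left_le)
    moreover have "cos (pi * (1 - d)) \<le> cos (pi * \<bar>x - p\<bar>)"
      using that x d by (intro cos_monotone_0_pi_le) (auto intro: mult_left_le)
    moreover have "cos (pi * (1 - d)) = - c1" by (simp add: c1_def algebra_simps cos_diff)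
    ultimately show ?thesis using 1 by auto
  qed
  have cd2: "c2 \<le> cos (pi * (x - p))" if "x \<in> {p..p + d/2}" for x
    unfolding c2_def using that d by (intro cos_monotone_0_pi_le) auto
  have ci: "(\<lambda>x. D x * cos (pi * (x - p)) ^ (2*N)) integrable_on {a..b}" if "0 \<le> a" "b \<le> 1" for N a b
    by (intro integrable_continuous_interval continuous_intros continuous_on_subset[OF cont])
       (use that in auto)
  have main: "e * (d/2) * c2 ^ (2*N) \<le> M * c1 ^ (2*N)" for N
  proof -
    let ?g = "\<lambda>x. D x * cos (pi * (x - p)) ^ (2*N)"
    define s where "s x = (if x \<in> {p..p+d/2} then e * c2 ^ (2*N) else 0) - M * c1 ^ (2*N)" for x
    have "s x \<le> ?g x" if x: "x \<in> {0..1}" for x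
    proof (cases "\<bar>x - p\<bar> \<ge> d")
      case True
      then have nx: "x \<notin> {p..p+d/2}" using d by auto
      have "\<bar>?g x\<bar> = \<bar>D x\<bar> * \<bar>cos (pi * (x - p))\<bar> ^ (2*N)" by (simp add: abs_mult power_abs)
      also have "\<dots> \<le> M * c1 ^ (2*N)"
        using M x True cd by (intro mult_mono power_mono) auto
      finally have "\<bar>?g x\<bar> \<le> M * c1 ^ (2*N)" .
      then show ?thesis using nx unfolding s_def by auto
    next
      case False
      then have D: "D x \<ge> e" using d0(2)[OF x] d e by auto
      show ?thesis
      proof (cases "x \<in> {p..p+d/2}")
        case True
        have "e * c2 ^ (2*N) \<le> ?g x"
          using D e c cd2[OF True] by (intro mult_mono power_mono) auto
        moreover have "0 \<le> M * c1 ^ (2*N)" using M(2) c by simp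
        ultimately show ?thesis using True by (simp add: s_def)
      next
        case F2: False
        have "0 \<le> ?g x" using D e by (intro mult_nonneg_nonneg) auto
        moreover have "0 \<le> M * c1 ^ (2*N)" using M(2) c by simp
        ultimately show ?thesis using F2 by (auto simp: s_def)
      qed
    qed note sle = this
    have sI: "(s has_integral e * c2 ^ (2*N) * (d/2) - M * c1 ^ (2*N)) {0..1}"
    proof -
      have "((\<lambda>x::real. e * c2 ^ (2*N)) has_integral (d/2) *\<^sub>R (e * c2 ^ (2*N))) {p..p+d/2}"
        using has_integral_const_real[of "e * c2 ^ (2*N)" p "p+d/2"] d by simp
      then have "((\<lambda>x::real. if x \<in> {p..p+d/2} then e * c2 ^ (2*N) else 0) has_integral (d/2) *\<^sub>R (e * c2 ^ (2*N))) {0..1}"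
        by (subst has_integral_restrict) (use d p in auto)
      from has_integral_diff[OF this has_integral_const_real[of "M * c1 ^ (2*N)" 0 1]]
      show ?thesis by (simp add: s_def[abs_def] mult_ac)
    qed
    have "e * c2 ^ (2*N) * (d/2) - M * c1 ^ (2*N) \<le> integral {0..1} ?g"
      using sle by (intro has_integral_le[OF sI integrable_integral[OF ci]]) auto
    then show ?thesis unfolding orth by (simp add: mult_ac)
  qed
  define r where "r = (c1/c2)\<^sup>2"
  have r: "0 \<le> r" "r < 1" using c by (auto simp: r_def power_divide abs_square_less_1 power_strict_mono)
  have "e * (d/2) / M \<le> r ^ N" for N
    using main[of N] M(2) c
    by (simp add: r_def power_divide power_mult field_simps) (simp add: power_mult[symmetric] mult.commute)
  moreover have "(\<lambda>N. r ^ N) \<longlonglongrightarrow> 0" using r by (intro LIMSEQ_realpow_zero) auto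
  ultimately have "e * (d/2) / M \<le> 0" by (intro LIMSEQ_le_const) auto
  then show False using e d M by (simp add: field_simps) (smt (verit) mult_pos_pos)
qed

text \<open>
  By the binomial theorem, cos^(2N) (pi (x - p)) is a trigonometric polynomial in x, so the integrals
  in the previous lemma vanish for the real and imaginary parts of D and for their negatives.
\<close>

lemma fourier_unique:
  fixes D :: "real \<Rightarrow> complex"
  assumes cont: "continuous_on {0..1} D"
    and orth: "\<And>m::int. integral {0..1} (\<lambda>x. D x * cis (- 2 * pi * of_int m * x)) = 0"
    and x: "x \<in> {0..1}"
  shows "D x = 0"
proof -
  have int: "(\<lambda>x. D x * of_real (g x)) integrable_on {0..1}" if "continuous_on {0..1} g" for g :: "real \<Rightarrow> real"
    by (intro integrable_continuous_interval continuous_intros cont that)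
  have zero: "integral {0..1} (\<lambda>x. D x * of_real (cos (pi * (x - p)) ^ (2*N))) = 0" for p N
  proof -
    have ex: "D x * of_real (cos (pi * (x - p)) ^ (2*N)) =
        (\<Sum>j\<le>2*N. (of_nat (2*N choose j) / 4^N * cis (2 * pi * (of_int (int N - int j)) * p)) *
           (D x * cis (- 2 * pi * of_int (int N - int j) * x)))" for x
    proof -
      define y where "y = pi * (x - p)"
      have four: "(2::complex) ^ (2*N) = 4 ^ N" by (simp add: power_mult)
      have "complex_of_real (cos y) = (cis y + cis (-y)) / 2"
        by (simp add: complex_eq_iff)
      then have "complex_of_real (cos y) ^ (2*N) = (cis y + cis (-y)) ^ (2*N) / 4 ^ N"
        by (simp only: power_divide four)
      also have "\<dots> = (\<Sum>j\<le>2*N. of_nat (2*N choose j) * cis y ^ j * cis (-y) ^ (2*N-j)) / 4^N"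
        by (simp add: binomial_ring)
      also have "\<dots> = (\<Sum>j\<le>2*N. of_nat (2*N choose j) / 4^N * (cis (2 * pi * (of_int (int N - int j)) * p)
           * cis (- 2 * pi * of_int (int N - int j) * x)))"
        unfolding sum_divide_distrib
      proof (rule sum.cong[OF refl])
        fix j assume "j \<in> {..2*N}"
        then have r: "real (2*N - j) = 2 * real N - real j" by (simp add: of_nat_diff)
        have "cis y ^ j * cis (-y) ^ (2*N-j) = cis (2 * pi * (of_int (int N - int j)) * p)
           * cis (- 2 * pi * of_int (int N - int j) * x)"
          unfolding Complex.DeMoivre cis_mult r by (rule arg_cong[where f = cis]) (simp add: y_def algebra_simps)
        then show "of_nat (2*N choose j) * cis y ^ j * cis (-y) ^ (2*N-j) / 4^N = of_nat (2*N choose j) / 4^N * (cis (2 * pi * (of_int (int N - int j)) * p)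
           * cis (- 2 * pi * of_int (int N - int j) * x))" 
          by (simp add: mult.assoc)
      qed
      finally show ?thesis unfolding y_def of_real_power by (simp add: sum_distrib_left mult_ac)
    qed
    show ?thesis unfolding ex
      by (subst integral_sum)
         (simp_all only: integral_mult_right orth mult_zero_right sum.neutral_const finite_atMost,
          auto intro!: integrable_continuous_interval continuous_intros cont)
  qed
  have zr: "integral {0..1} (\<lambda>x. h (D x) * cos (pi * (x - p)) ^ (2*N)) = 0"
    if h: "bounded_linear h" and hm: "\<And>z r. h (z * of_real r) = h z * r" for h :: "complex \<Rightarrow> real" and p N
  proof -
    have "integral {0..1} (h \<circ> (\<lambda>x. D x * of_real (cos (pi * (x - p)) ^ (2*N)))) = h 0"
      unfolding zero[of p N, symmetric]
      by (rule integral_linear[OF int h]) (intro continuous_intros)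
    moreover have "h 0 = 0" using h by (simp add: bounded_linear.linear linear_0)
    ultimately show ?thesis by (simp add: o_def hm del: of_real_power)
  qed
  have le: "h (D p) \<le> 0" if h: "bounded_linear h" and hm: "\<And>z r. h (z * of_real r) = h z * r"
     and p: "0 < p" "p < 1" for h :: "complex \<Rightarrow> real" and p
    by (rule fourier_unique_real[OF _ zr[OF h hm] p])
       (use h cont in \<open>auto intro: bounded_linear.continuous_on\<close>)
  have "D p = 0" if p: "0 < p" "p < 1" for p
  proof -
    have "Re (D p) \<le> 0" "- Re (D p) \<le> 0" "Im (D p) \<le> 0" "- Im (D p) \<le> 0"
      by (rule le[OF _ _ p]; auto intro: bounded_linear_Re bounded_linear_Im bounded_linear_minus)+
    then show ?thesis by (simp add: complex_eq_iff)
  qed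
  then have "D ` {0<..<1} \<subseteq> {0}" by auto
  then have "D ` closure {0<..<1} \<subseteq> {0}"
    by (intro image_closure_subset) (use cont in auto)
  then show ?thesis using x by (auto dest: subsetD[OF _ imageI])
qed

text \<open>
  A rescaling of the characteristic function of the standard normal distribution.
\<close>

lemma gauss_fourier_transform:
  fixes a m :: real
  assumes a: "0 < a"
  shows "has_bochner_integral lborel (\<lambda>u. of_real (exp (- pi * a * u\<^sup>2)) * cis (- 2 * pi * m * u))
    (of_real (exp (- pi * m\<^sup>2 / a) / sqrt a))"
proof -
  define c where "c = sqrt (2 * pi * a)"
  have c: "c > 0" "c\<^sup>2 = 2 * pi * a" "c = sqrt (2*pi) * sqrt a" using a by (auto simp: c_def simp flip: real_sqrt_mult)
  define t where "t = - 2 * pi * m / c"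
  have i: "integrable lborel (\<lambda>x. std_normal_density x *\<^sub>R iexp (t * x))"
    by (rule Bochner_Integration.integrable_bound[of _ std_normal_density])
       (auto simp: normal_density_nonneg)
  have "char std_normal_distribution t = (LINT x|lborel. std_normal_density x *\<^sub>R iexp (t * x))"
    unfolding char_def by (subst integral_density) (auto simp: normal_density_nonneg)
  then have "has_bochner_integral lborel (\<lambda>x. std_normal_density x *\<^sub>R iexp (t * x)) (of_real (exp (- (t^2) / 2)))"
    using i by (simp add: has_bochner_integral_iff char_std_normal_distribution)
  then have "has_bochner_integral lborel (\<lambda>x. std_normal_density (0 + c * x) *\<^sub>R iexp (t * (0 + c * x)))
      (of_real (exp (- (t^2) / 2)) /\<^sub>R \<bar>c\<bar>)"
    using c by (subst (asm) lborel_has_bochner_integral_real_affine_iff[of c _ _ 0]) auto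
  then have "has_bochner_integral lborel (\<lambda>x. of_real (sqrt (2*pi)) * (std_normal_density (0 + c * x) *\<^sub>R iexp (t * (0 + c * x))))
      (of_real (sqrt (2*pi)) * (of_real (exp (- (t^2) / 2)) /\<^sub>R \<bar>c\<bar>))"
    by (rule has_bochner_integral_mult_right)
  moreover have "of_real (sqrt (2*pi)) * (std_normal_density (0 + c * x) *\<^sub>R iexp (t * (0 + c * x)))
     = of_real (exp (- pi * a * x\<^sup>2)) * cis (- 2 * pi * m * x)" for x
  proof -
    have "sqrt (2*pi) * std_normal_density (0 + c * x) = exp (- pi * a * x\<^sup>2)"
      using c by (simp add: std_normal_density_def power_mult_distrib)
    moreover have "t * (0 + c * x) = - 2 * pi * m * x" using c(1) by (simp add: t_def)
    ultimately show ?thesis by (simp add: cis_conv_exp scaleR_conv_of_real flip: of_real_mult)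
  qed
  moreover have "t\<^sup>2 / 2 = pi * m\<^sup>2 / a" using a by (simp add: t_def power_divide c) (simp add: power2_eq_square field_simps)
  moreover have "of_real (sqrt (2*pi)) * (complex_of_real (exp (- (t^2) / 2)) /\<^sub>R \<bar>c\<bar>) = of_real (exp (- (t^2/2)) / sqrt a)"
    using c a by (simp add: scaleR_conv_of_real field_simps)
  ultimately show ?thesis by simp
qed

text \<open>
  Both sides are continuous functions of x with period 1, so it suffices to compare their
  Fourier coefficients. On the left, integrating the sum over a period unfolds to the integral of
  one Gaussian over the whole line.
\<close>

theorem gauss_poisson:
  fixes a x :: real
  assumes a: "0 < a"
  shows "of_real (\<Sum>\<^sub>\<infinity>k::int. exp (- pi * a * (of_int k + x)\<^sup>2)) =
    of_real (1 / sqrt a) * (\<Sum>\<^sub>\<infinity>k::int. of_real (exp (- pi * (of_int k)\<^sup>2 / a)) * cis (2 * pi * of_int k * x))"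
proof -
  define f where "f k x = exp (- pi * a * (of_int k + x)\<^sup>2)" for k :: int and x
  define g where "g k x = of_real (exp (- pi * (of_int k)\<^sup>2 / a)) * cis (2 * pi * of_int k * x)" for k :: int and x
  define F where "F x = (\<Sum>\<^sub>\<infinity>k. complex_of_real (f k x))" for x
  define G where "G x = (\<Sum>\<^sub>\<infinity>k. g k x)" for x
  have nb: "finite_subsets_at_top (UNIV::int set) \<noteq> bot" by simp
  have uF: "uniform_limit {0..1} (\<lambda>X x. \<Sum>k\<in>X. complex_of_real (f k x)) F (finite_subsets_at_top UNIV)"
    unfolding F_def
  proof (rule Weierstrass_m_test_general)
    show "norm (complex_of_real (f k x)) \<le> exp (pi * a * 2) * exp (- (pi * a)) ^ nat \<bar>k\<bar>"
      if "x \<in> {0..1}" for k x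
      using gauss_le_geometric[of "pi * a" x 1 k] that a by (simp add: f_def)
    show "(\<lambda>k::int. exp (pi * a * 2) * exp (- (pi * a)) ^ nat \<bar>k\<bar>) summable_on UNIV"
      by (intro summable_on_cmult_right summable_on_power_nat_abs_int) (use a in auto)
  qed
  have sG: "(\<lambda>k::int. exp (- pi * (of_int k)\<^sup>2 / a)) summable_on UNIV"
    using gauss_summable[of "pi / a" 0] a by simp
  have uG: "uniform_limit {0..1} (\<lambda>X x. \<Sum>k\<in>X. g k x) G (finite_subsets_at_top UNIV)"
    unfolding G_def
    by (rule Weierstrass_m_test_general[OF _ sG]) (simp add: g_def norm_mult)
  have cf: "continuous_on S (\<lambda>x. complex_of_real (f k x))" "continuous_on S (g k)" for k S
    unfolding f_def g_def by (intro continuous_intros)+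
  have contF: "continuous_on {0..1} F"
    by (rule uniform_limit_theorem[OF _ uF]) (auto intro!: always_eventually continuous_intros cf)
  have contG: "continuous_on {0..1} G"
    by (rule uniform_limit_theorem[OF _ uG]) (auto intro!: always_eventually continuous_intros cf)
  define D where "D x = F x - of_real (1 / sqrt a) * G x" for x
  (* Uniform convergence permits integration term by term. *)
  have coeff: "((\<lambda>k. integral {0..1} (\<lambda>x. h k x * c x)) has_sum integral {0..1} (\<lambda>x. H x * c x)) UNIV"
    if u: "uniform_limit {0..1} (\<lambda>X x. \<Sum>k\<in>X. h k x) H (finite_subsets_at_top UNIV)"
      and ch: "\<And>k. continuous_on {0..1} (h k)" and cH: "continuous_on {0..1} H"
      and cc: "continuous_on {0..1} c" for h :: "int \<Rightarrow> real \<Rightarrow> complex" and H c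
  proof -
    have "uniform_limit {0..1} (\<lambda>X x. (\<Sum>k\<in>X. h k x) * c x) (\<lambda>x. H x * c x) (finite_subsets_at_top UNIV)"
      by (intro uniform_lim_mult u uniform_limit_const compact_imp_bounded compact_continuous_image cH cc) auto
    then obtain I J where IJ: "\<And>X. ((\<lambda>x. (\<Sum>k\<in>X. h k x) * c x) has_integral I X) {0..1}"
        "((\<lambda>x. H x * c x) has_integral J) {0..1}" "(I \<longlongrightarrow> J) (finite_subsets_at_top UNIV)"
      by (rule uniform_limit_integral) (auto intro!: continuous_intros ch cc)
    have "I X = (\<Sum>k\<in>X. integral {0..1} (\<lambda>x. h k x * c x))" if "finite X" for X
      unfolding IJ(1)[THEN integral_unique, symmetric] sum_distrib_right
      by (intro integral_sum that integrable_continuous_interval continuous_intros ch cc)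
    then have "eventually (\<lambda>X. I X = (\<Sum>k\<in>X. integral {0..1} (\<lambda>x. h k x * c x))) (finite_subsets_at_top UNIV)"
      by (intro eventually_finite_subsets_at_top_weakI) auto
    with IJ(3) have "((\<lambda>X. \<Sum>k\<in>X. integral {0..1} (\<lambda>x. h k x * c x)) \<longlongrightarrow> J) (finite_subsets_at_top UNIV)"
      by (rule Lim_transform_eventually)
    then show ?thesis unfolding has_sum_def IJ(2)[THEN integral_unique] .
  qed
  have "D x = 0" if "x \<in> {0..1}" for x
  proof (rule fourier_unique[OF _ _ that])
    show "continuous_on {0..1} D" unfolding D_def by (intro continuous_intros contF contG)
    fix m :: int
    define c where "c x = cis (- 2 * pi * of_int m * x)" for x
    have cc: "continuous_on S c" for S unfolding c_def by (intro continuous_intros)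
    define \<phi> where "\<phi> u = of_real (exp (- pi * a * u\<^sup>2)) * cis (- 2 * pi * of_int m * u)" for u :: real
    have c\<phi>: "continuous_on S \<phi>" for S unfolding \<phi>_def by (intro continuous_intros)
    have ft: "has_bochner_integral lborel \<phi> (of_real (exp (- pi * (of_int m)\<^sup>2 / a) / sqrt a))"
      using gauss_fourier_transform[OF a, of "of_int m"] by (simp add: \<phi>_def[abs_def])
    (* A translation by k turns the k-th term over [0, 1] into the Gaussian over [k, k + 1]. *)
    have shift: "integral {0..1} (\<lambda>x. of_real (f k x) * c x) = integral {of_int k..of_int k + 1} \<phi>" for k
    proof -
      have "c x = cis (- 2 * pi * of_int m * (of_int k + x))" for x
      proof -
        have "cis (- 2 * pi * of_int m * (of_int k + x)) = cis (2 * pi * of_int (- m * k)) * c x"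
          unfolding c_def cis_mult by (simp add: algebra_simps)
        moreover have "cis (2 * pi * of_int (- m * k)) = 1" by (rule cis_multiple_2pi) simp
        ultimately show ?thesis by simp
      qed
      then have "(\<lambda>x. of_real (f k x) * c x) = (\<lambda>x. \<phi> (x + of_int k))"
        by (auto simp: \<phi>_def f_def add.commute)
      moreover have "integral {0..1} (\<lambda>x. \<phi> (x + of_int k)) = integral {of_int k..of_int k + 1} \<phi>"
        using integral_shift_Icc_real[of 0 1 \<phi> "of_int k"] by (simp add: o_def add.commute)
      ultimately show ?thesis by simp
    qed
    have part: "(\<Sum>k\<in>{- int N..<int N}. integral {of_int k..of_int k + 1} \<phi>) = integral {- real N..real N} \<phi>" for N
    proof (induction N)
      case (Suc N)
      have s: "{- int (Suc N)..<int (Suc N)} = insert (- int (Suc N)) (insert (int N) {- int N..<int N})" by auto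
      have "integral {- real (Suc N)..real (Suc N)} \<phi> = integral {- real (Suc N)..- real N} \<phi> + integral {- real N..real (Suc N)} \<phi>"
        by (rule Henstock_Kurzweil_Integration.integral_combine[symmetric]) (auto intro!: integrable_continuous_interval c\<phi>)
      also have "integral {- real N..real (Suc N)} \<phi> = integral {- real N..real N} \<phi> + integral {real N..real (Suc N)} \<phi>"
        by (rule Henstock_Kurzweil_Integration.integral_combine[symmetric]) (auto intro!: integrable_continuous_interval c\<phi>)
      finally show ?case unfolding s using Suc.IH by (simp add: algebra_simps)
    qed simp
    have seq: "filterlim (\<lambda>N. {- int N..<int N}) (finite_subsets_at_top UNIV) sequentially"
      unfolding filterlim_finite_subsets_at_top
    proof (intro allI impI, elim conjE)
      fix X :: "int set" assume "finite X"
      then have "\<bar>x\<bar> \<le> (\<Sum>x\<in>X. \<bar>x\<bar>)" if "x \<in> X" for x using that by (intro member_le_sum) auto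
      then obtain B where B: "\<And>x. x \<in> X \<Longrightarrow> \<bar>x\<bar> < B" by (meson zle_add1_eq_le)
      show "\<forall>\<^sub>F N in sequentially. finite {- int N..<int N} \<and> X \<subseteq> {- int N..<int N} \<and> {- int N..<int N} \<subseteq> UNIV"
        using eventually_ge_at_top[of "nat B"] by eventually_elim (use B in force)
    qed
    have hsF: "((\<lambda>k. integral {0..1} (\<lambda>x. of_real (f k x) * c x)) has_sum integral {0..1} (\<lambda>x. F x * c x)) UNIV"
      by (rule coeff[OF uF cf(1) contF cc])
    have "(\<lambda>N. integral {- real N..real N} \<phi>) \<longlonglongrightarrow> integral {0..1} (\<lambda>x. F x * c x)"
      using filterlim_compose[OF hsF[unfolded has_sum_def] seq] by (simp add: shift part)
    moreover have "(\<lambda>N. integral {- real N..real N} \<phi>) \<longlonglongrightarrow> of_real (exp (- pi * (of_int m)\<^sup>2 / a) / sqrt a)"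
    proof -
      have [measurable]: "\<phi> \<in> borel_measurable borel" by (intro borel_measurable_continuous_onI c\<phi>)
      have "(\<lambda>N. LINT u|lborel. indicator {- real N..real N} u *\<^sub>R \<phi> u) \<longlonglongrightarrow> (LINT u|lborel. \<phi> u)"
      proof (rule integral_dominated_convergence)
        show "integrable lborel (\<lambda>u. norm (\<phi> u))"
          using ft by (auto simp: has_bochner_integral_iff)
        show "AE u in lborel. (\<lambda>N. indicator {- real N..real N} u *\<^sub>R \<phi> u) \<longlonglongrightarrow> \<phi> u"
        proof (rule AE_I2)
          fix u
          have "eventually (\<lambda>N. indicator {- real N..real N} u *\<^sub>R \<phi> u = \<phi> u) sequentially"
            using eventually_ge_at_top[of "nat \<lceil>\<bar>u\<bar>\<rceil>"]
          proof eventually_elim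
            case (elim N)
            then have "\<bar>u\<bar> \<le> real N" by linarith
            then show ?case by (simp add: abs_le_iff)
          qed
          then show "(\<lambda>N. indicator {- real N..real N} u *\<^sub>R \<phi> u) \<longlonglongrightarrow> \<phi> u"
            by (rule tendsto_eventually)
        qed
      qed (auto split: split_indicator)
      moreover have "(LINT u|lborel. indicator {- real N..real N} u *\<^sub>R \<phi> u) = integral {- real N..real N} \<phi>" for N
        using set_borel_integral_eq_integral(2)[of "{- real N..real N}" \<phi>] borel_integrable_atLeastAtMost'[OF c\<phi>]
        by (simp add: set_lebesgue_integral_def)
      ultimately show ?thesis using ft by (simp add: has_bochner_integral_iff)
    qed
    ultimately have cF: "integral {0..1} (\<lambda>x. F x * c x) = of_real (exp (- pi * (of_int m)\<^sup>2 / a) / sqrt a)"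
      by (rule LIMSEQ_unique)
    (* Orthogonality of the characters isolates the m-th term of the right-hand side. *)
    have gm: "integral {0..1} (\<lambda>x. g k x * c x) = (if k = m then of_real (exp (- pi * (of_int m)\<^sup>2 / a)) else 0)" for k
    proof -
      have e: "g k x * c x = of_real (exp (- pi * (of_int k)\<^sup>2 / a)) * cis (2 * pi * of_int (k - m) * x)" for x
        by (simp add: g_def c_def cis_mult mult.assoc) (simp add: algebra_simps)
      show ?thesis
      proof (cases "k = m")
        case False
        define w where "w = 2 * pi * of_int (k - m)"
        have w: "w \<noteq> 0" using False by (simp add: w_def)
        have "((\<lambda>x. cis (w * x)) has_integral (cis (w * 1) / (\<i> * w) - cis (w * 0) / (\<i> * w))) {0..1}"
        proof (rule fundamental_theorem_of_calculus)
          fix x :: real assume "x \<in> {0..1}"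
          have "((\<lambda>x. exp (\<i> * w * of_real x) / (\<i> * w)) has_vector_derivative exp (\<i> * w * of_real x)) (at x within {0..1})"
            using w by (auto intro!: derivative_eq_intros has_vector_derivative_real_field)
          then show "((\<lambda>x. cis (w * x) / (\<i> * w)) has_vector_derivative cis (w * x)) (at x within {0..1})"
            by (simp add: cis_conv_exp mult_ac)
        qed simp
        moreover have "cis w = 1" unfolding w_def by (rule cis_multiple_2pi) auto
        ultimately have "integral {0..1} (\<lambda>x. cis (w * x)) = 0" by (simp add: integral_unique)
        then show ?thesis unfolding e using False by (simp add: w_def)
      next
        case True
        then show ?thesis unfolding e by simp
      qed
    qed
    have "((\<lambda>k. integral {0..1} (\<lambda>x. g k x * c x)) has_sum integral {0..1} (\<lambda>x. G x * c x)) UNIV"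
      by (rule coeff[OF uG cf(2) contG cc])
    moreover have "((\<lambda>k. integral {0..1} (\<lambda>x. g k x * c x)) has_sum of_real (exp (- pi * (of_int m)\<^sup>2 / a))) UNIV"
      unfolding gm by (rule has_sum_finite_neutralI[of "{m}"]) auto
    ultimately have cG: "integral {0..1} (\<lambda>x. G x * c x) = of_real (exp (- pi * (of_int m)\<^sup>2 / a))"
      by (rule has_sum_unique)
    have "integral {0..1} (\<lambda>x. D x * c x) = integral {0..1} (\<lambda>x. F x * c x - of_real (1 / sqrt a) * (G x * c x))"
      by (simp add: D_def algebra_simps)
    also have "\<dots> = integral {0..1} (\<lambda>x. F x * c x) - of_real (1 / sqrt a) * integral {0..1} (\<lambda>x. G x * c x)"
      using a by (subst integral_diff) (auto intro!: integrable_continuous_interval continuous_intros contF contG cc simp: integral_mult_right)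
    also have "\<dots> = 0" unfolding cF cG by simp
    finally show "integral {0..1} (\<lambda>x. D x * cis (- 2 * pi * of_int m * x)) = 0" by (simp add: c_def)
  qed
  then have FG: "F x = of_real (1 / sqrt a) * G x" if "x \<in> {0..1}" for x using that by (simp add: D_def)
  have per: "F x = F (frac x)" "G x = G (frac x)"
  proof -
    have "f k x = f (k + \<lfloor>x\<rfloor>) (frac x)" for k by (simp add: f_def frac_def algebra_simps)
    then have "F x = (\<Sum>\<^sub>\<infinity>k. complex_of_real (f (k + \<lfloor>x\<rfloor>) (frac x)))" by (simp add: F_def)
    also have "\<dots> = F (frac x)" unfolding F_def
      using infsum_reindex_bij_betw[of "\<lambda>k. k + \<lfloor>x\<rfloor>" UNIV UNIV "\<lambda>k. complex_of_real (f k (frac x))"]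
      by (simp add: bij_plus_right)
    finally show "F x = F (frac x)" .
    have "cis (2 * pi * of_int k * x) = cis (2 * pi * of_int k * frac x)" for k
    proof -
      have "cis (2 * pi * of_int k * x) = cis (2 * pi * of_int k * frac x) * cis (2 * pi * of_int (k * \<lfloor>x\<rfloor>))"
        unfolding cis_mult by (simp add: frac_def algebra_simps)
      then show ?thesis by (simp add: cis_multiple_2pi)
    qed
    then show "G x = G (frac x)" by (simp add: G_def g_def)
  qed
  have "F x = of_real (1 / sqrt a) * G x"
    unfolding per by (rule FG) (auto simp: frac_ge_0 less_imp_le[OF frac_lt_1])
  moreover have "F x = of_real (\<Sum>\<^sub>\<infinity>k. f k x)"
    unfolding F_def using gauss_summable[of "pi * a" x] a
    by (intro infsumI has_sum_of_real has_sum_infsum) (simp add: f_def)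
  ultimately show ?thesis by (simp add: f_def g_def G_def)
qed

section \<open>Counting series and truncated expansions\<close>

text \<open>
  All theta series below count the elements s of a set by a natural number: the exponent of q is
  the norm of a lattice vector, the square of an integer, or k^2 + k.
\<close>

definition wt_series :: "'s set \<Rightarrow> ('s \<Rightarrow> nat) \<Rightarrow> complex \<Rightarrow> complex" where
  "wt_series S \<nu> q = (\<Sum>\<^sub>\<infinity>s\<in>S. q ^ \<nu> s)"

definition wt_summable :: "'s set \<Rightarrow> ('s \<Rightarrow> nat) \<Rightarrow> bool" where
  "wt_summable S \<nu> \<longleftrightarrow> (\<forall>r::real. 0 < r \<longrightarrow> r < 1 \<longrightarrow> (\<lambda>s. r ^ \<nu> s) summable_on S)"

lemma wt_summable_finite:
  assumes "wt_summable S \<nu>"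
  shows "finite {s \<in> S. \<nu> s = m}"
proof (rule ccontr)
  define I where "I = (\<Sum>\<^sub>\<infinity>s\<in>S. (1/2::real) ^ \<nu> s)"
  have sm: "(\<lambda>s. (1/2::real) ^ \<nu> s) summable_on S" using assms unfolding wt_summable_def by (elim allE[of _ "1/2"]) auto
  assume "infinite {s \<in> S. \<nu> s = m}"
  then obtain T where T: "finite T" "card T = nat \<lceil>I * 2 ^ m\<rceil> + 1" "T \<subseteq> {s \<in> S. \<nu> s = m}"
    using infinite_arbitrarily_large by blast
  have "(\<Sum>s\<in>T. (1/2::real) ^ \<nu> s) = (\<Sum>s\<in>T. (1/2) ^ m)" by (rule sum.cong) (use T(3) in auto)
  also have "\<dots> = real (card T) / 2 ^ m" by (simp add: power_one_over)
  finally have "real (card T) / 2 ^ m = (\<Sum>s\<in>T. (1/2::real) ^ \<nu> s)" by (rule sym)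
  also have "\<dots> \<le> I"
    unfolding I_def by (rule finite_sum_le_infsum[OF sm T(1)]) (use T(3) in auto)
  finally have "real (card T) / 2 ^ m \<le> I" .
  then have "real (card T) \<le> I * 2 ^ m" by (simp add: divide_le_eq)
  then show False using T(2) by linarith
qed

lemma wt_series_abs_summable:
  fixes q :: complex
  assumes "wt_summable S \<nu>" "norm q < 1"
  shows "(\<lambda>s. norm (q ^ \<nu> s)) summable_on S"
proof (rule summable_on_comparison_test)
  show "(\<lambda>s. ((norm q + 1) / 2) ^ \<nu> s) summable_on S"
    using assms unfolding wt_summable_def by (elim allE[of _ "(norm q + 1) / 2"]) (auto simp: add_nonneg_pos)
  show "norm (q ^ \<nu> s) \<le> ((norm q + 1) / 2) ^ \<nu> s" for s
    using assms(2) power_mono[of "norm q" "(norm q + 1) / 2" "\<nu> s"] by (simp add: norm_power)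
qed auto

lemma wt_series_has_sum:
  assumes "wt_summable S \<nu>" "norm q < 1"
  shows "((\<lambda>s. q ^ \<nu> s) has_sum wt_series S \<nu> q) S"
  unfolding wt_series_def by (rule has_sum_infsum[OF abs_summable_summable[OF wt_series_abs_summable[OF assms]]])

text \<open>
  Grouping the terms by their exponent gives a power series with the cardinalities of the
  fibres as coefficients. This is how the numbers of vectors of given norm enter.
\<close>

lemma wt_series_sums:
  assumes "wt_summable S \<nu>" "norm q < 1"
  shows "(\<lambda>m. of_nat (card {s \<in> S. \<nu> s = m}) * q ^ m) sums wt_series S \<nu> q"
proof -
  have bij: "bij_betw (\<lambda>s. (\<nu> s, s)) S (SIGMA m:UNIV. {s \<in> S. \<nu> s = m})"
    by (rule bij_betwI[where g = snd]) auto
  have "((\<lambda>(m,s). q ^ m) has_sum wt_series S \<nu> q) (SIGMA m:UNIV. {s \<in> S. \<nu> s = m})"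
    using wt_series_has_sum[OF assms] has_sum_reindex_bij_betw[OF bij, of "\<lambda>(m,s). q ^ m"] by simp
  then have "((\<lambda>m. of_nat (card {s \<in> S. \<nu> s = m}) * q ^ m) has_sum wt_series S \<nu> q) UNIV"
    by (rule has_sum_SigmaD) (auto intro!: has_sum_finiteI wt_summable_finite[OF assms(1)])
  then show ?thesis by (rule has_sum_imp_sums)
qed

lemma wt_series_holomorphic:
  assumes "wt_summable S \<nu>"
  shows "wt_series S \<nu> holomorphic_on ball 0 1"
  by (rule power_series_holomorphic[where a = "\<lambda>m. of_nat (card {s \<in> S. \<nu> s = m})"])
     (use wt_series_sums[OF assms] in simp)

lemma power_series_remainder_bigo:
  fixes f :: "complex \<Rightarrow> complex"
  assumes "\<And>q. norm q < 1 \<Longrightarrow> (\<lambda>m. c m * q ^ m) sums f q"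
  shows "(\<lambda>q. f q - (\<Sum>m<N. c m * q ^ m)) \<in> O[at 0](\<lambda>q. q ^ N)"
proof -
  define g where "g q = (\<Sum>m. c (m + N) * q ^ m)" for q
  have sg: "(\<lambda>m. c (m + N) * q ^ m) sums g q" if "norm q < 1" for q
  proof (cases "q = 0")
    case False
    have "(\<lambda>m. c (m + N) * q ^ (m + N)) sums (f q - (\<Sum>m<N. c m * q ^ m))"
      using assms[OF that] by (rule sums_split_initial_segment)
    then have "(\<lambda>m. c (m + N) * q ^ (m + N) / q ^ N) sums ((f q - (\<Sum>m<N. c m * q ^ m)) / q ^ N)"
      by (rule sums_divide)
    then have "summable (\<lambda>m. c (m + N) * q ^ m)" using False by (simp add: power_add sums_iff)
    then show ?thesis unfolding g_def by (rule summable_sums)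
  next
    case True
    have "(\<lambda>m. c (m + N) * 0 ^ m) sums (c (0 + N))"
      using powser_sums_zero[of "\<lambda>m. c (m + N)"] by simp
    then show ?thesis unfolding g_def True by (simp add: sums_iff)
  qed
  have eq: "f q - (\<Sum>m<N. c m * q ^ m) = g q * q ^ N" if "norm q < 1" for q
  proof -
    have "(\<lambda>m. c (m + N) * q ^ (m + N)) sums (f q - (\<Sum>m<N. c m * q ^ m))"
      using assms[OF that] by (rule sums_split_initial_segment)
    moreover have "(\<lambda>m. c (m + N) * q ^ (m + N)) sums (g q * q ^ N)"
      using sums_mult2[OF sg[OF that], of "q ^ N"] by (simp add: power_add mult.assoc)
    ultimately show ?thesis by (rule sums_unique2)
  qed
  have "g holomorphic_on ball 0 1"
    by (rule power_series_holomorphic[where a = "\<lambda>m. c (m + N)"]) (use sg in simp)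
  then have "isCont g 0"
    by (metis centre_in_ball continuous_on_eq_continuous_at holomorphic_on_imp_continuous_on open_ball zero_less_one)
  then have "g \<in> O[at 0](\<lambda>_. 1)"
    by (intro bigoI_tendsto[where c = "g 0"]) (auto simp: isCont_def)
  then have "(\<lambda>q. g q * q ^ N) \<in> O[at 0](\<lambda>q. 1 * q ^ N)"
    by (rule landau_o.big.mult) simp
  moreover have "eventually (\<lambda>q. f q - (\<Sum>m<N. c m * q ^ m) = g q * q ^ N) (at 0)"
    using eventually_at_ball[of 1 "0::complex" UNIV] by (auto elim!: eventually_mono simp: eq)
  ultimately show ?thesis by (subst landau_o.big.in_cong) auto
qed

lemma wt_series_remainder:
  assumes "wt_summable S \<nu>"
  shows "(\<lambda>q. wt_series S \<nu> q - (\<Sum>m<N. of_nat (card {s \<in> S. \<nu> s = m}) * q ^ m)) \<in> O[at 0](\<lambda>q. q ^ N)"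
  by (rule power_series_remainder_bigo) (rule wt_series_sums[OF assms])

text \<open>
  An expansion of f up to order N in a parameter u that tends to 0 along F, as a polynomial. Only the
  coefficients below N matter, so products need no truncation. At the cusp infinity u is the nome
  q, at the other cusp it is the eighth power of the local parameter.
\<close>

definition jet :: "'x filter \<Rightarrow> ('x \<Rightarrow> complex) \<Rightarrow> nat \<Rightarrow> ('x \<Rightarrow> complex) \<Rightarrow> complex poly \<Rightarrow> bool" where
  "jet F u N f p \<longleftrightarrow> (\<lambda>x. f x - poly p (u x)) \<in> O[F](\<lambda>x. u x ^ N)"

lemma poly_in_bigo_1:
  assumes "(u \<longlongrightarrow> (0::complex)) F"
  shows "(\<lambda>x. poly p (u x)) \<in> O[F](\<lambda>_. 1)"
proof (cases "F = bot")
  case False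
  have "((\<lambda>x. poly p (u x)) \<longlongrightarrow> poly p 0) F" by (intro tendsto_intros assms)
  then show ?thesis by (intro bigoI_tendsto[where c = "poly p 0"]) auto
qed simp

lemma jet_mult:
  assumes u: "(u \<longlongrightarrow> (0::complex)) F" and "jet F u N f p" "jet F u N g r"
  shows "jet F u N (\<lambda>x. f x * g x) (p * r)"
proof -
  have pw: "(\<lambda>x. u x ^ N) \<in> O[F](\<lambda>_. 1)"
    using poly_in_bigo_1[OF u, of "monom 1 N"] by (simp add: poly_monom)
  have "(\<lambda>x. (g x - poly r (u x)) + poly r (u x)) \<in> O[F](\<lambda>_. 1)"
    by (rule sum_in_bigo(1)[OF landau_o.big_trans[OF assms(3)[unfolded jet_def] pw] poly_in_bigo_1[OF u]])
  then have g1: "g \<in> O[F](\<lambda>_. 1)" by simp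
  have "(\<lambda>x. (f x - poly p (u x)) * g x) \<in> O[F](\<lambda>x. u x ^ N * 1)"
    using assms(2) g1 unfolding jet_def by (rule landau_o.big.mult)
  moreover have "(\<lambda>x. poly p (u x) * (g x - poly r (u x))) \<in> O[F](\<lambda>x. 1 * u x ^ N)"
    using poly_in_bigo_1[OF u] assms(3) unfolding jet_def by (rule landau_o.big.mult)
  ultimately have "(\<lambda>x. (f x - poly p (u x)) * g x + poly p (u x) * (g x - poly r (u x))) \<in> O[F](\<lambda>x. u x ^ N)"
    by (intro sum_in_bigo) auto
  then show ?thesis unfolding jet_def by (simp add: algebra_simps)
qed

lemma jet_poly: "jet F u N (\<lambda>x. poly p (u x)) p"
  by (simp add: jet_def)

lemma jet_const: "jet F u N (\<lambda>x. c) [:c:]"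
  by (simp add: jet_def)

lemma jet_power:
  assumes u: "(u \<longlongrightarrow> (0::complex)) F" and "jet F u N f p"
  shows "jet F u N (\<lambda>x. f x ^ m) (p ^ m)"
proof (induction m)
  case 0
  show ?case using jet_const[of F u N 1] by (simp add: one_pCons)
next
  case (Suc m)
  show ?case using jet_mult[OF u assms(2) Suc] by simp
qed

lemma jet_add: "jet F u N f p \<Longrightarrow> jet F u N g r \<Longrightarrow> jet F u N (\<lambda>x. f x + g x) (p + r)"
  unfolding jet_def by (drule (1) sum_in_bigo(1)) (simp add: algebra_simps)

lemma jet_diff: "jet F u N f p \<Longrightarrow> jet F u N g r \<Longrightarrow> jet F u N (\<lambda>x. f x - g x) (p - r)"
  unfolding jet_def by (drule (1) sum_in_bigo(2)) (simp add: algebra_simps)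

lemma poly_bigo_coeffs:
  assumes u: "(u \<longlongrightarrow> (0::complex)) F" and "\<And>i. i < N \<Longrightarrow> coeff p i = 0"
  shows "(\<lambda>x. poly p (u x)) \<in> O[F](\<lambda>x. u x ^ N)"
proof -
  have "monom 1 N dvd p"
    using assms(2) by (subst monom_1_dvd_iff') auto
  then obtain r where r: "p = monom 1 N * r" by (elim dvdE)
  have "(\<lambda>x. u x ^ N * poly r (u x)) \<in> O[F](\<lambda>x. u x ^ N * 1)"
    by (rule landau_o.big.mult[OF landau_o.big_refl poly_in_bigo_1[OF u]])
  then show ?thesis by (simp add: r poly_monom)
qed

lemma jet_zero_bigo:
  assumes u: "(u \<longlongrightarrow> (0::complex)) F" and "jet F u N f p" "\<And>i. i < N \<Longrightarrow> coeff p i = 0"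
  shows "f \<in> O[F](\<lambda>x. u x ^ N)"
proof -
  have "(\<lambda>x. (f x - poly p (u x)) + poly p (u x)) \<in> O[F](\<lambda>x. u x ^ N)"
    by (rule sum_in_bigo(1)[OF assms(2)[unfolded jet_def] poly_bigo_coeffs[OF u assms(3)]])
  then show ?thesis by simp
qed

text \<open>
  The lowest nonvanishing term of a polynomial in u cannot be compensated by higher powers of u.
\<close>

lemma jet_unique_zero:
  assumes u: "filterlim u (at (0::complex)) F" and nb: "F \<noteq> bot" and j: "jet F u N (\<lambda>x. 0) p" and i: "i < N"
  shows "coeff p i = 0"
  using i
proof (induction i rule: less_induct)
  case (less i)
  have u0: "(u \<longlongrightarrow> 0) F" using u unfolding filterlim_at by blast
  have une: "eventually (\<lambda>x. u x \<noteq> 0) F" using u unfolding filterlim_at by (elim conjE) (erule eventually_mono, blast)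
  have "coeff p k = 0" if "k < i" for k by (rule less.IH[OF that]) (use that less.prems in linarith)
  then have "monom 1 i dvd p" by (subst monom_1_dvd_iff') blast
  then obtain r where r: "p = monom 1 i * r" by (elim dvdE)
  have "(\<lambda>x. u x ^ i * poly r (u x)) \<in> O[F](\<lambda>x. u x ^ N)"
    using j unfolding jet_def r by (simp add: poly_monom)
  moreover have "(\<lambda>x. u x ^ N) \<in> o[F](\<lambda>x. u x ^ i)"
  proof (rule smalloI_tendsto)
    have "(0::complex) ^ (N - i) = 0" using less.prems by simp
    then have "((\<lambda>x. u x ^ (N - i)) \<longlongrightarrow> 0) F" using tendsto_power[OF u0, of "N - i"] by metis
    then show "((\<lambda>x. u x ^ N / u x ^ i) \<longlongrightarrow> 0) F"
    proof (rule Lim_transform_eventually)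
      show "\<forall>\<^sub>F x in F. u x ^ (N - i) = u x ^ N / u x ^ i"
        using une by eventually_elim (use less.prems in \<open>simp add: power_diff\<close>)
    qed
    show "\<forall>\<^sub>F x in F. u x ^ i \<noteq> 0" using une by eventually_elim simp
  qed
  ultimately have "(\<lambda>x. u x ^ i * poly r (u x)) \<in> o[F](\<lambda>x. u x ^ i)"
    by (rule landau_o.big_small_trans)
  then have "((\<lambda>x. u x ^ i * poly r (u x) / u x ^ i) \<longlongrightarrow> 0) F" by (rule smalloD_tendsto)
  then have "((\<lambda>x. poly r (u x)) \<longlongrightarrow> 0) F"
  proof (rule Lim_transform_eventually)
    show "\<forall>\<^sub>F x in F. u x ^ i * poly r (u x) / u x ^ i = poly r (u x)"
      using une by eventually_elim simp
  qed
  moreover have "((\<lambda>x. poly r (u x)) \<longlongrightarrow> poly r 0) F" by (intro tendsto_intros u0)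
  ultimately have "poly r 0 = 0" using nb tendsto_unique by blast
  then show ?case by (simp add: r coeff_monom_mult poly_0_coeff_0)
qed

section \<open>Poisson summation for unimodular lattices\<close>

definition gauss :: "real \<Rightarrow> 'a::real_normed_vector \<Rightarrow> real" where
  "gauss t w = exp (- pi * t * (norm w)\<^sup>2)"

lemma gauss_pos: "gauss t w > 0" by (simp add: gauss_def)

lemma summable_on_prod_PiE:
  fixes f :: "'a \<Rightarrow> 'b \<Rightarrow> real"
  assumes "finite A" and "\<And>x. x \<in> A \<Longrightarrow> f x summable_on B x" and nn: "\<And>x y. 0 \<le> f x y"
  shows "(\<lambda>g. \<Prod>x\<in>A. f x (g x)) summable_on PiE A B"
proof (rule nonneg_bdd_above_summable_on)
  show "bdd_above (sum (\<lambda>g. \<Prod>x\<in>A. f x (g x)) ` {P. P \<subseteq> PiE A B \<and> finite P})"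
  proof (rule bdd_aboveI2)
    fix P assume "P \<in> {P. P \<subseteq> PiE A B \<and> finite P}"
    then have P: "P \<subseteq> PiE A B" "finite P" by auto
    define B' where "B' x = (\<lambda>p. p x) ` P" for x
    have "P \<subseteq> PiE A B'" using P by (auto simp: B'_def PiE_def extensional_def Pi_def)
    moreover have fin: "finite (B' x)" for x using P by (simp add: B'_def)
    ultimately have "(\<Sum>g\<in>P. \<Prod>x\<in>A. f x (g x)) \<le> (\<Sum>g\<in>PiE A B'. \<Prod>x\<in>A. f x (g x))"
      using assms(1) by (intro sum_mono2 finite_PiE prod_nonneg nn ballI) auto
    also have "\<dots> = (\<Prod>x\<in>A. \<Sum>y\<in>B' x. f x y)"
      using assms(1) fin by (simp add: prod_sum_PiE)
    also have "\<dots> \<le> (\<Prod>x\<in>A. infsum (f x) (B x))"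
    proof (intro prod_mono conjI sum_nonneg nn)
      fix x assume "x \<in> A"
      then have "B' x \<subseteq> B x" using P by (auto simp: B'_def)
      then show "(\<Sum>y\<in>B' x. f x y) \<le> infsum (f x) (B x)"
        using assms(2)[OF \<open>x \<in> A\<close>] fin nn by (intro finite_sum_le_infsum) auto
    qed
    finally show "(\<Sum>g\<in>P. \<Prod>x\<in>A. f x (g x)) \<le> (\<Prod>x\<in>A. infsum (f x) (B x))" .
  qed
qed (intro prod_nonneg nn ballI)

lemma lattice_closed:
  assumes "full_rank_lattice L"
  shows "0 \<in> L" "x \<in> L \<Longrightarrow> y \<in> L \<Longrightarrow> x + y \<in> L" "x \<in> L \<Longrightarrow> y \<in> L \<Longrightarrow> x - y \<in> L"
    "x \<in> L \<Longrightarrow> of_int k *\<^sub>R x \<in> L"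
    "(\<And>i. i \<in> I \<Longrightarrow> g i \<in> L) \<Longrightarrow> (\<Sum>i\<in>I. g i) \<in> L"
proof -
  obtain B where L: "L = range (\<lambda>c :: real ^ 'a \<Rightarrow> int. \<Sum>b\<in>B. of_int (c b) *\<^sub>R b)"
    using assms unfolding full_rank_lattice_def by blast
  show z: "0 \<in> L" unfolding L by (rule image_eqI[of _ _ "\<lambda>_. 0"]) auto
  show a: "x \<in> L \<Longrightarrow> y \<in> L \<Longrightarrow> x + y \<in> L" for x y unfolding L
  proof (elim rangeE)
    fix c d assume "x = (\<Sum>b\<in>B. of_int (c b) *\<^sub>R b)" "y = (\<Sum>b\<in>B. of_int (d b) *\<^sub>R b)"
    then show "x + y \<in> range (\<lambda>c. \<Sum>b\<in>B. of_int (c b) *\<^sub>R b)"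
      by (intro image_eqI[of _ _ "\<lambda>b. c b + d b"]) (auto simp: sum.distrib algebra_simps)
  qed
  show m: "x \<in> L \<Longrightarrow> of_int k *\<^sub>R x \<in> L" for x k unfolding L
  proof (elim rangeE)
    fix c assume "x = (\<Sum>b\<in>B. of_int (c b) *\<^sub>R b)"
    then show "of_int k *\<^sub>R x \<in> range (\<lambda>c. \<Sum>b\<in>B. of_int (c b) *\<^sub>R b)"
      by (intro image_eqI[of _ _ "\<lambda>b. k * c b"]) (auto simp: scaleR_sum_right)
  qed
  show "x \<in> L \<Longrightarrow> y \<in> L \<Longrightarrow> x - y \<in> L"
    using a[of x "of_int (-1) *\<^sub>R y"] m[of y "-1"] by simp
  show "(\<And>i. i \<in> I \<Longrightarrow> g i \<in> L) \<Longrightarrow> (\<Sum>i\<in>I. g i) \<in> L"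
    by (induction I rule: infinite_finite_induct) (auto intro: z a)
qed

lemma full_rank_lattice_basis:
  fixes L :: "(real ^ 'n) set"
  assumes "full_rank_lattice L"
  obtains B where "independent B" "finite B" "span B = UNIV" "B \<subseteq> L"
    "L = range (\<lambda>c :: real ^ 'n \<Rightarrow> int. \<Sum>b\<in>B. of_int (c b) *\<^sub>R b)"
proof -
  obtain B where B: "independent B" "card B = CARD('n)"
    and LB: "L = range (\<lambda>c :: real ^ 'n \<Rightarrow> int. \<Sum>b\<in>B. of_int (c b) *\<^sub>R b)"
    using assms unfolding full_rank_lattice_def by blast
  have finB: "finite B" using B(1) by (rule independent_imp_finite)
  have "span B = UNIV"
    using B by (metis DIM_cart DIM_real card_eq_dim dim_UNIV finB independent_imp_finite
        mult.right_neutral subset_UNIV top.extremum_uniqueI)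
  moreover have "b \<in> L" if "b \<in> B" for b
  proof -
    have "(\<Sum>x\<in>B. of_int (if x = b then 1 else 0) *\<^sub>R x) = (\<Sum>x\<in>B. if x = b then x else 0)"
      by (rule sum.cong) auto
    also have "\<dots> = b" using that finB by simp
    finally show ?thesis unfolding LB by (intro image_eqI[of _ _ "\<lambda>x. if x = b then 1 else 0"]) auto
  qed
  ultimately show ?thesis using that B(1) finB LB by blast
qed

text \<open>
  Gram-Schmidt without denominators. The lattice need not have an orthogonal basis, but it contains
  one of a sublattice; this reduces summation over the lattice to products of sums over the integers.
\<close>

lemma integral_orthogonalization:
  fixes L :: "(real ^ 'n) set"
  assumes lat: "full_rank_lattice L" and int: "\<And>v w. v \<in> L \<Longrightarrow> w \<in> L \<Longrightarrow> v \<bullet> w \<in> \<int>"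
    and B: "finite B" "B \<subseteq> L" "independent B"
  shows "\<exists>F. finite F \<and> F \<subseteq> L \<and> pairwise orthogonal F \<and> 0 \<notin> F \<and> span F = span B"
  using B
proof (induction B)
  case empty
  then show ?case by (intro exI[of _ "{}"]) (auto simp: pairwise_def)
next
  case (insert b B)
  then obtain F where F: "finite F" "F \<subseteq> L" "pairwise orthogonal F" "0 \<notin> F" "span F = span B"
    by (metis independent_mono insert_subset subset_insertI)
  have b: "b \<in> L" "b \<notin> span B" using insert by (auto simp: independent_insert)
  define N where "N = (\<Prod>f\<in>F. f \<bullet> f)"
  have N: "N \<noteq> 0" using F by (auto simp: N_def)
  (* The factor N clears the denominators of the Gram-Schmidt coefficients. *)
  have Nq: "N * (b \<bullet> f) / (f \<bullet> f) \<in> \<int>" if "f \<in> F" for f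
  proof -
    have "N = (f \<bullet> f) * (\<Prod>f\<in>F-{f}. f \<bullet> f)" unfolding N_def using F(1) that by (rule prod.remove)
    then have "N * (b \<bullet> f) / (f \<bullet> f) = (\<Prod>f\<in>F-{f}. f \<bullet> f) * (b \<bullet> f)"
      using that F(4) by auto
    also have "\<dots> \<in> \<int>" using F(2) b that by (intro Ints_mult Ints_prod int) auto
    finally show ?thesis .
  qed
  have Nint: "N \<in> \<int>" unfolding N_def using F(2) by (intro Ints_prod int) auto
  have sc: "r *\<^sub>R x \<in> L" if "r \<in> \<int>" "x \<in> L" for r x
    using that lattice_closed(4)[OF lat] by (auto elim!: Ints_cases)
  define p where "p = (\<Sum>f\<in>F. (N * (b \<bullet> f) / (f \<bullet> f)) *\<^sub>R f)"
  define c where "c = N *\<^sub>R b - p"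
  have pF: "p \<in> span F" unfolding p_def by (intro span_sum span_scale span_base)
  have "p \<in> L" unfolding p_def using F(2) by (intro lattice_closed(5)[OF lat] sc Nq) auto
  then have cL: "c \<in> L" unfolding c_def using b by (intro lattice_closed(3)[OF lat] sc Nint)
  have orth: "orthogonal c f" if f: "f \<in> F" for f
  proof -
    have "p \<bullet> f = (\<Sum>g\<in>F. if g = f then N * (b \<bullet> f) else 0)"
      unfolding p_def inner_sum_left
    proof (rule sum.cong[OF refl])
      fix g assume g: "g \<in> F"
      show "(N * (b \<bullet> g) / (g \<bullet> g)) *\<^sub>R g \<bullet> f = (if g = f then N * (b \<bullet> f) else 0)"
        using F(3,4) f g by (auto simp: pairwise_def orthogonal_def)
    qed
    then show ?thesis using F(1) f by (simp add: orthogonal_def c_def inner_diff_left)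
  qed
  have c0: "c \<noteq> 0"
  proof
    assume "c = 0"
    then have "N *\<^sub>R b \<in> span F" using pF by (simp add: c_def)
    then have "inverse N *\<^sub>R (N *\<^sub>R b) \<in> span F" by (rule span_scale)
    then show False using b(2) F(5) N by simp
  qed
  have "span (insert c F) = span (insert b B)"
  proof
    have pB: "p \<in> span (insert b B)" using pF F(5) span_mono[of B "insert b B"] by auto
    have cB: "c \<in> span (insert b B)" unfolding c_def
      by (intro span_diff span_scale pB) (auto intro: span_base)
    have "F \<subseteq> span (insert b B)" using F(5) span_superset[of F] span_mono[of B "insert b B"] by auto
    then show "span (insert c F) \<subseteq> span (insert b B)"
      using cB by (intro span_minimal subspace_span) auto
    have pc: "p \<in> span (insert c F)" using pF span_mono[of F "insert c F"] by auto
    have "inverse N *\<^sub>R (c + p) \<in> span (insert c F)"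
      by (intro span_scale span_add pc) (auto intro: span_base)
    then have "b \<in> span (insert c F)" using N by (simp add: c_def)
    moreover have "B \<subseteq> span (insert c F)"
      using F(5) span_superset[of B] span_mono[of F "insert c F"] by auto
    ultimately show "span (insert b B) \<subseteq> span (insert c F)"
      by (intro span_minimal subspace_span) auto
  qed
  then show ?case
    using F cL c0 orth by (intro exI[of _ "insert c F"]) (auto simp: pairwise_insert orthogonal_commute)
qed

lemma orthogonal_basis_expansion:
  fixes F :: "(real ^ 'n) set"
  assumes F: "finite F" "pairwise orthogonal F" "0 \<notin> F" "span F = UNIV"
  shows "v = (\<Sum>f\<in>F. (v \<bullet> f / (f \<bullet> f)) *\<^sub>R f)"
    and "v \<bullet> w = (\<Sum>f\<in>F. (v \<bullet> f) * (w \<bullet> f) / (f \<bullet> f))"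
proof -
  define x where "x = v - (\<Sum>f\<in>F. (v \<bullet> f / (f \<bullet> f)) *\<^sub>R f)"
  have "orthogonal x f" if f: "f \<in> F" for f
  proof -
    have "(\<Sum>g\<in>F. (v \<bullet> g / (g \<bullet> g)) *\<^sub>R g) \<bullet> f = (\<Sum>g\<in>F. if g = f then v \<bullet> f else 0)"
      unfolding inner_sum_left
      by (rule sum.cong[OF refl]) (use F f in \<open>auto simp: pairwise_def orthogonal_def\<close>)
    then show ?thesis using F(1) f by (simp add: orthogonal_def x_def inner_diff_left)
  qed
  then have "orthogonal x y" if "y \<in> span F" for y using that orthogonal_to_span by blast
  then have "orthogonal x x" using F(4) by auto
  then have "x = 0" by (simp add: orthogonal_def)
  then show e: "v = (\<Sum>f\<in>F. (v \<bullet> f / (f \<bullet> f)) *\<^sub>R f)" by (simp add: x_def)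
  show "v \<bullet> w = (\<Sum>f\<in>F. (v \<bullet> f) * (w \<bullet> f) / (f \<bullet> f))"
    using arg_cong[OF e, of "\<lambda>x. x \<bullet> w"] by (simp add: inner_sum_left) (simp add: inner_commute)
qed

lemma orthogonal_combination_inner:
  fixes F :: "(real ^ 'n) set"
  assumes "finite F" "pairwise orthogonal F" "f \<in> F"
  shows "(\<Sum>g\<in>F. c g *\<^sub>R g) \<bullet> f = c f * (f \<bullet> f)"
proof -
  have "(\<Sum>g\<in>F. c g *\<^sub>R g) \<bullet> f = (\<Sum>g\<in>F. if g = f then c f * (f \<bullet> f) else 0)"
    unfolding inner_sum_left
    by (rule sum.cong[OF refl]) (use assms in \<open>auto simp: pairwise_def orthogonal_def\<close>)
  then show ?thesis using assms by simp
qed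

text \<open>
  For pairwise orthogonal vectors f the Gaussian is a product over f, and so the one-dimensional
  formula applies in each coordinate. Here mp k runs through the lattice spanned by F and dp k through
  its dual lattice.
\<close>

lemma orthogonal_lattice_poisson:
  fixes F :: "(real ^ 'n) set" and t :: real
  assumes F: "finite F" "pairwise orthogonal F" "0 \<notin> F" "span F = UNIV" and t: "0 < t"
  defines "K \<equiv> (\<Pi>\<^sub>E f\<in>F. (UNIV :: int set))"
  defines "mp \<equiv> (\<lambda>k. \<Sum>f\<in>F. of_int (k f) *\<^sub>R f)"
  defines "dp \<equiv> (\<lambda>k. \<Sum>f\<in>F. (of_int (k f) / (f \<bullet> f)) *\<^sub>R f)"
  shows "(\<lambda>k. gauss t (mp k + u)) summable_on K"
    and "(\<lambda>k. gauss (1 / t) (dp k)) summable_on K"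
    and "of_real (\<Sum>\<^sub>\<infinity>k\<in>K. gauss t (mp k + u)) =
      of_real ((1 / sqrt t) ^ CARD('n) * (\<Prod>f\<in>F. 1 / norm f)) *
      (\<Sum>\<^sub>\<infinity>k\<in>K. of_real (gauss (1 / t) (dp k)) * cis (2 * pi * (dp k \<bullet> u)))"
proof -
  have ff: "f \<bullet> f > 0" if "f \<in> F" for f using that F(3) by (metis inner_gt_zero_iff)
  have card: "card F = CARD('n)"
  proof -
    have "independent F" using F by (intro pairwise_orthogonal_independent)
    then show ?thesis using F(4) by (metis dim_eq_card_independent dim_span dim_UNIV DIM_cart DIM_real mult_1_right)
  qed
  define h where "h f j = exp (- (pi * (t * (f \<bullet> f))) * (of_int j + u \<bullet> f / (f \<bullet> f))\<^sup>2)" for f :: "real ^ 'n" and j :: int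
  define g where "g f j = of_real (exp (- (pi / (t * (f \<bullet> f))) * (of_int j)\<^sup>2)) * cis (2 * pi * of_int j * (u \<bullet> f / (f \<bullet> f)))" for f :: "real ^ 'n" and j :: int
  have nmp: "(norm (mp k + u))\<^sup>2 = (\<Sum>f\<in>F. (f \<bullet> f) * (of_int (k f) + u \<bullet> f / (f \<bullet> f))\<^sup>2)" for k
  proof -
    have "(norm (mp k + u))\<^sup>2 = (\<Sum>f\<in>F. ((mp k + u) \<bullet> f) * ((mp k + u) \<bullet> f) / (f \<bullet> f))"
      unfolding power2_norm_eq_inner by (rule orthogonal_basis_expansion(2)[OF F])
    also have "\<dots> = (\<Sum>f\<in>F. (f \<bullet> f) * (of_int (k f) + u \<bullet> f / (f \<bullet> f))\<^sup>2)"
    proof (rule sum.cong[OF refl])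
      fix f assume f: "f \<in> F"
      have "(mp k + u) \<bullet> f = of_int (k f) * (f \<bullet> f) + u \<bullet> f"
        using orthogonal_combination_inner[OF F(1,2) f, of "\<lambda>f. of_int (k f)"] by (simp add: mp_def inner_add_left)
      then show "((mp k + u) \<bullet> f) * ((mp k + u) \<bullet> f) / (f \<bullet> f) = (f \<bullet> f) * (of_int (k f) + u \<bullet> f / (f \<bullet> f))\<^sup>2"
        using ff[OF f] by (simp add: field_simps power2_eq_square)
    qed
    finally show ?thesis .
  qed
  have dpf: "dp k \<bullet> f = of_int (k f)" if f: "f \<in> F" for k f
    using orthogonal_combination_inner[OF F(1,2) f, of "\<lambda>f. of_int (k f) / (f \<bullet> f)"] ff[OF f] by (simp add: dp_def)
  have ndp: "(norm (dp k))\<^sup>2 = (\<Sum>f\<in>F. (of_int (k f))\<^sup>2 / (f \<bullet> f))"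
    and udp: "dp k \<bullet> u = (\<Sum>f\<in>F. of_int (k f) * (u \<bullet> f / (f \<bullet> f)))" for k
    unfolding power2_norm_eq_inner
    by (subst orthogonal_basis_expansion(2)[OF F, of "dp k"], auto intro!: sum.cong simp: dpf power2_eq_square)+
  have hprod: "gauss t (mp k + u) = (\<Prod>f\<in>F. h f (k f))" for k
    unfolding gauss_def nmp h_def sum_distrib_left exp_sum[OF F(1)]
    by (intro prod.cong refl arg_cong[where f = exp]) (simp add: mult.assoc)
  have eprod: "gauss (1 / t) (dp k) = (\<Prod>f\<in>F. exp (- (pi / (t * (f \<bullet> f))) * (of_int (k f))\<^sup>2))" for k
    unfolding gauss_def ndp sum_distrib_left exp_sum[OF F(1)]
    by (intro prod.cong refl arg_cong[where f = exp]) (simp add: field_simps)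
  have cprod: "cis (\<Sum>f\<in>F'. a f) = (\<Prod>f\<in>F'. cis (a f))" if "finite F'" for F' :: "(real ^ 'n) set" and a
    using that by induction (simp_all add: cis_mult[symmetric] del: cis_mult)
  have gprod: "of_real (gauss (1 / t) (dp k)) * cis (2 * pi * (dp k \<bullet> u)) = (\<Prod>f\<in>F. g f (k f))" for k
    unfolding eprod udp g_def sum_distrib_left cprod[OF F(1)] by (simp add: prod.distrib mult.assoc)
  have hs: "h f summable_on UNIV" if "f \<in> F" for f
    unfolding h_def using t ff[OF that] by (intro gauss_summable) auto
  have es: "(\<lambda>j::int. exp (- (pi / (t * (f \<bullet> f))) * (of_int j)\<^sup>2)) summable_on UNIV" if "f \<in> F" for f
    using gauss_summable[of "pi / (t * (f \<bullet> f))" 0] t ff[OF that] by simp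
  show s1: "(\<lambda>k. gauss t (mp k + u)) summable_on K"
    unfolding hprod K_def by (intro summable_on_prod_PiE F(1) hs) (auto simp: h_def)
  show s2: "(\<lambda>k. gauss (1 / t) (dp k)) summable_on K"
    unfolding eprod K_def by (intro summable_on_prod_PiE F(1) es) auto
  have hg: "of_real (infsum (h f) UNIV) = of_real (1 / sqrt t * (1 / norm f)) * infsum (g f) UNIV" if f: "f \<in> F" for f
  proof -
    have "sqrt (t * (f \<bullet> f)) = sqrt t * norm f" by (simp add: real_sqrt_mult norm_eq_sqrt_inner)
    then show ?thesis
      using gauss_poisson[of "t * (f \<bullet> f)" "u \<bullet> f / (f \<bullet> f)"] t ff[OF f]
      by (simp add: h_def[abs_def] g_def[abs_def] mult_ac)
  qed
  have "(\<Sum>\<^sub>\<infinity>k\<in>K. gauss t (mp k + u)) = (\<Prod>f\<in>F. infsum (h f) UNIV)"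
    using s1 unfolding hprod K_def by (intro infsum_prod_PiE F(1) hs)
  then have "complex_of_real (\<Sum>\<^sub>\<infinity>k\<in>K. gauss t (mp k + u)) = (\<Prod>f\<in>F. of_real (infsum (h f) UNIV))"
    by simp
  also have "\<dots> = (\<Prod>f\<in>F. of_real (1 / sqrt t * (1 / norm f)) * infsum (g f) UNIV)"
    by (rule prod.cong[OF refl hg])
  also have "\<dots> = of_real ((1 / sqrt t) ^ CARD('n) * (\<Prod>f\<in>F. 1 / norm f)) * (\<Prod>f\<in>F. infsum (g f) UNIV)"
    by (simp add: prod.distrib prod_dividef card power_divide)
  also have "(\<Prod>f\<in>F. infsum (g f) UNIV) = (\<Sum>\<^sub>\<infinity>k\<in>K. of_real (gauss (1 / t) (dp k)) * cis (2 * pi * (dp k \<bullet> u)))"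
    unfolding gprod K_def
  proof (rule infsum_prod_PiE_abs[symmetric, OF F(1)])
    fix f assume "f \<in> F"
    show "(\<lambda>j. norm (g f j)) summable_on UNIV" unfolding g_def using es[OF \<open>f \<in> F\<close>] by (simp add: norm_mult)
  qed
  finally show "of_real (\<Sum>\<^sub>\<infinity>k\<in>K. gauss t (mp k + u)) =
      of_real ((1 / sqrt t) ^ CARD('n) * (\<Prod>f\<in>F. 1 / norm f)) *
      (\<Sum>\<^sub>\<infinity>k\<in>K. of_real (gauss (1 / t) (dp k)) * cis (2 * pi * (dp k \<bullet> u)))" .
qed

lemma infsum_finite_sum:
  fixes f :: "'a \<Rightarrow> 'b \<Rightarrow> 'c :: banach"
  assumes "\<And>r. r \<in> R \<Longrightarrow> f r summable_on K"
  shows "(\<Sum>\<^sub>\<infinity>k\<in>K. \<Sum>r\<in>R. f r k) = (\<Sum>r\<in>R. infsum (f r) K)"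
proof -
  have "((\<lambda>k. \<Sum>r\<in>R. f r k) has_sum (\<Sum>r\<in>R. infsum (f r) K)) K"
    using assms by (induction R rule: infinite_finite_induct) (auto intro!: has_sum_add has_sum_infsum)
  then show ?thesis by (rule infsumI)
qed

text \<open>
  Let M be a sublattice of L with an orthogonal basis F. As L is its own dual, M is contained in L
  and L in the dual of M. Summing the formula for M over the cosets of M in L produces
  character sums over L / M, which vanish except at the elements of L. The constant is the index of
  M in L divided by the covolume of M.
\<close>

lemma unimodular_poisson_upto_constant:
  fixes L :: "(real ^ 'n) set"
  assumes L: "integral_unimodular_lattice L"
  shows "\<exists>\<kappa>::real > 0. \<forall>t > 0. \<forall>u.
    (\<lambda>v. gauss t (v + u)) summable_on L \<and>
    of_real (\<Sum>\<^sub>\<infinity>v\<in>L. gauss t (v + u)) =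
       of_real (\<kappa> * (1 / sqrt t) ^ CARD('n)) *
       (\<Sum>\<^sub>\<infinity>v\<in>L. of_real (gauss (1 / t) v) * cis (2 * pi * (v \<bullet> u)))"
proof -
  have lat: "full_rank_lattice L" and int: "\<And>v w. v \<in> L \<Longrightarrow> w \<in> L \<Longrightarrow> v \<bullet> w \<in> \<int>"
    and dual: "dual_lattice L = L"
    using L by (auto simp: integral_unimodular_lattice_def)
  obtain B where B: "independent B" "finite B" "span B = UNIV" "B \<subseteq> L"
    by (rule full_rank_lattice_basis[OF lat])
  obtain F where F: "finite F" "F \<subseteq> L" "pairwise orthogonal F" "0 \<notin> F" "span F = UNIV"
    using integral_orthogonalization[OF lat int B(2,4,1)] B(3) by metis
  note FB = F(1,3,4,5)
  define K where "K = (\<Pi>\<^sub>E f\<in>F. (UNIV :: int set))"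
  define mp where "mp k = (\<Sum>f\<in>F. of_int (k f) *\<^sub>R f)" for k :: "real ^ 'n \<Rightarrow> int"
  define dp where "dp k = (\<Sum>f\<in>F. (of_int (k f) / (f \<bullet> f)) *\<^sub>R f)" for k :: "real ^ 'n \<Rightarrow> int"
  note poi = orthogonal_lattice_poisson[OF FB, folded K_def mp_def dp_def]
  have ff: "f \<bullet> f > 0" if "f \<in> F" for f using that F(4) by (metis inner_gt_zero_iff)
  have mpf: "mp k \<bullet> f = of_int (k f) * (f \<bullet> f)" if "f \<in> F" for k f
    using orthogonal_combination_inner[OF F(1,3) that, of "\<lambda>f. of_int (k f)"] by (simp add: mp_def)
  have dpf: "dp k \<bullet> f = of_int (k f)" if f: "f \<in> F" for k f
    using orthogonal_combination_inner[OF F(1,3) f, of "\<lambda>f. of_int (k f) / (f \<bullet> f)"] ff[OF f] by (simp add: dp_def)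
  have mpL: "mp k \<in> L" for k unfolding mp_def
    using F(2) by (intro lattice_closed(5)[OF lat] lattice_closed(4)[OF lat]) auto
  have eqI: "x = y" if "\<And>f. f \<in> F \<Longrightarrow> x \<bullet> f = y \<bullet> f" for x y :: "real ^ 'n"
  proof -
    have "(\<Sum>f\<in>F. (x \<bullet> f / (f \<bullet> f)) *\<^sub>R f) = (\<Sum>f\<in>F. (y \<bullet> f / (f \<bullet> f)) *\<^sub>R f)"
      by (rule sum.cong) (simp_all add: that)
    then show ?thesis using orthogonal_basis_expansion(1)[OF FB, of x] orthogonal_basis_expansion(1)[OF FB, of y] by simp
  qed
  have keq: "k = k'" if "k \<in> K" "k' \<in> K" "\<And>f. f \<in> F \<Longrightarrow> k f = k' f" for k k'
    using that unfolding K_def by (intro PiE_ext) auto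
  define co where "co v f = v \<bullet> f / (f \<bullet> f)" for v f :: "real ^ 'n"
  (* R represents L / M: the vectors of L with coordinates in [0, 1) with respect to F. *)
  define R where "R = {r \<in> L. \<forall>f\<in>F. 0 \<le> co r f \<and> co r f < 1}"
  define fl where "fl v = (\<lambda>f\<in>F. \<lfloor>co v f\<rfloor>)" for v
  define red where "red v = v - mp (fl v)" for v
  have flK: "fl v \<in> K" for v by (simp add: fl_def K_def)
  have comp: "co (x + mp k) f = co x f + of_int (k f)" if "f \<in> F" for x k f
    using mpf[OF that, of k] ff[OF that] by (simp add: co_def inner_add_left add_divide_distrib)
  have cored: "co (red v) f = frac (co v f)" if "f \<in> F" for v f
    using mpf[OF that, of "fl v"] ff[OF that] that by (simp add: co_def red_def inner_diff_left diff_divide_distrib fl_def frac_def)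
  have redR: "red v \<in> R" if "v \<in> L" for v
  proof -
    have "red v \<in> L" unfolding red_def by (intro lattice_closed(3)[OF lat] mpL that)
    then show ?thesis unfolding R_def by (simp add: cored frac_lt_1)
  qed
  have coinj: "r = r'" if rr: "r \<in> R" "r' \<in> R" "\<And>f. f \<in> F \<Longrightarrow> co r f - co r' f \<in> \<int>" for r r'
  proof (rule eqI)
    fix f assume f: "f \<in> F"
    have "0 \<le> co r f" "co r f < 1" "0 \<le> co r' f" "co r' f < 1" using rr(1,2) f by (simp_all add: R_def)
    then have "\<bar>co r f - co r' f\<bar> < 1" by linarith
    moreover obtain z where z: "co r f - co r' f = of_int z" using rr(3)[OF f] by (auto elim!: Ints_cases)
    ultimately have "z = 0" by linarith
    then have "co r f = co r' f" using z by simp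
    then show "r \<bullet> f = r' \<bullet> f" using ff[OF f] by (simp add: co_def)
  qed
  have finR: "finite R"
  proof (rule finite_imageD)
    have flo: "of_int \<lfloor>r \<bullet> f\<rfloor> = r \<bullet> f" if "r \<in> R" "f \<in> F" for r f
      using int[of r f] that F(2) by (auto simp: R_def elim!: Ints_cases)
    show "inj_on (\<lambda>r. \<lambda>f\<in>F. \<lfloor>r \<bullet> f\<rfloor>) R"
    proof (rule inj_onI, rule eqI)
      fix r r' f assume r: "r \<in> R" "r' \<in> R" "(\<lambda>f\<in>F. \<lfloor>r \<bullet> f\<rfloor>) = (\<lambda>f\<in>F. \<lfloor>r' \<bullet> f\<rfloor>)" and f: "f \<in> F"
      from fun_cong[OF r(3), of f] f have "\<lfloor>r \<bullet> f\<rfloor> = \<lfloor>r' \<bullet> f\<rfloor>" by simp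
      then show "r \<bullet> f = r' \<bullet> f" using flo[OF r(1) f] flo[OF r(2) f] by metis
    qed
    have "(\<lambda>r. \<lambda>f\<in>F. \<lfloor>r \<bullet> f\<rfloor>) ` R \<subseteq> (\<Pi>\<^sub>E f\<in>F. {0..\<lfloor>f \<bullet> f\<rfloor>})"
    proof (rule image_subsetI, rule PiE_I)
      fix r f assume r: "r \<in> R" and f: "f \<in> F"
      then have "0 \<le> r \<bullet> f" "r \<bullet> f \<le> f \<bullet> f" using ff[OF f] by (auto simp: R_def co_def field_simps)
      then show "(\<lambda>f\<in>F. \<lfloor>r \<bullet> f\<rfloor>) f \<in> {0..\<lfloor>f \<bullet> f\<rfloor>}" using f by (auto intro: floor_mono)
    qed auto
    then show "finite ((\<lambda>r. \<lambda>f\<in>F. \<lfloor>r \<bullet> f\<rfloor>) ` R)"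
      by (rule finite_subset) (intro finite_PiE F(1) finite_atLeastAtMost_int)
  qed
  have bijL: "bij_betw (\<lambda>(r,k). r + mp k) (R \<times> K) L"
  proof (rule bij_betw_imageI)
    show "inj_on (\<lambda>(r,k). r + mp k) (R \<times> K)"
    proof (rule inj_onI, clarify)
      fix r k r' k' assume a: "r \<in> R" "k \<in> K" "r' \<in> R" "k' \<in> K" "r + mp k = r' + mp k'"
      have e: "co r f + of_int (k f) = co r' f + of_int (k' f)" if "f \<in> F" for f
        using comp[OF that, of r k] comp[OF that, of r' k'] a(5) by simp
      have "r = r'"
      proof (rule coinj[OF a(1,3)])
        fix f assume "f \<in> F"
        then have "co r f - co r' f = of_int (k' f - k f)" using e by (simp add: algebra_simps)
        then show "co r f - co r' f \<in> \<int>" by (metis Ints_of_int)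
      qed
      moreover have "k = k'" using e \<open>r = r'\<close> by (intro keq a) auto
      ultimately show "r = r' \<and> k = k'" by simp
    qed
    show "(\<lambda>(r,k). r + mp k) ` (R \<times> K) = L"
    proof
      show "(\<lambda>(r,k). r + mp k) ` (R \<times> K) \<subseteq> L"
        by (auto simp: R_def intro!: lattice_closed(2)[OF lat] mpL)
      show "L \<subseteq> (\<lambda>(r,k). r + mp k) ` (R \<times> K)"
        by (rule subsetI) (rule image_eqI[of _ _ "(red v, fl v)" for v], auto simp: red_def[of _] redR[unfolded red_def] flK)
    qed
  qed
  have bijD: "bij_betw dp {k \<in> K. dp k \<in> L} L"
  proof (rule bij_betw_imageI)
    show "inj_on dp {k \<in> K. dp k \<in> L}"
    proof (rule inj_onI)
      fix k k' assume "k \<in> {k \<in> K. dp k \<in> L}" "k' \<in> {k \<in> K. dp k \<in> L}" "dp k = dp k'"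
      then show "k = k'" using dpf[of _ k] dpf[of _ k'] by (intro keq) auto
    qed
    show "dp ` {k \<in> K. dp k \<in> L} = L"
    proof (intro equalityI subsetI)
      fix y assume y: "y \<in> L"
      define k where "k = (\<lambda>f\<in>F. \<lfloor>y \<bullet> f\<rfloor>)"
      have "k \<in> K" by (simp add: k_def K_def)
      moreover have "dp k = y"
      proof (rule eqI)
        fix f assume f: "f \<in> F"
        then have "y \<bullet> f \<in> \<int>" using int[of y f] y F(2) by auto
        then show "dp k \<bullet> f = y \<bullet> f" using f by (auto simp: dpf k_def elim!: Ints_cases)
      qed
      ultimately show "y \<in> dp ` {k \<in> K. dp k \<in> L}" using y by force
    qed auto
  qed
  define \<eta> where "\<eta> x = cis (2 * pi * x)" for x
  have \<eta>add: "\<eta> (x + y) = \<eta> x * \<eta> y" for x y by (simp add: \<eta>_def cis_mult algebra_simps)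
  have \<eta>1: "\<eta> x = 1 \<longleftrightarrow> x \<in> \<int>" for x
  proof
    assume "\<eta> x = 1"
    then have "cos (2 * pi * x) = 1" by (simp add: \<eta>_def complex_eq_iff)
    then obtain m :: int where "2 * pi * x = of_int m * 2 * pi" by (auto simp: cos_one_2pi_int)
    then have "x = of_int m" by simp
    then show "x \<in> \<int>" by simp
  qed (simp add: \<eta>_def)
  have dpmp: "dp k \<bullet> mp k' \<in> \<int>" for k k'
  proof -
    have "dp k \<bullet> mp k' = (\<Sum>f\<in>F. of_int (k' f * k f))"
      by (simp add: mp_def inner_sum_right dpf)
    also have "\<dots> \<in> \<int>" by (intro Ints_sum Ints_of_int)
    finally show ?thesis .
  qed
  have charsum: "(\<Sum>r\<in>R. \<eta> (dp k \<bullet> r)) = (if dp k \<in> L then of_nat (card R) else 0)" for k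
  proof (cases "dp k \<in> L")
    case True
    then have "\<eta> (dp k \<bullet> r) = 1" if "r \<in> R" for r using int[of "dp k" r] that by (simp add: \<eta>1 R_def)
    then show ?thesis using True by simp
  next
    case False
    then obtain v where v: "v \<in> L" "v \<bullet> dp k \<notin> \<int>" using dual by (auto simp: dual_lattice_def)
    (* Translation by v permutes L / M and multiplies the character sum by a number other than 1. *)
    define \<tau> where "\<tau> r = red (r + v)" for r
    have \<tau>R: "\<tau> ` R \<subseteq> R" unfolding \<tau>_def using v(1)
      by (intro image_subsetI redR lattice_closed(2)[OF lat]) (auto simp: R_def)
    have "inj_on \<tau> R"
    proof (rule inj_onI, rule coinj)
      fix r r' f assume r: "\<tau> r = \<tau> r'" and f: "f \<in> F"
      have "frac (co (r + v) f) = frac (co (r' + v) f)"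
        using cored[OF f, of "r + v"] cored[OF f, of "r' + v"] r by (simp add: \<tau>_def)
      then have "co (r + v) f - co (r' + v) f = of_int (\<lfloor>co (r + v) f\<rfloor> - \<lfloor>co (r' + v) f\<rfloor>)"
        by (simp add: frac_def)
      moreover have "co (r + v) f - co (r' + v) f = co r f - co r' f"
        by (simp add: co_def inner_add_left add_divide_distrib)
      ultimately show "co r f - co r' f \<in> \<int>" by (metis Ints_of_int)
    qed auto
    then have bij: "bij_betw \<tau> R R" using endo_inj_surj[OF finR \<tau>R] by (simp add: bij_betw_def)
    have \<eta>\<tau>: "\<eta> (dp k \<bullet> \<tau> r) = \<eta> (dp k \<bullet> v) * \<eta> (dp k \<bullet> r)" for r
    proof -
      have "\<eta> (dp k \<bullet> \<tau> r) * \<eta> (dp k \<bullet> mp (fl (r + v))) = \<eta> (dp k \<bullet> (r + v))"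
        unfolding \<eta>add[symmetric] by (simp add: \<tau>_def red_def flip: inner_add_right)
      moreover have "\<eta> (dp k \<bullet> mp (fl (r + v))) = 1" unfolding \<eta>1 by (rule dpmp)
      ultimately show ?thesis by (simp add: inner_add_right \<eta>add)
    qed
    have "(\<Sum>r\<in>R. \<eta> (dp k \<bullet> r)) = (\<Sum>r\<in>R. \<eta> (dp k \<bullet> \<tau> r))"
      by (rule sum.reindex_bij_betw[OF bij, symmetric])
    also have "\<dots> = \<eta> (dp k \<bullet> v) * (\<Sum>r\<in>R. \<eta> (dp k \<bullet> r))" by (simp add: \<eta>\<tau> sum_distrib_left)
    finally have "(1 - \<eta> (dp k \<bullet> v)) * (\<Sum>r\<in>R. \<eta> (dp k \<bullet> r)) = 0" by (simp add: algebra_simps)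
    moreover have "\<eta> (dp k \<bullet> v) \<noteq> 1" using v(2) by (simp add: \<eta>1 inner_commute)
    ultimately show ?thesis using False by auto
  qed
  define \<kappa> where "\<kappa> = (\<Prod>f\<in>F. 1 / norm f) * real (card R)"
  have "red 0 \<in> R" by (intro redR lattice_closed(1)[OF lat])
  then have "card R > 0" using finR by (auto simp: card_gt_0_iff)
  moreover have "(\<Prod>f\<in>F. 1 / norm f) > 0" using F(4) by (intro prod_pos) auto
  ultimately have \<kappa>: "\<kappa> > 0" by (simp add: \<kappa>_def)
  show ?thesis
  proof (rule exI[of _ \<kappa>], rule conjI[OF \<kappa>], rule allI, rule impI, rule allI, rule conjI)
    fix t :: real and u :: "real ^ 'n" assume t: "0 < t"
    define h where "h w = gauss t (w + u)" for w
    define E where "E k = complex_of_real (gauss (1 / t) (dp k))" for k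
    have hr: "h (r + mp k) = gauss t (mp k + (r + u))" for r k
    proof -
      have "r + mp k + u = mp k + (r + u)" by (metis add.assoc add.commute)
      then show ?thesis by (simp only: h_def)
    qed
    have sK: "(\<lambda>k. h (r + mp k)) summable_on K" for r
      unfolding hr by (rule poi(1)[OF t])
    have sRK: "(\<lambda>(r,k). h (r + mp k)) summable_on (R \<times> K)"
      by (rule summable_on_SigmaI[where g = "\<lambda>r. \<Sum>\<^sub>\<infinity>k\<in>K. h (r + mp k)"])
         (use sK finR in \<open>auto simp: h_def less_imp_le[OF gauss_pos] intro!: has_sum_infsum summable_on_finite\<close>)
    then have "h summable_on L"
      using summable_on_reindex_bij_betw[OF bijL, of h] by (simp add: case_prod_unfold)
    then show sL: "(\<lambda>v. gauss t (v + u)) summable_on L"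
      by (simp add: h_def[abs_def])
    have "(\<Sum>\<^sub>\<infinity>v\<in>L. h v) = (\<Sum>\<^sub>\<infinity>(r,k)\<in>R \<times> K. h (r + mp k))"
      using infsum_reindex_bij_betw[OF bijL, of h] by (simp add: case_prod_unfold)
    also have "\<dots> = (\<Sum>\<^sub>\<infinity>r\<in>R. \<Sum>\<^sub>\<infinity>k\<in>K. h (r + mp k))"
      by (rule infsum_Sigma'_banach[symmetric]) (use sRK in simp)
    also have "\<dots> = (\<Sum>r\<in>R. \<Sum>\<^sub>\<infinity>k\<in>K. h (r + mp k))" using finR by simp
    finally have "complex_of_real (\<Sum>\<^sub>\<infinity>v\<in>L. h v) = (\<Sum>r\<in>R. of_real (\<Sum>\<^sub>\<infinity>k\<in>K. h (r + mp k)))" by simp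
    also have "\<dots> = (\<Sum>r\<in>R. of_real ((1 / sqrt t) ^ CARD('n) * (\<Prod>f\<in>F. 1 / norm f)) *
      (\<Sum>\<^sub>\<infinity>k\<in>K. E k * \<eta> (dp k \<bullet> (r + u))))"
      by (rule sum.cong[OF refl], subst hr, subst poi(3)[OF t]) (simp only: E_def \<eta>_def)
    also have "\<dots> = of_real ((1 / sqrt t) ^ CARD('n) * (\<Prod>f\<in>F. 1 / norm f)) *
      (\<Sum>r\<in>R. \<Sum>\<^sub>\<infinity>k\<in>K. E k * \<eta> (dp k \<bullet> (r + u)))"
      by (simp add: sum_distrib_left)
    also have "(\<Sum>r\<in>R. \<Sum>\<^sub>\<infinity>k\<in>K. E k * \<eta> (dp k \<bullet> (r + u))) = (\<Sum>\<^sub>\<infinity>k\<in>K. \<Sum>r\<in>R. E k * \<eta> (dp k \<bullet> (r + u)))"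
    proof (rule infsum_finite_sum[symmetric])
      fix r assume "r \<in> R"
      show "(\<lambda>k. E k * \<eta> (dp k \<bullet> (r + u))) summable_on K"
        by (rule abs_summable_summable) (use poi(2)[OF t] in \<open>simp add: E_def norm_mult \<eta>_def abs_of_pos[OF gauss_pos]\<close>)
    qed
    also have "\<dots> = (\<Sum>\<^sub>\<infinity>k\<in>{k \<in> K. dp k \<in> L}. of_nat (card R) * (E k * \<eta> (dp k \<bullet> u)))"
    proof (rule infsum_cong_neutral)
      have s: "(\<Sum>r\<in>R. E k * \<eta> (dp k \<bullet> (r + u))) = E k * \<eta> (dp k \<bullet> u) * (\<Sum>r\<in>R. \<eta> (dp k \<bullet> r))" for k
        by (simp add: inner_add_right \<eta>add sum_distrib_left mult_ac)
      show "(\<Sum>r\<in>R. E k * \<eta> (dp k \<bullet> (r + u))) = 0" if "k \<in> K - {k \<in> K. dp k \<in> L}" for k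
        using that by (simp add: s charsum)
      show "(\<Sum>r\<in>R. E k * \<eta> (dp k \<bullet> (r + u))) = of_nat (card R) * (E k * \<eta> (dp k \<bullet> u))"
        if "k \<in> K \<inter> {k \<in> K. dp k \<in> L}" for k
        using that by (simp add: s charsum)
    qed auto
    also have "\<dots> = of_nat (card R) * (\<Sum>\<^sub>\<infinity>k\<in>{k \<in> K. dp k \<in> L}. E k * \<eta> (dp k \<bullet> u))"
      by (rule infsum_cmult_right') 
    also have "(\<Sum>\<^sub>\<infinity>k\<in>{k \<in> K. dp k \<in> L}. E k * \<eta> (dp k \<bullet> u)) =
       (\<Sum>\<^sub>\<infinity>v\<in>L. of_real (gauss (1 / t) v) * cis (2 * pi * (v \<bullet> u)))"
      unfolding E_def \<eta>_def by (rule infsum_reindex_bij_betw[OF bijD])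
    finally show "of_real (\<Sum>\<^sub>\<infinity>v\<in>L. gauss t (v + u)) =
       of_real (\<kappa> * (1 / sqrt t) ^ CARD('n)) *
       (\<Sum>\<^sub>\<infinity>v\<in>L. of_real (gauss (1 / t) v) * cis (2 * pi * (v \<bullet> u)))"
      by (simp add: h_def \<kappa>_def mult_ac)
  qed
qed

text \<open>
  At t = 1 and u = 0 the two sums are the same positive number, which shows that the constant is 1
  without a computation of covolumes.
\<close>

theorem unimodular_poisson:
  fixes L :: "(real ^ 'n) set"
  assumes L: "integral_unimodular_lattice L" and t: "0 < t"
  shows "(\<lambda>v. gauss t (v + u)) summable_on L"
    and "of_real (\<Sum>\<^sub>\<infinity>v\<in>L. gauss t (v + u)) =
       of_real ((1 / sqrt t) ^ CARD('n)) *
       (\<Sum>\<^sub>\<infinity>v\<in>L. of_real (gauss (1 / t) v) * cis (2 * pi * (v \<bullet> u)))"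
proof -
  let ?P = "\<lambda>\<kappa> t u. (\<lambda>v. gauss t (v + u)) summable_on L \<and>
    complex_of_real (\<Sum>\<^sub>\<infinity>v\<in>L. gauss t (v + u)) =
       of_real (\<kappa> * (1 / sqrt t) ^ CARD('n)) *
       (\<Sum>\<^sub>\<infinity>v\<in>L. of_real (gauss (1 / t) v) * cis (2 * pi * (v \<bullet> u)))"
  obtain \<kappa> :: real where \<kappa>: "\<kappa> > 0" and all: "\<forall>t>0. \<forall>u. ?P \<kappa> t u"
    using unimodular_poisson_upto_constant[OF L] by (elim exE conjE) (rule that)
  note s = all[rule_format, THEN conjunct1] and e = all[rule_format, THEN conjunct2]
  show "(\<lambda>v. gauss t (v + u)) summable_on L" by (rule s[OF t])
  (* S is the common value of both sums for t = 1 and u = 0; it is positive because L contains 0. *)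
  define S where "S = (\<Sum>\<^sub>\<infinity>v\<in>L. gauss 1 v)"
  have sS: "(\<lambda>v. gauss 1 v) summable_on L" using s[of 1 0] by simp
  have "0 \<in> L" using L lattice_closed(1) by (auto simp: integral_unimodular_lattice_def)
  then have "(\<Sum>v\<in>{0::real ^ 'n}. gauss 1 v) \<le> S"
    unfolding S_def using finite_sum_le_infsum[OF sS, of "{0}"] by (simp add: less_imp_le[OF gauss_pos])
  then have "1 \<le> S" by (simp add: gauss_def)
  moreover have "S = \<kappa> * S"
  proof -
    have o: "(\<Sum>\<^sub>\<infinity>v\<in>L. complex_of_real (gauss 1 v)) = complex_of_real S"
      unfolding S_def by (intro infsumI has_sum_of_real has_sum_infsum sS)
    have "complex_of_real S = complex_of_real (\<kappa> * S)"
      using e[of 1 0] o by (simp add: S_def)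
    then show ?thesis by (simp only: of_real_eq_iff)
  qed
  ultimately have "\<kappa> = 1" by simp
  then show "of_real (\<Sum>\<^sub>\<infinity>v\<in>L. gauss t (v + u)) =
       of_real ((1 / sqrt t) ^ CARD('n)) *
       (\<Sum>\<^sub>\<infinity>v\<in>L. of_real (gauss (1 / t) v) * cis (2 * pi * (v \<bullet> u)))"
    using e[OF t, of u] by simp
qed

section \<open>Zeros of the theta series of the integers\<close>

lemma wt_summable_squares: "wt_summable (UNIV :: int set) (\<lambda>k. nat (k\<^sup>2))"
  unfolding wt_summable_def
proof (intro allI impI)
  fix r :: real assume r: "0 < r" "r < 1"
  show "(\<lambda>k::int. r ^ nat (k\<^sup>2)) summable_on UNIV"
  proof (rule summable_on_comparison_test[OF summable_on_power_nat_abs_int[OF r]])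
    fix k :: int
    have "\<bar>k\<bar> * 1 \<le> \<bar>k\<bar> * \<bar>k\<bar>"
    proof (cases "k = 0")
      case False
      then show ?thesis by (intro mult_left_mono) auto
    qed simp
    moreover have "\<bar>k\<bar> * \<bar>k\<bar> = k\<^sup>2" by (simp add: power2_eq_square)
    ultimately have "nat \<bar>k\<bar> \<le> nat (k\<^sup>2)" by (intro nat_mono) simp
    then show "r ^ nat (k\<^sup>2) \<le> r ^ nat \<bar>k\<bar>" using r by (intro power_decreasing) auto
  qed (use r in auto)
qed

lemma pronic_nonneg: "(k::int)\<^sup>2 + k \<ge> 0"
proof (cases "k \<ge> 0")
  case False
  then have "0 \<le> (- k) * (- k - 1)" by (intro mult_nonneg_nonneg) auto
  then show ?thesis by (simp add: power2_eq_square algebra_simps)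
qed auto

lemma wt_summable_pronic: "wt_summable (UNIV :: int set) (\<lambda>k. nat (k\<^sup>2 + k))"
  unfolding wt_summable_def
proof (intro allI impI)
  fix r :: real assume r: "0 < r" "r < 1"
  show "(\<lambda>k::int. r ^ nat (k\<^sup>2 + k)) summable_on UNIV"
  proof (rule summable_on_comparison_test)
    show "(\<lambda>k::int. inverse r * r ^ nat \<bar>k\<bar>) summable_on UNIV"
      by (intro summable_on_cmult_right summable_on_power_nat_abs_int r)
    fix k :: int
    have "\<bar>k\<bar> \<le> k\<^sup>2 + k + 1"
    proof (cases "k \<ge> 0")
      case False
      have "0 \<le> (k + 1)\<^sup>2" by simp
      then show ?thesis using False by (simp add: power2_eq_square algebra_simps)
    qed auto
    then have "nat \<bar>k\<bar> \<le> nat (k\<^sup>2 + k) + 1" by linarith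
    then have "r ^ (nat (k\<^sup>2 + k) + 1) \<le> r ^ nat \<bar>k\<bar>" using r by (intro power_decreasing) auto
    then show "r ^ nat (k\<^sup>2 + k) \<le> inverse r * r ^ nat \<bar>k\<bar>" using r by (simp add: field_simps)
  qed (use r in auto)
qed

text \<open>
  With q = exp(pi i z) these are the classical theta constants: theta_sq q is theta_3(z), and
  theta_pronic q is exp(-pi i z / 4) theta_2(z).
\<close>

definition theta_sq :: "complex \<Rightarrow> complex" where "theta_sq = wt_series (UNIV :: int set) (\<lambda>k. nat (k\<^sup>2))"
definition theta_pronic :: "complex \<Rightarrow> complex" where "theta_pronic = wt_series (UNIV :: int set) (\<lambda>k. nat (k\<^sup>2 + k))"

lemma infsum_int_dominated_convergence:
  fixes f :: "nat \<Rightarrow> int \<Rightarrow> complex"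
  assumes lim: "\<And>k. (\<lambda>N. f N k) \<longlonglongrightarrow> g k" and bd: "\<And>N k. norm (f N k) \<le> M k"
    and M: "M summable_on UNIV"
  shows "(\<lambda>N. infsum (f N) UNIV) \<longlonglongrightarrow> infsum g UNIV"
proof -
  have bij: "bij_betw int_decode UNIV UNIV" by (rule bij_int_decode)
  have sM: "summable (\<lambda>n. M (int_decode n))"
    using M summable_on_reindex_bij_betw[OF bij, of M] summable_on_imp_summable by blast
  have eq: "infsum h UNIV = (\<Sum>n. h (int_decode n))" if "\<And>k. norm (h k) \<le> M k" for h :: "int \<Rightarrow> complex"
  proof -
    have "(\<lambda>k. norm (h k)) summable_on UNIV"
      by (rule summable_on_comparison_test[OF M]) (use that in auto)
    then have "(h has_sum infsum h UNIV) UNIV"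
      by (rule has_sum_infsum[OF abs_summable_summable])
    then have "((\<lambda>n. h (int_decode n)) has_sum infsum h UNIV) UNIV"
      using has_sum_reindex_bij_betw[OF bij, of h] by blast
    then show ?thesis using has_sum_imp_sums sums_unique by blast
  qed
  have bg: "norm (g k) \<le> M k" for k
    by (rule tendsto_upperbound[OF tendsto_norm[OF lim]]) (use bd in auto)
  have "(\<lambda>N. \<Sum>n. f N (int_decode n)) \<longlonglongrightarrow> (\<Sum>n. g (int_decode n))"
  proof -
    have "\<forall>\<^sub>F (n, N) in at_top \<times>\<^sub>F sequentially. norm (f N (int_decode n)) \<le> M (int_decode n)"
      by (rule always_eventually) (use bd in auto)
    from tannerys_theorem[OF lim this sM] show ?thesis by simp
  qed
  then show ?thesis using eq[OF bd] eq[OF bg] by simp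
qed

definition qpoch :: "complex \<Rightarrow> nat \<Rightarrow> complex" where
  "qpoch p n = (\<Prod>i<n. 1 - p ^ Suc i)"

definition qbin :: "complex \<Rightarrow> nat \<Rightarrow> nat \<Rightarrow> complex" where
  "qbin p m k = (if k \<le> m then qpoch p m / (qpoch p k * qpoch p (m - k)) else 0)"

lemma one_minus_power_nonzero:
  fixes p :: complex
  assumes "norm p < 1"
  shows "1 - p ^ Suc i \<noteq> 0"
proof
  assume "1 - p ^ Suc i = 0"
  then have "norm (p ^ Suc i) = 1" by simp
  moreover have "norm (p ^ Suc i) < 1" using assms by (simp only: norm_power power_Suc_less_one norm_ge_zero)
    (meson norm_ge_zero power_Suc_less_one power_less_one_iff zero_less_Suc)
  ultimately show False by simp
qed

lemma qpoch_nonzero: "norm p < 1 \<Longrightarrow> qpoch p n \<noteq> 0"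
  unfolding qpoch_def by (simp only: prod_zero_iff finite_lessThan) (use one_minus_power_nonzero in blast)

lemma qbin_pascal:
  assumes p: "norm p < 1" and "k \<le> m"
  shows "qbin p (Suc m) (Suc k) = qbin p m (Suc k) + p ^ (m - k) * qbin p m k"
proof -
  note nz = qpoch_nonzero[OF p] one_minus_power_nonzero[OF p]
  show ?thesis
  proof (cases "k = m")
    case True
    then show ?thesis using nz by (simp add: qbin_def qpoch_def[of p 0])
  next
    case False
    then obtain d where d: "m = k + Suc d" using assms(2) less_iff_Suc_add[of k m] by auto
    have s: "qpoch p (Suc n) = qpoch p n * (1 - p ^ Suc n)" for n by (simp add: qpoch_def)
    define A where "A = 1 - p ^ Suc k"
    define D where "D = 1 - p ^ Suc d"
    have AD: "A \<noteq> 0" "D \<noteq> 0" unfolding A_def D_def by (rule nz(2))+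
    have e: "1 - p ^ Suc m = D + p ^ Suc d * A" unfolding A_def D_def d by (simp add: algebra_simps power_add)
    have l: "qbin p (Suc m) (Suc k) = qpoch p m * (1 - p ^ Suc m) / (qpoch p k * A * (qpoch p d * D))"
      using d by (simp add: qbin_def s A_def D_def)
    have r1: "qbin p m (Suc k) = qpoch p m / (qpoch p k * A * qpoch p d)"
      using d by (simp add: qbin_def s A_def)
    have r2: "qbin p m k = qpoch p m / (qpoch p k * (qpoch p d * D))"
      using d by (simp add: qbin_def s D_def)
    have m: "m - k = Suc d" using d by simp
    show ?thesis unfolding l r1 r2 m e using nz(1) AD by (simp add: field_simps)
  qed
qed

text \<open>
  The homogeneous form in x and y avoids negative powers of q in its application below.
\<close>

lemma q_binomial_theorem:
  fixes p x y :: complex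
  assumes p: "norm p < 1"
  shows "(\<Prod>i<m. y + p ^ i * x) = (\<Sum>k\<le>m. p ^ (k choose 2) * qbin p m k * x ^ k * y ^ (m - k))"
proof (induction m)
  case 0
  show ?case by (simp add: qbin_def qpoch_def binomial_eq_0)
next
  case (Suc m)
  define c where "c m k = p ^ (k choose 2) * qbin p m k * x ^ k * y ^ (m - k)" for m k
  have c0: "c (Suc m) 0 = y * c m 0"
    using qpoch_nonzero[OF p] by (simp add: c_def qbin_def qpoch_def[of p 0])
  have cS: "c (Suc m) (Suc k) = y * (if k < m then c m (Suc k) else 0) + p ^ m * x * c m k" if "k \<le> m" for k
  proof -
    have ch: "p ^ (Suc k choose 2) = p ^ k * p ^ (k choose 2)"
      by (simp add: numeral_2_eq_2 power_add)
    have pm: "p ^ k * p ^ (m - k) = p ^ m" using that by (simp flip: power_add)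
    have "c (Suc m) (Suc k) = p ^ (Suc k choose 2) * qbin p m (Suc k) * x ^ Suc k * y ^ (m - k)
         + (p ^ k * p ^ (m - k)) * x * (p ^ (k choose 2) * qbin p m k * x ^ k * y ^ (m - k))"
      unfolding c_def qbin_pascal[OF p that] ch by (simp add: algebra_simps)
    also have "p ^ (Suc k choose 2) * qbin p m (Suc k) * x ^ Suc k * y ^ (m - k) = y * (if k < m then c m (Suc k) else 0)"
    proof (cases "k < m")
      case True
      then have "m - k = Suc (m - Suc k)" by simp
      then show ?thesis using True by (simp add: c_def)
    next
      case False
      then show ?thesis using that by (simp add: qbin_def)
    qed
    finally show ?thesis unfolding pm c_def .
  qed
  have "(\<Sum>k\<le>Suc m. c (Suc m) k) = c (Suc m) 0 + (\<Sum>k\<le>m. c (Suc m) (Suc k))"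
    by (rule sum.atMost_Suc_shift)
  also have "(\<Sum>k\<le>m. c (Suc m) (Suc k)) = (\<Sum>k\<le>m. y * (if k < m then c m (Suc k) else 0) + p ^ m * x * c m k)"
    by (rule sum.cong) (auto simp: cS)
  also have "\<dots> = y * (\<Sum>k\<le>m. if k < m then c m (Suc k) else 0) + p ^ m * x * (\<Sum>k\<le>m. c m k)"
    by (simp add: sum.distrib sum_distrib_left)
  also have "(\<Sum>k\<le>m. if k < m then c m (Suc k) else 0) = (\<Sum>k<m. c m (Suc k))"
    by (rule sum.mono_neutral_cong_right) auto
  finally have "(\<Sum>k\<le>Suc m. c (Suc m) k) = y * (c m 0 + (\<Sum>k<m. c m (Suc k))) + p ^ m * x * (\<Sum>k\<le>m. c m k)"
    by (simp add: c0 algebra_simps)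
  also have "c m 0 + (\<Sum>k<m. c m (Suc k)) = (\<Sum>k\<le>m. c m k)"
    by (simp add: sum.atMost_shift)
  finally show ?case using Suc by (simp add: c_def algebra_simps)
qed

text \<open>
  The q-binomial theorem with p = q^2, x = 1, y = q^(2N - 1) and 2N factors. Both sides of that
  instance carry the factor q^E with E = 3 N^2 - 2 N.
\<close>

lemma finite_jacobi_product:
  fixes q :: complex
  assumes q: "norm q < 1" "q \<noteq> 0"
  shows "(\<Prod>j<N. 1 + q ^ (2*j+1))\<^sup>2 =
    (\<Sum>k\<in>{- int N..int N}. q ^ nat (k\<^sup>2) * qbin (q\<^sup>2) (2*N) (nat (k + int N)))"
proof (cases "N = 0")
  case True
  then show ?thesis by (simp add: qbin_def qpoch_def)
next
  case False
  then obtain M where M: "N = Suc M" by (cases N) auto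
  have p: "norm (q\<^sup>2) < 1" using q by (simp add: norm_power power_less_one_iff)
  define E where "E = 3 * N\<^sup>2 - 2 * N"
  have NN: "2 * N \<le> 3 * N\<^sup>2" using M by (simp add: power2_eq_square)
  have "(\<Prod>i<2*N. q ^ (2*N-1) + (q\<^sup>2) ^ i * 1) = q ^ E * (\<Prod>j<N. 1 + q ^ (2*j+1))\<^sup>2"
  proof -
    have low: "q ^ (2 * (N - Suc (N - Suc i))) * (1 + q ^ (2 * (N - Suc i) + 1)) = q ^ (2*N-1) + (q\<^sup>2) ^ i" if "i < N" for i
    proof -
      have e: "2*N-1 = 2*i + (2*(N - Suc i)+1)" "N - Suc (N - Suc i) = i" using that by linarith+
      show ?thesis unfolding e(2) by (subst e(1)) (simp add: distrib_left flip: power_add power_mult)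
    qed
    have high: "q ^ (2*N-1) * (1 + q ^ (2 * (i - N) + 1)) = q ^ (2*N-1) + (q\<^sup>2) ^ i" if "N \<le> i" for i
    proof -
      have e: "2*i = (2*N-1) + (2*(i-N)+1)" using that M by linarith
      show ?thesis unfolding power_mult[symmetric] by (subst e) (simp only: distrib_left power_add mult_1_right)
    qed
    have sp: "{..<2*N} = {..<N} \<union> {N..<2*N}" by auto
    have "(\<Prod>i<2*N. q ^ (2*N-1) + (q\<^sup>2) ^ i * 1) = (\<Prod>i<N. q ^ (2*N-1) + (q\<^sup>2) ^ i) * (\<Prod>i\<in>{N..<2*N}. q ^ (2*N-1) + (q\<^sup>2) ^ i)"
      unfolding sp by (subst prod.union_disjoint) auto
    also have "(\<Prod>i<N. q ^ (2*N-1) + (q\<^sup>2) ^ i) = (\<Prod>j<N. q ^ (2 * (N - Suc j)) * (1 + q ^ (2*j+1)))"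
      by (rule prod.reindex_bij_witness[of _ "\<lambda>j. N - Suc j" "\<lambda>i. N - Suc i"])
         (use low in auto)
    also have "\<dots> = (\<Prod>j<N. q ^ (2 * j)) * (\<Prod>j<N. 1 + q ^ (2*j+1))"
      by (simp add: prod.distrib prod.nat_diff_reindex[of "\<lambda>j. q ^ (2 * j)"])
    also have "(\<Prod>i\<in>{N..<2*N}. q ^ (2*N-1) + (q\<^sup>2) ^ i) = (\<Prod>j<N. q ^ (2*N-1) * (1 + q ^ (2*j+1)))"
      by (rule prod.reindex_bij_witness[of _ "\<lambda>j. N + j" "\<lambda>i. i - N"])
         (use high in auto)
    also have "\<dots> = (q ^ (2*N-1)) ^ N * (\<Prod>j<N. 1 + q ^ (2*j+1))" by (simp add: prod.distrib)
    also have "(\<Prod>j<N. q ^ (2 * j)) = q ^ (\<Sum>j<N. 2 * j)" by (rule power_sum[symmetric])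
    also have "(\<Sum>j<N. 2 * j) = N * (N - 1)"
      by (induction N) (auto simp: algebra_simps)
    finally have "(\<Prod>i<2*N. q ^ (2*N-1) + (q\<^sup>2) ^ i * 1) = q ^ (N * (N - 1) + (2*N-1) * N) * (\<Prod>j<N. 1 + q ^ (2*j+1))\<^sup>2"
      by (simp only: power_add power_mult power2_eq_square mult_1_right) (simp only: ac_simps)
    also have "N * (N - 1) + (2*N-1) * N = E"
      unfolding E_def M by (simp add: power2_eq_square algebra_simps)
    finally show ?thesis .
  qed
  also have "(\<Prod>i<2*N. q ^ (2*N-1) + (q\<^sup>2) ^ i * 1) =
      (\<Sum>k\<le>2*N. (q\<^sup>2) ^ (k choose 2) * qbin (q\<^sup>2) (2*N) k * 1 ^ k * (q ^ (2*N-1)) ^ (2*N - k))"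
    by (rule q_binomial_theorem[OF p])
  also have "\<dots> = (\<Sum>k\<le>2*N. q ^ E * (q ^ nat ((int k - int N)\<^sup>2) * qbin (q\<^sup>2) (2*N) k))"
  proof (rule sum.cong[OF refl])
    fix k assume "k \<in> {..2*N}"
    then have k: "k \<le> 2*N" by simp
    have c2: "2 * (k choose 2) = k * (k - 1)" unfolding choose_two by (cases k) auto
    have "int (k * (k - 1)) = int k * (int k - 1)" by (cases k) (auto simp: algebra_simps)
    moreover have "int ((2*N-1) * (2*N-k)) = (2 * int N - 1) * (2 * int N - int k)"
    proof -
      have "int (2*N-1) = 2 * int N - 1" "int (2*N-k) = 2 * int N - int k" using k M by linarith+
      then show ?thesis by (simp only: of_nat_mult)
    qed
    moreover have "int E = 3 * (int N)\<^sup>2 - 2 * int N" unfolding E_def using NN by (simp add: of_nat_diff)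
    ultimately have "int (2 * (k choose 2) + (2*N-1) * (2*N-k)) = int E + (int k - int N)\<^sup>2"
      unfolding c2 of_nat_add by (simp add: power2_eq_square algebra_simps)
    then have ex: "2 * (k choose 2) + (2*N-1) * (2*N-k) = E + nat ((int k - int N)\<^sup>2)"
      by (metis nat_int nat_int_add zero_le_power2 int_nat_eq)
    have "(q\<^sup>2) ^ (k choose 2) * (q ^ (2*N-1)) ^ (2*N - k) = q ^ (2 * (k choose 2) + (2*N-1) * (2*N-k))"
      by (simp add: power_mult power_add)
    then show "(q\<^sup>2) ^ (k choose 2) * qbin (q\<^sup>2) (2*N) k * 1 ^ k * (q ^ (2*N-1)) ^ (2*N - k) =
      q ^ E * (q ^ nat ((int k - int N)\<^sup>2) * qbin (q\<^sup>2) (2*N) k)"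
      unfolding ex by (simp add: power_add mult_ac)
  qed
  also have "\<dots> = q ^ E * (\<Sum>k\<le>2*N. q ^ nat ((int k - int N)\<^sup>2) * qbin (q\<^sup>2) (2*N) k)"
    by (rule sum_distrib_left[symmetric])
  also have "(\<Sum>k\<le>2*N. q ^ nat ((int k - int N)\<^sup>2) * qbin (q\<^sup>2) (2*N) k) =
     (\<Sum>k\<in>{- int N..int N}. q ^ nat (k\<^sup>2) * qbin (q\<^sup>2) (2*N) (nat (k + int N)))"
    by (rule sum.reindex_bij_witness[of _ "\<lambda>k. nat (k + int N)" "\<lambda>k. int k - int N"]) auto
  finally show ?thesis using q(2) by simp
qed

text \<open>
  An absolutely convergent product without vanishing factors does not vanish.
\<close>

lemma LIMSEQ_prod_one_plus:
  fixes f :: "nat \<Rightarrow> complex"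
  assumes "summable (\<lambda>i. norm (f i))" and nz: "\<And>i. 1 + f i \<noteq> 0"
  obtains P where "P \<noteq> 0" "(\<lambda>n. \<Prod>i<n. 1 + f i) \<longlonglongrightarrow> P"
proof -
  have "abs_convergent_prod (\<lambda>i. 1 + f i)"
    using assms(1) by (simp add: abs_convergent_prod_conv_summable)
  then have c: "convergent_prod (\<lambda>i. 1 + f i)" by (rule abs_convergent_prod_imp_convergent_prod)
  have "(\<lambda>n. \<Prod>i\<le>n. 1 + f i) \<longlonglongrightarrow> prodinf (\<lambda>i. 1 + f i)" by (rule convergent_prod_LIMSEQ[OF c])
  then have "(\<lambda>n. \<Prod>i<Suc n. 1 + f i) \<longlonglongrightarrow> prodinf (\<lambda>i. 1 + f i)" by (simp add: lessThan_Suc_atMost)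
  then have "(\<lambda>n. \<Prod>i<n. 1 + f i) \<longlonglongrightarrow> prodinf (\<lambda>i. 1 + f i)" by (rule LIMSEQ_imp_Suc)
  moreover have "prodinf (\<lambda>i. 1 + f i) \<noteq> 0" by (rule prodinf_nonzero[OF c nz])
  ultimately show ?thesis using that by blast
qed

lemma theta_sq_0: "theta_sq 0 = 1"
proof -
  have "((\<lambda>k::int. (0::complex) ^ nat (k\<^sup>2)) has_sum 1) UNIV"
    by (rule has_sum_finite_neutralI[of "{0}"]) (auto simp: power_0_left)
  then show ?thesis by (simp add: theta_sq_def wt_series_def infsumI)
qed

text \<open>
  Letting N tend to infinity in the finite product gives Jacobi's formula
  theta_sq q = prod (1 - q^(2i)) (1 + q^(2i - 1))^2, a product of nonzero factors.
\<close>

theorem theta_sq_nonzero: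
  assumes q: "norm q < 1"
  shows "theta_sq q \<noteq> 0"
proof (cases "q = 0")
  case True
  then show ?thesis by (simp add: theta_sq_0)
next
  case False
  define p where "p = q\<^sup>2"
  have p: "norm p < 1" using q by (simp add: p_def norm_power power_less_one_iff)
  have geo: "summable (\<lambda>i. norm q ^ i)" using q by (intro summable_geometric) auto
  obtain P where P: "P \<noteq> 0" "(\<lambda>n. \<Prod>i<n. 1 + - (p ^ Suc i)) \<longlonglongrightarrow> P"
  proof (rule LIMSEQ_prod_one_plus[of "\<lambda>i. - (p ^ Suc i)"])
    have "summable (\<lambda>i. norm p * norm p ^ i)" using p by (intro summable_mult summable_geometric) simp
    then show "summable (\<lambda>i. norm (- (p ^ Suc i)))" by (simp add: norm_power norm_mult)
    show "1 + - (p ^ Suc i) \<noteq> 0" for i using one_minus_power_nonzero[OF p] by simp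
  qed
  then have Pl: "qpoch p \<longlonglongrightarrow> P" by (simp add: qpoch_def[abs_def])
  obtain Q where Q: "Q \<noteq> 0" "(\<lambda>n. \<Prod>i<n. 1 + q ^ (2*i+1)) \<longlonglongrightarrow> Q"
  proof (rule LIMSEQ_prod_one_plus[of "\<lambda>i. q ^ (2*i+1)"])
    show "summable (\<lambda>i. norm (q ^ (2*i+1)))"
    proof (rule summable_comparison_test'[OF geo, of 0])
      show "norm (norm (q ^ (2*i+1))) \<le> norm q ^ i" for i
        using power_decreasing[of i "2*i+1" "norm q"] q by (simp add: norm_power norm_mult)
    qed
    show "1 + q ^ (2*i+1) \<noteq> 0" for i
    proof
      assume "1 + q ^ (2*i+1) = 0"
      then have "- (q ^ (2*i+1)) = 1" by (simp add: add_eq_0_iff)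
      then have "1 - (- q) ^ Suc (2*i) = 0" by simp
      then show False using one_minus_power_nonzero[of "-q" "2*i"] q by simp
    qed
  qed
  define f where "f N k = (if \<bar>k\<bar> \<le> int N then q ^ nat (k\<^sup>2) * qbin p (2*N) (nat (k + int N)) else 0)" for N and k :: int
  have "(\<lambda>N. infsum (f N) UNIV) \<longlonglongrightarrow> (\<Sum>\<^sub>\<infinity>k. q ^ nat (k\<^sup>2) * (1 / P))"
  proof -
    obtain U where U: "\<And>n. norm (qpoch p n) \<le> U"
      using convergent_imp_Bseq[of "qpoch p"] Pl by (auto simp: convergent_def Bseq_def)
    have "(\<lambda>n. inverse (qpoch p n)) \<longlonglongrightarrow> inverse P" by (rule tendsto_inverse[OF Pl P(1)])
    then obtain V where V: "\<And>n. norm (inverse (qpoch p n)) \<le> V"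
      using convergent_imp_Bseq[of "\<lambda>n. inverse (qpoch p n)"] by (auto simp: convergent_def Bseq_def)
    have UV: "0 \<le> U" "0 \<le> V" using order_trans[OF norm_ge_zero U] order_trans[OF norm_ge_zero V] by auto
    (* U bounds the Pochhammer symbols and V their inverses, so U V V bounds all q-binomial coefficients. *)
    show ?thesis
    proof (rule infsum_int_dominated_convergence[where M = "\<lambda>k. norm (q ^ nat (k\<^sup>2)) * (U * (V * V))"])
      show "(\<lambda>k::int. norm (q ^ nat (k\<^sup>2)) * (U * (V * V))) summable_on UNIV"
        by (intro summable_on_cmult_left wt_series_abs_summable wt_summable_squares q)
      show "norm (f N k) \<le> norm (q ^ nat (k\<^sup>2)) * (U * (V * V))" for N k
      proof (cases "\<bar>k\<bar> \<le> int N")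
        case True
        then have "nat (k + int N) \<le> 2 * N" by linarith
        then have "qbin p (2*N) (nat (k + int N)) = qpoch p (2*N) * (inverse (qpoch p (nat (k + int N))) * inverse (qpoch p (2*N - nat (k + int N))))"
          by (simp add: qbin_def divide_inverse)
        then have "norm (qbin p (2*N) (nat (k + int N))) \<le> U * (V * V)"
          using UV by (simp only: norm_mult) (intro mult_mono U V mult_nonneg_nonneg norm_ge_zero, auto)
        then show ?thesis using True by (simp add: f_def norm_mult mult_left_mono)
      next
        case False
        then show ?thesis using UV by (simp add: f_def)
      qed
      show "(\<lambda>N. f N k) \<longlonglongrightarrow> q ^ nat (k\<^sup>2) * (1 / P)" for k
      proof -
        have f1: "filterlim (\<lambda>N. nat (k + int N)) at_top sequentially"
          unfolding filterlim_at_top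
        proof
          fix Z show "\<forall>\<^sub>F N in sequentially. Z \<le> nat (k + int N)"
            using eventually_ge_at_top[of "Z + nat \<bar>k\<bar>"] by eventually_elim linarith
        qed
        have f2: "filterlim (\<lambda>N. 2 * N - nat (k + int N)) at_top sequentially"
          unfolding filterlim_at_top
        proof
          fix Z show "\<forall>\<^sub>F N in sequentially. Z \<le> 2 * N - nat (k + int N)"
            using eventually_ge_at_top[of "Z + nat \<bar>k\<bar>"] by eventually_elim linarith
        qed
        have f3: "filterlim (\<lambda>N::nat. 2 * N) at_top sequentially"
          by (rule filterlim_subseq) (simp add: strict_mono_def)
        have "(\<lambda>N. q ^ nat (k\<^sup>2) * (qpoch p (2*N) / (qpoch p (nat (k + int N)) * qpoch p (2*N - nat (k + int N)))))
           \<longlonglongrightarrow> q ^ nat (k\<^sup>2) * (P / (P * P))"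
          using P(1) by (intro tendsto_intros filterlim_compose[OF Pl] f1 f2 f3) auto
        then have "(\<lambda>N. q ^ nat (k\<^sup>2) * (qpoch p (2*N) / (qpoch p (nat (k + int N)) * qpoch p (2*N - nat (k + int N)))))
           \<longlonglongrightarrow> q ^ nat (k\<^sup>2) * (1 / P)" using P(1) by simp
        moreover have "\<forall>\<^sub>F N in sequentially. q ^ nat (k\<^sup>2) * (qpoch p (2*N) / (qpoch p (nat (k + int N)) * qpoch p (2*N - nat (k + int N)))) = f N k"
          using eventually_ge_at_top[of "nat \<bar>k\<bar>"]
        proof eventually_elim
          case (elim N)
          then have "\<bar>k\<bar> \<le> int N" "nat (k + int N) \<le> 2 * N" by linarith+
          then show ?case by (simp add: f_def qbin_def)
        qed
        ultimately show ?thesis by (rule Lim_transform_eventually)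
      qed
    qed
  qed
  moreover have "infsum (f N) UNIV = (\<Prod>j<N. 1 + q ^ (2*j+1))\<^sup>2" for N
  proof -
    have "infsum (f N) UNIV = infsum (f N) {- int N..int N}"
      by (rule infsum_cong_neutral) (auto simp: f_def)
    also have "\<dots> = (\<Sum>k\<in>{- int N..int N}. f N k)" by simp
    also have "\<dots> = (\<Sum>k\<in>{- int N..int N}. q ^ nat (k\<^sup>2) * qbin (q\<^sup>2) (2*N) (nat (k + int N)))"
      by (rule sum.cong) (auto simp: f_def p_def)
    finally show ?thesis using finite_jacobi_product[OF q False] by simp
  qed
  ultimately have "(\<lambda>N. (\<Prod>j<N. 1 + q ^ (2*j+1))\<^sup>2) \<longlonglongrightarrow> (\<Sum>\<^sub>\<infinity>k. q ^ nat (k\<^sup>2) * (1 / P))" by simp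
  moreover have "(\<lambda>N. (\<Prod>j<N. 1 + q ^ (2*j+1))\<^sup>2) \<longlonglongrightarrow> Q\<^sup>2" by (intro tendsto_intros Q(2))
  ultimately have "Q\<^sup>2 = (\<Sum>\<^sub>\<infinity>k::int. q ^ nat (k\<^sup>2) * (1 / P))" using LIMSEQ_unique by blast
  also have "\<dots> = theta_sq q * (1 / P)" unfolding theta_sq_def wt_series_def by (rule infsum_cmult_left')
  finally show ?thesis using Q(1) by auto
qed

section \<open>Characteristic vectors and inversion on the imaginary axis\<close>

text \<open>
  Modulo 2 the map v -> v . v is additive on L. Prescribing its values on a basis gives a linear
  functional, which is the inner product with some vector c. As c takes integral values on L, it lies
  in the dual lattice, that is, in L.
\<close>

lemma characteristic_vector_exists:
  fixes L :: "(real ^ 'n) set"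
  assumes L: "integral_unimodular_lattice L"
  shows "\<exists>c. c \<in> characteristic_vectors L"
proof -
  have lat: "full_rank_lattice L" and int: "\<And>v w. v \<in> L \<Longrightarrow> w \<in> L \<Longrightarrow> v \<bullet> w \<in> \<int>"
    and dual: "dual_lattice L = L"
    using L by (auto simp: integral_unimodular_lattice_def)
  obtain B where B: "independent B" "finite B" "B \<subseteq> L"
    and LB: "L = range (\<lambda>c :: real ^ 'n \<Rightarrow> int. \<Sum>b\<in>B. of_int (c b) *\<^sub>R b)"
    by (rule full_rank_lattice_basis[OF lat])
  obtain g :: "real ^ 'n \<Rightarrow> real" where g: "linear g" "\<And>b. b \<in> B \<Longrightarrow> g b = b \<bullet> b"
    using linear_independent_extend[OF B(1), of "\<lambda>b. b \<bullet> b"] by blast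
  define c where "c = adjoint g 1"
  have gc: "v \<bullet> c = g v" for v using adjoint_works[OF g(1), of v 1] by (simp add: c_def)
  define P where "P v \<longleftrightarrow> v \<in> L \<and> (\<exists>k::int. v \<bullet> c - v \<bullet> v = 2 * of_int k)" for v
  have P0: "P 0" using lattice_closed(1)[OF lat] by (auto simp: P_def intro: exI[of _ 0])
  have Padd: "P (v + w)" if vw: "P v" "P w" for v w
  proof -
    obtain k l :: int where kl: "v \<bullet> c - v \<bullet> v = 2 * of_int k" "w \<bullet> c - w \<bullet> w = 2 * of_int l"
      using vw by (auto simp: P_def)
    have "v \<bullet> w \<in> \<int>" using vw int by (auto simp: P_def)
    then obtain m where m: "v \<bullet> w = of_int m" by (elim Ints_cases)
    have "(v + w) \<bullet> c - (v + w) \<bullet> (v + w) = (v \<bullet> c - v \<bullet> v) + (w \<bullet> c - w \<bullet> w) - 2 * (v \<bullet> w)"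
      by (simp add: inner_add_left inner_add_right inner_commute)
    also have "\<dots> = 2 * of_int (k + l - m)" unfolding kl m by simp
    finally show ?thesis using lattice_closed(2)[OF lat, of v w] vw unfolding P_def by blast
  qed
  have Pm: "P (of_int m *\<^sub>R b)" if bB: "b \<in> B" for m b
  proof -
    have "b \<in> L" using bB B(3) by blast
    then obtain j where j: "b \<bullet> b = of_int j" using int[of b b] by (auto elim: Ints_cases)
    have "even (m - m * m)" by simp
    then obtain i where i: "m - m * m = 2 * i" by (elim evenE)
    have "(of_int m *\<^sub>R b) \<bullet> c - (of_int m *\<^sub>R b) \<bullet> (of_int m *\<^sub>R b) = of_int (m - m * m) * of_int j"
      using gc[of b] g(2)[OF bB] j by (simp add: algebra_simps)
    also have "\<dots> = 2 * of_int (i * j)" unfolding i by simp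
    finally show ?thesis using lattice_closed(4)[OF lat, of b m] bB B(3) unfolding P_def by blast
  qed
  have PL: "P v" if vL: "v \<in> L" for v
  proof -
    obtain a where v: "v = (\<Sum>b\<in>B. of_int (a b) *\<^sub>R b)" using vL unfolding LB by blast
    have "P (\<Sum>b\<in>B'. of_int (a b) *\<^sub>R b)" if "finite B'" "B' \<subseteq> B" for B'
      using that by induction (auto intro: P0 Padd Pm)
    then show ?thesis unfolding v using B(2) by blast
  qed
  have "v \<bullet> c \<in> \<int>" if v: "v \<in> L" for v
  proof -
    obtain k :: int where "v \<bullet> c - v \<bullet> v = 2 * of_int k" using PL[OF v] by (auto simp: P_def)
    then have "v \<bullet> c = v \<bullet> v + of_int (2 * k)" by simp
    then show ?thesis using int[OF v v] by (metis Ints_add Ints_of_int)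
  qed
  then have "c \<in> L" using dual by (auto simp: dual_lattice_def)
  then show ?thesis using PL unfolding characteristic_vectors_def P_def by blast
qed

text \<open>
  The difference of two characteristic vectors has even inner products with L, so its half lies in the
  dual lattice.
\<close>

lemma characteristic_vectors_coset:
  fixes L :: "(real ^ 'n) set"
  assumes L: "integral_unimodular_lattice L" and c: "c \<in> characteristic_vectors L"
  shows "bij_betw (\<lambda>v. 2 *\<^sub>R v + c) L (characteristic_vectors L)"
proof (rule bij_betw_imageI)
  have lat: "full_rank_lattice L" and int: "\<And>v w. v \<in> L \<Longrightarrow> w \<in> L \<Longrightarrow> v \<bullet> w \<in> \<int>"
    and dual: "dual_lattice L = L"
    using L by (auto simp: integral_unimodular_lattice_def)
  show "inj_on (\<lambda>v. 2 *\<^sub>R v + c) L" by (rule inj_onI) simp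
  show "(\<lambda>v. 2 *\<^sub>R v + c) ` L = characteristic_vectors L"
  proof (intro equalityI subsetI)
    fix w assume "w \<in> (\<lambda>v. 2 *\<^sub>R v + c) ` L"
    then obtain v where v: "v \<in> L" "w = 2 *\<^sub>R v + c" by blast
    have "w \<in> L" unfolding v(2) using lattice_closed(4)[OF lat v(1), of 2] c
      by (intro lattice_closed(2)[OF lat]) (auto simp: characteristic_vectors_def)
    moreover have "\<exists>k::int. x \<bullet> w - x \<bullet> x = 2 * of_int k" if x: "x \<in> L" for x
    proof -
      obtain k :: int where k: "x \<bullet> c - x \<bullet> x = 2 * of_int k" using c x by (auto simp: characteristic_vectors_def)
      obtain j where j: "x \<bullet> v = of_int j" using int[OF x v(1)] by (elim Ints_cases)
      have "x \<bullet> w - x \<bullet> x = 2 * of_int (k + j)" using k j by (simp add: v(2) inner_add_right)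
      then show ?thesis by blast
    qed
    ultimately show "w \<in> characteristic_vectors L" by (auto simp: characteristic_vectors_def)
  next
    fix w assume w: "w \<in> characteristic_vectors L"
    define v where "v = (1/2) *\<^sub>R (w - c)"
    have "x \<bullet> v \<in> \<int>" if x: "x \<in> L" for x
    proof -
      obtain k :: int where k: "x \<bullet> c - x \<bullet> x = 2 * of_int k" using c x by (auto simp: characteristic_vectors_def)
      obtain l :: int where "x \<bullet> w - x \<bullet> x = 2 * of_int l" using w x by (auto simp: characteristic_vectors_def)
      with k have "x \<bullet> v = of_int (l - k)" by (simp add: v_def inner_diff_right)
      then show ?thesis by (metis Ints_of_int)
    qed
    then have "v \<in> L" using dual by (auto simp: dual_lattice_def)
    moreover have "w = 2 *\<^sub>R v + c" by (simp add: v_def)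
    ultimately show "w \<in> (\<lambda>v. 2 *\<^sub>R v + c) ` L" by blast
  qed
qed

definition sqnorm :: "(real ^ 'n) \<Rightarrow> nat" where "sqnorm v = nat \<lfloor>v \<bullet> v\<rfloor>"

lemma of_nat_sqnorm:
  assumes "integral_unimodular_lattice L" "v \<in> L"
  shows "real (sqnorm v) = v \<bullet> v"
proof -
  have "v \<bullet> v \<in> \<int>" using assms by (auto simp: integral_unimodular_lattice_def)
  then obtain k where k: "v \<bullet> v = of_int k" by (elim Ints_cases)
  moreover have "k \<ge> 0" using k inner_ge_zero[of v] by simp
  ultimately show ?thesis by (simp add: sqnorm_def)
qed

lemma characteristic_subset: "characteristic_vectors L \<subseteq> L"
  by (auto simp: characteristic_vectors_def)

lemma exp_power_sqnorm:
  assumes "integral_unimodular_lattice L" "v \<in> L"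
  shows "exp (- pi * t) ^ sqnorm v = gauss t v"
proof -
  have "exp (- pi * t) ^ sqnorm v = exp (real (sqnorm v) * (- pi * t))" by (rule exp_of_nat_mult[symmetric])
  then show ?thesis unfolding of_nat_sqnorm[OF assms] gauss_def power2_norm_eq_inner by (simp add: mult_ac)
qed

lemma wt_summable_lattice:
  assumes L: "integral_unimodular_lattice L"
  shows "wt_summable L sqnorm"
  unfolding wt_summable_def
proof (intro allI impI)
  fix r :: real assume r: "0 < r" "r < 1"
  define t where "t = - ln r / pi"
  have t: "t > 0" using r by (simp add: t_def divide_neg_pos)
  have e: "exp (- pi * t) = r" using r by (simp add: t_def)
  have "(\<lambda>v. gauss t (v + 0)) summable_on L" by (rule unimodular_poisson(1)[OF L t])
  then show "(\<lambda>v. r ^ sqnorm v) summable_on L"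
    by (rule summable_on_cong[THEN iffD1, rotated]) (simp add: exp_power_sqnorm[OF L, of _ t, unfolded e])
qed

lemma wt_summable_characteristic:
  assumes L: "integral_unimodular_lattice L"
  shows "wt_summable (characteristic_vectors L) sqnorm"
  using wt_summable_lattice[OF L] characteristic_subset unfolding wt_summable_def
  by (meson summable_on_subset_banach)

lemma infsum_of_real_nonneg:
  fixes f :: "'a \<Rightarrow> real"
  assumes "f summable_on S"
  shows "(\<Sum>\<^sub>\<infinity>s\<in>S. complex_of_real (f s)) = of_real (infsum f S)"
  using assms by (intro infsumI has_sum_of_real has_sum_infsum)

text \<open>
  The second formula is Poisson summation shifted by c/2 for a characteristic vector c: the
  character becomes the sign (-1)^(v . v), and the shifted lattice consists of the halves of the
  characteristic vectors.
\<close>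

lemma lattice_theta_inversion_real:
  fixes L :: "(real ^ 'n) set"
  assumes L: "integral_unimodular_lattice L" and t: "0 < t"
  shows "wt_series L sqnorm (of_real (exp (- pi / t))) = of_real (sqrt t ^ CARD('n)) * wt_series L sqnorm (of_real (exp (- pi * t)))"
    and "wt_series L sqnorm (- of_real (exp (- pi / t))) =
      of_real (sqrt t ^ CARD('n)) * wt_series (characteristic_vectors L) sqnorm (of_real (exp (- pi * t / 4)))"
proof -
  have st: "sqrt t ^ CARD('n) * (1 / sqrt t) ^ CARD('n) = 1" using t by (simp flip: power_mult_distrib)
  have pw: "of_real (exp (- pi * s)) ^ sqnorm v = complex_of_real (gauss s v)" if "v \<in> L" for s v
    using exp_power_sqnorm[OF L that, of s] by (metis of_real_power)
  have g: "wt_series L sqnorm (of_real (exp (- pi * s))) = of_real (\<Sum>\<^sub>\<infinity>v\<in>L. gauss s v)" if "s > 0" for s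
  proof -
    have "wt_series L sqnorm (of_real (exp (- pi * s))) = (\<Sum>\<^sub>\<infinity>v\<in>L. complex_of_real (gauss s v))"
      unfolding wt_series_def by (rule infsum_cong) (rule pw)
    also have "\<dots> = of_real (\<Sum>\<^sub>\<infinity>v\<in>L. gauss s v)"
      using unimodular_poisson(1)[OF L that, of 0] by (intro infsum_of_real_nonneg) simp
    finally show ?thesis .
  qed
  have "of_real (\<Sum>\<^sub>\<infinity>v\<in>L. gauss t v) =
       of_real ((1 / sqrt t) ^ CARD('n)) * (\<Sum>\<^sub>\<infinity>v\<in>L. complex_of_real (gauss (1 / t) v))"
    using unimodular_poisson(2)[OF L t, of 0] by simp
  also have "(\<Sum>\<^sub>\<infinity>v\<in>L. complex_of_real (gauss (1 / t) v)) = wt_series L sqnorm (of_real (exp (- pi * (1 / t))))"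
    unfolding wt_series_def by (rule infsum_cong) (rule pw[symmetric])
  finally have "wt_series L sqnorm (of_real (exp (- pi * t))) = of_real ((1 / sqrt t) ^ CARD('n)) * wt_series L sqnorm (of_real (exp (- pi / t)))"
    using g[OF t] by simp
  then have "of_real (sqrt t ^ CARD('n)) * wt_series L sqnorm (of_real (exp (- pi * t))) =
     of_real (sqrt t ^ CARD('n) * (1 / sqrt t) ^ CARD('n)) * wt_series L sqnorm (of_real (exp (- pi / t)))"
    by (simp add: mult.assoc)
  then show "wt_series L sqnorm (of_real (exp (- pi / t))) = of_real (sqrt t ^ CARD('n)) * wt_series L sqnorm (of_real (exp (- pi * t)))"
    unfolding st by simp
  obtain c where c: "c \<in> characteristic_vectors L" using characteristic_vector_exists[OF L] by blast
  have sgn: "cis (2 * pi * (v \<bullet> ((1/2) *\<^sub>R c))) = (-1) ^ sqnorm v" if v: "v \<in> L" for v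
  proof -
    obtain k :: int where "v \<bullet> c - v \<bullet> v = 2 * of_int k" using c v by (auto simp: characteristic_vectors_def)
    then have "2 * pi * (v \<bullet> ((1/2) *\<^sub>R c)) = real (sqnorm v) * pi + 2 * pi * of_int k"
      using of_nat_sqnorm[OF L v] by (simp add: algebra_simps)
    then have "cis (2 * pi * (v \<bullet> ((1/2) *\<^sub>R c))) = cis (real (sqnorm v) * pi)"
      by (simp add: cis_multiple_2pi flip: cis_mult)
    also have "\<dots> = (-1) ^ sqnorm v" by (simp add: cis_pi flip: Complex.DeMoivre)
    finally show ?thesis .
  qed
  have "of_real (\<Sum>\<^sub>\<infinity>v\<in>L. gauss t (v + (1/2) *\<^sub>R c)) =
       of_real ((1 / sqrt t) ^ CARD('n)) *
       (\<Sum>\<^sub>\<infinity>v\<in>L. of_real (gauss (1 / t) v) * cis (2 * pi * (v \<bullet> ((1/2) *\<^sub>R c))))"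
    by (rule unimodular_poisson(2)[OF L t])
  also have "(\<Sum>\<^sub>\<infinity>v\<in>L. of_real (gauss (1 / t) v) * cis (2 * pi * (v \<bullet> ((1/2) *\<^sub>R c))))
     = wt_series L sqnorm (- of_real (exp (- pi / t)))"
    unfolding wt_series_def
  proof (rule infsum_cong)
    fix v assume v: "v \<in> L"
    have "(- complex_of_real (exp (- pi / t))) ^ sqnorm v = (-1) ^ sqnorm v * of_real (exp (- pi * (1/t))) ^ sqnorm v"
      by (subst power_minus) simp
    then show "of_real (gauss (1 / t) v) * cis (2 * pi * (v \<bullet> ((1/2) *\<^sub>R c))) = (- complex_of_real (exp (- pi / t))) ^ sqnorm v"
      unfolding sgn[OF v] pw[OF v] by (simp add: mult.commute)
  qed
  also have "(\<Sum>\<^sub>\<infinity>v\<in>L. gauss t (v + (1/2) *\<^sub>R c)) =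
      (\<Sum>\<^sub>\<infinity>w\<in>characteristic_vectors L. gauss (t / 4) w)"
  proof -
    have "gauss (t / 4) (2 *\<^sub>R v + c) = gauss t (v + (1/2) *\<^sub>R c)" for v
    proof -
      have "2 *\<^sub>R v + c = 2 *\<^sub>R (v + (1/2) *\<^sub>R c)" by (simp add: scaleR_add_right)
      then show ?thesis by (simp add: gauss_def power_mult_distrib)
    qed
    then show ?thesis
      using infsum_reindex_bij_betw[OF characteristic_vectors_coset[OF L c], of "gauss (t / 4)"] by simp
  qed
  also have "complex_of_real \<dots> = wt_series (characteristic_vectors L) sqnorm (of_real (exp (- pi * (t / 4))))"
  proof -
    have s: "(\<lambda>w. gauss (t / 4) w) summable_on characteristic_vectors L"
      using unimodular_poisson(1)[OF L, of "t/4" 0] t characteristic_subset[of L]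
      by (auto intro: summable_on_subset_banach)
    show ?thesis unfolding wt_series_def infsum_of_real_nonneg[OF s, symmetric]
      by (rule infsum_cong, rule pw[symmetric]) (use characteristic_subset[of L] in blast)
  qed
  finally have "of_real (sqrt t ^ CARD('n)) * wt_series (characteristic_vectors L) sqnorm (of_real (exp (- pi * (t / 4)))) =
     of_real (sqrt t ^ CARD('n) * (1 / sqrt t) ^ CARD('n)) * wt_series L sqnorm (- of_real (exp (- pi / t)))"
    by (simp add: mult.assoc)
  then show "wt_series L sqnorm (- of_real (exp (- pi / t))) =
      of_real (sqrt t ^ CARD('n)) * wt_series (characteristic_vectors L) sqnorm (of_real (exp (- pi * t / 4)))"
    unfolding st by simp
qed

text \<open>
  The analogue for the integers, whose characteristic vectors are the odd numbers 2k + 1 with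
  (2k + 1)^2 = 4 (k^2 + k) + 1.
\<close>

lemma theta_inversion_real:
  assumes t: "0 < t"
  shows "theta_sq (of_real (exp (- pi / t))) = of_real (sqrt t) * theta_sq (of_real (exp (- pi * t)))"
    and "theta_sq (- of_real (exp (- pi / t))) =
      of_real (sqrt t) * (of_real (exp (- pi * t / 4)) * theta_pronic (of_real (exp (- pi * t))))"
proof -
  have st: "complex_of_real (sqrt t) * of_real (1 / sqrt t) = 1" using t by (simp flip: of_real_mult)
  have pw: "complex_of_real (exp x) ^ nat k = of_real (exp (x * of_int k))" if "k \<ge> 0" for k x
  proof -
    have "exp x ^ nat k = exp (real (nat k) * x)" by (rule exp_of_nat_mult[symmetric])
    then show ?thesis using that by (simp add: mult.commute flip: of_real_power)
  qed
  have g: "theta_sq (of_real (exp (- pi * s))) = of_real (\<Sum>\<^sub>\<infinity>k::int. exp (- pi * s * (of_int k + 0)\<^sup>2))" if "s > 0" for s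
  proof -
    have "theta_sq (of_real (exp (- pi * s))) = (\<Sum>\<^sub>\<infinity>k::int. complex_of_real (exp (- pi * s * (of_int k + 0)\<^sup>2)))"
      unfolding theta_sq_def wt_series_def by (rule infsum_cong) (subst pw, auto)
    also have "\<dots> = of_real (\<Sum>\<^sub>\<infinity>k::int. exp (- pi * s * (of_int k + 0)\<^sup>2))"
      using gauss_summable[of "pi * s" 0] that by (intro infsum_of_real_nonneg) simp
    finally show ?thesis .
  qed
  have "theta_sq (of_real (exp (- pi * t))) = of_real (1 / sqrt t) *
      (\<Sum>\<^sub>\<infinity>k::int. of_real (exp (- pi * (of_int k)\<^sup>2 / t)) * cis (2 * pi * of_int k * 0))"
    unfolding g[OF t] by (rule gauss_poisson[OF t])
  also have "(\<Sum>\<^sub>\<infinity>k::int. of_real (exp (- pi * (of_int k)\<^sup>2 / t)) * cis (2 * pi * of_int k * 0)) = theta_sq (of_real (exp (- pi / t)))"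
    unfolding theta_sq_def wt_series_def by (rule infsum_cong) (subst pw, auto)
  finally have "of_real (sqrt t) * theta_sq (of_real (exp (- pi * t))) = (of_real (sqrt t) * of_real (1 / sqrt t)) * theta_sq (of_real (exp (- pi / t)))"
    by simp
  then show "theta_sq (of_real (exp (- pi / t))) = of_real (sqrt t) * theta_sq (of_real (exp (- pi * t)))"
    unfolding st by simp
  have sgn: "cis (2 * pi * of_int k * (1/2)) = (-1) ^ nat (k\<^sup>2)" for k :: int
  proof (cases "even k")
    case True
    then obtain m where m: "k = 2 * m" by (elim evenE)
    have "cis (2 * pi * of_int k * (1/2)) = cis (2 * pi * of_int m)"
      by (rule arg_cong[where f = cis]) (simp add: m)
    also have "\<dots> = 1" by (rule cis_multiple_2pi) simp
    finally show ?thesis using True by (simp add: even_nat_iff)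
  next
    case False
    then obtain m where m: "k = 2 * m + 1" by (elim oddE)
    have "cis (2 * pi * of_int k * (1/2)) = cis (2 * pi * of_int m) * cis pi"
      unfolding cis_mult by (rule arg_cong[where f = cis]) (simp add: m algebra_simps)
    also have "cis (2 * pi * of_int m) = 1" by (rule cis_multiple_2pi) simp
    also have "1 * cis pi = -1" by (simp add: cis_pi)
    finally show ?thesis using False by (simp add: even_nat_iff)
  qed
  have "of_real (\<Sum>\<^sub>\<infinity>k::int. exp (- pi * t * (of_int k + 1/2)\<^sup>2)) = of_real (1 / sqrt t) *
      (\<Sum>\<^sub>\<infinity>k::int. of_real (exp (- pi * (of_int k)\<^sup>2 / t)) * cis (2 * pi * of_int k * (1/2)))"
    by (rule gauss_poisson[OF t])
  also have "(\<Sum>\<^sub>\<infinity>k::int. of_real (exp (- pi * (of_int k)\<^sup>2 / t)) * cis (2 * pi * of_int k * (1/2))) = theta_sq (- of_real (exp (- pi / t)))"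
    unfolding theta_sq_def wt_series_def
  proof (rule infsum_cong)
    fix k :: int
    show "of_real (exp (- pi * (of_int k)\<^sup>2 / t)) * cis (2 * pi * of_int k * (1/2)) = (- complex_of_real (exp (- pi / t))) ^ nat (k\<^sup>2)"
      unfolding sgn by (subst power_minus, subst pw) (auto simp: mult.commute)
  qed
  also have "complex_of_real (\<Sum>\<^sub>\<infinity>k::int. exp (- pi * t * (of_int k + 1/2)\<^sup>2)) = of_real (exp (- pi * t / 4)) * theta_pronic (of_real (exp (- pi * t)))"
  proof -
    have "complex_of_real (\<Sum>\<^sub>\<infinity>k::int. exp (- pi * t * (of_int k + 1/2)\<^sup>2)) = (\<Sum>\<^sub>\<infinity>k::int. of_real (exp (- pi * t * (of_int k + 1/2)\<^sup>2)))"
      using gauss_summable[of "pi * t" "1/2"] t by (intro infsum_of_real_nonneg[symmetric]) simp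
    also have "\<dots> = (\<Sum>\<^sub>\<infinity>k::int. of_real (exp (- pi * t / 4)) * of_real (exp (- pi * t)) ^ nat (k\<^sup>2 + k))"
    proof (rule infsum_cong)
      fix k :: int
      have "- pi * t * (of_int k + 1/2)\<^sup>2 = (- pi * t / 4) + (- pi * t) * of_int (k\<^sup>2 + k)"
        by (simp add: power2_eq_square algebra_simps)
      then show "complex_of_real (exp (- pi * t * (of_int k + 1/2)\<^sup>2)) = of_real (exp (- pi * t / 4)) * of_real (exp (- pi * t)) ^ nat (k\<^sup>2 + k)"
        unfolding pw[OF pronic_nonneg] by (simp only: exp_add of_real_mult)
    qed
    also have "\<dots> = of_real (exp (- pi * t / 4)) * theta_pronic (of_real (exp (- pi * t)))"
      unfolding theta_pronic_def wt_series_def by (rule infsum_cmult_right')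
    finally show ?thesis .
  qed
  finally have "of_real (sqrt t) * (of_real (exp (- pi * t / 4)) * theta_pronic (of_real (exp (- pi * t)))) =
     (of_real (sqrt t) * of_real (1 / sqrt t)) * theta_sq (- of_real (exp (- pi / t)))" by (simp only: mult.assoc)
  then show "theta_sq (- of_real (exp (- pi / t))) =
      of_real (sqrt t) * (of_real (exp (- pi * t / 4)) * theta_pronic (of_real (exp (- pi * t))))"
    unfolding st by simp
qed

section \<open>A fundamental domain for the theta group\<close>

inductive theta_orbit :: "complex \<Rightarrow> complex \<Rightarrow> bool" for z where
  base: "theta_orbit z z"
| shift_up: "theta_orbit z w \<Longrightarrow> theta_orbit z (w + 2)"
| shift_down: "theta_orbit z w \<Longrightarrow> theta_orbit z (w - 2)"
| invert: "theta_orbit z w \<Longrightarrow> theta_orbit z (- 1 / w)"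

lemma Im_inversion: "Im (- 1 / w) = Im w / (norm w)\<^sup>2"
  by (simp add: Im_divide cmod_power2)

lemma linear_form_nonzero:
  assumes "Im z > 0" "a * d - b * c = (1::int)"
  shows "of_int c * z + of_int d \<noteq> 0"
proof
  assume e: "of_int c * z + of_int d = 0"
  then have "Im (of_int c * z + of_int d) = 0" by simp
  then have "c = 0" using assms(1) by simp
  with e have "d = 0" by simp
  with \<open>c = 0\<close> assms(2) show False by simp
qed

lemma theta_orbit_moebius:
  assumes "theta_orbit z w" and z: "Im z > 0"
  shows "\<exists>a b c d :: int. a * d - b * c = 1 \<and> w = (of_int a * z + of_int b) / (of_int c * z + of_int d)"
  using assms(1)
proof induction
  case base
  show ?case by (rule exI[of _ 1], rule exI[of _ 0], rule exI[of _ 0], rule exI[of _ 1]) simp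
next
  case (shift_up w)
  then obtain a b c d :: int where 1: "a * d - b * c = 1" "w = (of_int a * z + of_int b) / (of_int c * z + of_int d)" by blast
  note nz = linear_form_nonzero[OF z 1(1)]
  show ?case
    by (rule exI[of _ "a + 2 * c"], rule exI[of _ "b + 2 * d"], rule exI[of _ c], rule exI[of _ d])
       (use 1 nz in \<open>auto simp: field_simps\<close>)
next
  case (shift_down w)
  then obtain a b c d :: int where 1: "a * d - b * c = 1" "w = (of_int a * z + of_int b) / (of_int c * z + of_int d)" by blast
  note nz = linear_form_nonzero[OF z 1(1)]
  show ?case
    by (rule exI[of _ "a - 2 * c"], rule exI[of _ "b - 2 * d"], rule exI[of _ c], rule exI[of _ d])
       (use 1 nz in \<open>auto simp: field_simps\<close>)
next
  case (invert w)
  then obtain a b c d :: int where 1: "a * d - b * c = 1" "w = (of_int a * z + of_int b) / (of_int c * z + of_int d)" by blast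
  have "- 1 / w = (of_int (- c) * z + of_int (- d)) / (of_int a * z + of_int b)"
    by (simp add: 1(2) divide_simps)
  then show ?case using 1(1)
    by (intro exI[of _ "- c"] exI[of _ "- d"] exI[of _ a] exI[of _ b]) (auto simp: algebra_simps)
qed

lemma theta_orbit_Im:
  assumes "theta_orbit z w" and z: "Im z > 0"
  shows "Im w > 0"
  using assms(1)
proof induction
  case (invert w)
  then have "w \<noteq> 0" by auto
  then show ?case unfolding Im_inversion using invert by simp
qed (use z in auto)

lemma Im_moebius:
  assumes z: "Im z > 0" and det: "a * d - b * c = (1::int)"
  shows "Im ((of_int a * z + of_int b) / (of_int c * z + of_int d)) = Im z / (norm (of_int c * z + of_int d))\<^sup>2"
proof -
  have det': "real_of_int a * of_int d - of_int b * of_int c = 1"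
    using det by (metis of_int_1 of_int_diff of_int_mult)
  have "Im (of_int a * z + of_int b) * Re (of_int c * z + of_int d) - Re (of_int a * z + of_int b) * Im (of_int c * z + of_int d)
     = (real_of_int a * of_int d - of_int b * of_int c) * Im z"
    by (simp add: algebra_simps)
  then show ?thesis unfolding Im_divide cmod_power2 det' by simp
qed

text \<open>
  The imaginary part of (a z + b) / (c z + d) is Im z / |c z + d|^2, and it exceeds Im z only for the
  finitely many pairs (c, d) with |c z + d| at most 1.
\<close>

lemma theta_orbit_max_Im:
  assumes z: "Im z > 0"
  obtains w where "theta_orbit z w" "\<And>w'. theta_orbit z w' \<Longrightarrow> Im w' \<le> Im w"
proof -
  define I where "I = {Im w | w. theta_orbit z w \<and> Im z \<le> Im w}"
  define N where "N = \<lceil>1 / Im z\<rceil>"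
  define M where "M = \<lceil>1 + of_int N * norm z\<rceil>"
  have "I \<subseteq> (\<lambda>(c,d). Im z / (norm (of_int c * z + of_int d))\<^sup>2) ` ({-N..N} \<times> {-M..M})"
  proof
    fix y assume "y \<in> I"
    then obtain w where w: "y = Im w" "theta_orbit z w" "Im z \<le> Im w" by (auto simp: I_def)
    obtain a b c d :: int where 1: "a * d - b * c = 1" "w = (of_int a * z + of_int b) / (of_int c * z + of_int d)"
      using theta_orbit_moebius[OF w(2) z] by blast
    define u where "u = of_int c * z + of_int d"
    have u0: "u \<noteq> 0" unfolding u_def by (rule linear_form_nonzero[OF z 1(1)])
    have Iw: "Im w = Im z / (norm u)\<^sup>2" unfolding 1(2) u_def by (rule Im_moebius[OF z 1(1)])
    then have "Im z * (norm u)\<^sup>2 \<le> Im z * 1" using w(3) u0 by (simp add: le_divide_eq)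
    then have "(norm u)\<^sup>2 \<le> 1" using z by (simp only: mult_le_cancel_left_pos)
    then have u1: "norm u \<le> 1" by (simp add: power2_le_iff_abs_le abs_square_le_1)
    have "\<bar>real_of_int c\<bar> * Im z = \<bar>Im u\<bar>" using z by (simp add: u_def abs_mult)
    also have "\<dots> \<le> 1" using abs_Im_le_cmod[of u] u1 by linarith
    finally have "\<bar>real_of_int c\<bar> \<le> 1 / Im z" using z by (simp add: field_simps)
    then have c: "\<bar>c\<bar> \<le> N" unfolding N_def by linarith
    have "of_int d = u - of_int c * z" by (simp add: u_def)
    then have "norm (of_int d :: complex) \<le> norm u + norm (of_int c * z)" by (metis norm_triangle_ineq4)
    also have "\<dots> \<le> 1 + of_int N * norm z"
      using u1 c by (intro add_mono) (auto simp: norm_mult intro!: mult_right_mono)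
    finally have "\<bar>real_of_int d\<bar> \<le> 1 + of_int N * norm z" by simp
    then have d: "\<bar>d\<bar> \<le> M" unfolding M_def by linarith
    show "y \<in> (\<lambda>(c,d). Im z / (norm (of_int c * z + of_int d))\<^sup>2) ` ({-N..N} \<times> {-M..M})"
      using c d by (intro image_eqI[of _ _ "(c,d)"]) (auto simp: w(1) Iw u_def)
  qed
  then have fin: "finite I" by (rule finite_subset) simp
  have zI: "Im z \<in> I" unfolding I_def using base by blast
  have "Max I \<in> I" using fin zI by (intro Max_in) auto
  then obtain w where w: "theta_orbit z w" "Im w = Max I" "Im z \<le> Im w" by (auto simp: I_def)
  have "Im w' \<le> Im w" if "theta_orbit z w'" for w'
  proof (cases "Im z \<le> Im w'")
    case True
    then have "Im w' \<in> I" using that by (auto simp: I_def)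
    then show ?thesis using fin w(2) by simp
  qed (use w(3) in simp)
  then show ?thesis using that w(1) by blast
qed

lemma theta_orbit_even_shift: "theta_orbit z w \<Longrightarrow> theta_orbit z (w + 2 * of_int k)"
proof (induction k rule: int_induct[where k = 0])
  case (step1 i)
  then have "theta_orbit z (w + 2 * of_int i + 2)" using shift_up by blast
  then show ?case by (simp add: algebra_simps)
next
  case (step2 i)
  then have "theta_orbit z (w + 2 * of_int i - 2)" using shift_down by blast
  then show ?case by (simp add: algebra_simps)
qed simp

text \<open>
  For |x| at most 1 the second condition places x + i y outside the open discs of radius 1 around 1
  and -1. Below height 1 this leaves a thin region at 0, which the map z -> -1/z sends to
  imaginary parts of at least 1/2.
\<close>

lemma near_cusp:
  fixes x y :: real
  assumes y: "0 < y" "y < 1" and x: "\<bar>x\<bar> \<le> 1" "2 * \<bar>x\<bar> \<le> x\<^sup>2 + y\<^sup>2"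
  shows "y / (x\<^sup>2 + y\<^sup>2) \<ge> 1 / 2"
proof -
  have "x\<^sup>2 = \<bar>x\<bar> * \<bar>x\<bar>" by (simp add: power2_eq_square)
  also have "\<dots> \<le> \<bar>x\<bar> * 1" using x(1) by (intro mult_left_mono) auto
  finally have "\<bar>x\<bar> \<le> y\<^sup>2" using x(2) by linarith
  then have "x\<^sup>2 \<le> y\<^sup>2" using \<open>x\<^sup>2 = \<bar>x\<bar> * \<bar>x\<bar>\<close> \<open>\<bar>x\<bar> * \<bar>x\<bar> \<le> \<bar>x\<bar> * 1\<close> by linarith
  moreover have "y\<^sup>2 \<le> y" using y by (simp add: power2_eq_square)
  ultimately have "x\<^sup>2 + y\<^sup>2 \<le> 2 * y" by linarith
  moreover have "x\<^sup>2 + y\<^sup>2 > 0" using y(1) by (simp add: add_nonneg_pos)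
  ultimately show ?thesis by (simp add: field_simps)
qed

text \<open>
  A point of maximal imaginary part in its orbit, moved to |Re w| at most 1, lies outside the
  open unit disc. Either its imaginary part is at least 1, or it is close to one of the cusps 1 and -1,
  which are equivalent under z -> z + 2.
\<close>

theorem theta_group_bound:
  fixes G :: "complex \<Rightarrow> real"
  assumes inv2: "\<And>z. Im z > 0 \<Longrightarrow> G (z + 2) = G z"
    and invS: "\<And>z. Im z > 0 \<Longrightarrow> G (- 1 / z) = G z"
    and inf: "\<And>z. Im z \<ge> 1 \<Longrightarrow> G z \<le> C"
    and cusp: "\<And>w. Im w \<ge> 1 / 2 \<Longrightarrow> G (1 - 1 / w) \<le> C"
    and z: "Im z > 0"
  shows "G z \<le> C"
proof -
  have inv: "G w = G z" if "theta_orbit z w" for w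
    using that
  proof induction
    case (shift_down w)
    have "G (w - 2 + 2) = G (w - 2)" by (rule inv2) (use theta_orbit_Im[OF shift_down(1) z] in simp)
    then show ?case using shift_down by simp
  qed (use inv2 invS theta_orbit_Im[OF _ z] in simp_all)
  obtain w0 where w0: "theta_orbit z w0" "\<And>w'. theta_orbit z w' \<Longrightarrow> Im w' \<le> Im w0"
    using theta_orbit_max_Im[OF z] by blast
  define w where "w = w0 + 2 * of_int (- \<lfloor>(Re w0 + 1) / 2\<rfloor>)"
  have w: "theta_orbit z w" unfolding w_def by (rule theta_orbit_even_shift[OF w0(1)])
  have Iw: "Im w = Im w0" by (simp add: w_def)
  have Rw: "\<bar>Re w\<bar> \<le> 1"
  proof -
    define m where "m = \<lfloor>(Re w0 + 1) / 2\<rfloor>"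
    have "of_int m \<le> (Re w0 + 1) / 2" "(Re w0 + 1) / 2 < of_int m + 1" unfolding m_def by linarith+
    then have "2 * of_int m \<le> Re w0 + 1" "Re w0 + 1 < 2 * of_int m + 2" by (simp_all add: field_simps)
    moreover have "Re w = Re w0 - 2 * of_int m" by (simp add: w_def m_def)
    ultimately have "Re w \<le> 1" "- Re w \<le> 1" by simp_all
    then show ?thesis by (rule abs_leI)
  qed
  have pos: "Im w > 0" by (rule theta_orbit_Im[OF w z])
  have "Im (- 1 / w) \<le> Im w" using w0(2)[OF invert[OF w]] Iw by simp
  moreover have "(norm w)\<^sup>2 > 0" using pos by auto
  ultimately have "Im w * 1 \<le> Im w * (norm w)\<^sup>2" unfolding Im_inversion by (simp add: divide_le_eq)
  then have "1 \<le> (norm w)\<^sup>2" using pos by (simp only: mult_le_cancel_left_pos)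
  then have nw: "1 \<le> (Re w)\<^sup>2 + (Im w)\<^sup>2" by (simp add: cmod_power2)
  show ?thesis
  proof (cases "Im w \<ge> 1")
    case True
    then show ?thesis using inf inv[OF w] by metis
  next
    case False
    define w' where "w' = (if Re w \<ge> 0 then w else w + 2)"
    have w': "theta_orbit z w'" using w shift_up by (simp add: w'_def)
    define x where "x = Re w' - 1"
    define y where "y = Im w'"
    have y: "0 < y" "y < 1" using pos False by (auto simp: y_def w'_def)
    have x: "\<bar>x\<bar> \<le> 1" using Rw by (auto simp: x_def w'_def)
    have x2: "2 * \<bar>x\<bar> \<le> x\<^sup>2 + y\<^sup>2"
    proof (cases "Re w \<ge> 0")
      case True
      then have e: "Re w = 1 + x" "Im w = y" "\<bar>x\<bar> = - x" using Rw by (auto simp: x_def y_def w'_def)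
      show ?thesis using nw unfolding e by (simp add: power2_eq_square algebra_simps)
    next
      case F2: False
      then have e: "Re w = x - 1" "Im w = y" "\<bar>x\<bar> = x" using Rw by (auto simp: x_def y_def w'_def)
      show ?thesis using nw unfolding e by (simp add: power2_eq_square algebra_simps)
    qed
    define v where "v = - 1 / (w' - 1)"
    have ne: "w' \<noteq> 1" using y by (auto simp: y_def)
    have "Im v = y / (x\<^sup>2 + y\<^sup>2)" unfolding v_def Im_inversion by (simp add: cmod_power2 x_def y_def)
    then have "Im v \<ge> 1 / 2" using near_cusp[OF y x x2] by simp
    moreover have "1 - 1 / v = w'" using ne by (simp add: v_def)
    ultimately show ?thesis using cusp[of v] inv[OF w'] by simp
  qed
qed

section \<open>Theta functions on the upper half-plane\<close>

definition nome :: "complex \<Rightarrow> complex" where "nome z = exp (\<i> * of_real pi * z)"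

text \<open>
  The branch of the square root of z / i that is positive on the imaginary axis: the factor by
  which theta_3 transforms under z -> -1/z.
\<close>

definition inv_factor :: "complex \<Rightarrow> complex" where "inv_factor z = csqrt (- (\<i> * z))"

definition upper_half :: "complex set" where "upper_half = {z. Im z > 0}"

lemma open_upper_half: "open upper_half" unfolding upper_half_def by (rule open_halfspace_Im_gt)

lemma convex_upper_half: "convex upper_half" unfolding upper_half_def by (rule convex_halfspace_Im_gt)

lemma nome_add: "nome (z + w) = nome z * nome w"
  by (simp add: nome_def algebra_simps exp_add)

lemma nome_int: "nome (2 * of_int k) = 1"
  by (simp add: nome_def exp_eq_1) 

lemma nome_1: "nome 1 = - 1" by (simp add: nome_def)

lemma nome_power: "nome z ^ n = nome (of_nat n * z)"
proof -
  have "nome z ^ n = exp (of_nat n * (\<i> * of_real pi * z))" unfolding nome_def by (rule exp_of_nat_mult[symmetric])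
  then show ?thesis by (simp add: nome_def mult.left_commute)
qed

lemma nome_nonzero: "nome z \<noteq> 0" by (simp add: nome_def)

lemma norm_nome: "norm (nome z) = exp (- pi * Im z)" by (simp add: nome_def)

lemma norm_nome_less_1: "z \<in> upper_half \<Longrightarrow> norm (nome z) < 1" by (simp add: norm_nome upper_half_def)

lemma nome_eq_1_iff: "nome z = 1 \<longleftrightarrow> (\<exists>k::int. z = 2 * of_int k)"
proof
  assume "nome z = 1"
  then obtain k :: int where "Re (\<i> * of_real pi * z) = 0" "Im (\<i> * of_real pi * z) = of_int (2 * k) * pi"
    unfolding nome_def exp_eq_1 by blast
  then have "Im z = 0" "Re z = 2 * of_int k" by auto
  then have "z = 2 * of_int k" by (simp add: complex_eq_iff)
  then show "\<exists>k::int. z = 2 * of_int k" by blast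
qed (use nome_int in blast)

lemma nome_imaginary: "nome (\<i> * of_real t) = of_real (exp (- pi * t))"
proof -
  have "\<i> * of_real pi * (\<i> * of_real t) = complex_of_real (- pi * t)" by (simp add: complex_eq_iff)
  then show ?thesis by (simp only: nome_def exp_of_real)
qed

lemma nome_surj:
  assumes "0 < norm q" "norm q < 1"
  obtains z where "z \<in> upper_half" "nome z = q" "Im z = - ln (norm q) / pi"
proof
  define z where "z = Ln q / (\<i> * of_real pi)"
  show e: "nome z = q" using assms by (auto simp: nome_def z_def)
  have "norm q = exp (- pi * Im z)" using norm_nome[of z] e by simp
  then show i: "Im z = - ln (norm q) / pi" by simp
  show "z \<in> upper_half" unfolding upper_half_def using i assms by (simp add: divide_neg_pos)
qed

lemma upper_half_inversion: "z \<in> upper_half \<Longrightarrow> - 1 / z \<in> upper_half"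
  unfolding upper_half_def mem_Collect_eq Im_inversion by (rule divide_pos_pos) auto

lemma upper_half_shift: "z \<in> upper_half \<Longrightarrow> z + 1 \<in> upper_half" "z \<in> upper_half \<Longrightarrow> z + 2 \<in> upper_half" "z \<in> upper_half \<Longrightarrow> z / 4 \<in> upper_half"
  by (auto simp: upper_half_def)

lemma identity_on_upper_half:
  assumes f: "f holomorphic_on upper_half" and g: "g holomorphic_on upper_half"
    and eq: "\<And>t. 0 < t \<Longrightarrow> f (\<i> * of_real t) = g (\<i> * of_real t)" and z: "z \<in> upper_half"
  shows "f z = g z"
proof -
  define U where "U = (\<lambda>t. \<i> * complex_of_real t) ` {0<..}"
  have lim: "\<i> islimpt U"
    unfolding islimpt_approachable
  proof (intro allI impI)
    fix e :: real assume e: "e > 0"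
    have "\<i> * complex_of_real (1 + e / 2) \<in> U" unfolding U_def using e by (intro imageI) auto
    moreover have "\<i> * complex_of_real (1 + e / 2) \<noteq> \<i>" using e by (simp add: complex_eq_iff)
    moreover have "dist (\<i> * complex_of_real (1 + e / 2)) \<i> < e"
    proof -
      have s: "\<i> * complex_of_real (1 + e / 2) - \<i> = \<i> * complex_of_real (e / 2)" by (simp add: algebra_simps)
      show ?thesis unfolding dist_norm s norm_mult using e by simp
    qed
    ultimately show "\<exists>x'\<in>U. x' \<noteq> \<i> \<and> dist x' \<i> < e" by blast
  qed
  have "(\<lambda>z. f z - g z) z = 0"
  proof (rule analytic_continuation[of "\<lambda>z. f z - g z" upper_half U \<i>])
    show "(\<lambda>z. f z - g z) holomorphic_on upper_half" by (intro holomorphic_intros f g)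
    show "U \<subseteq> upper_half" "\<i> \<in> upper_half" by (auto simp: U_def upper_half_def)
    show "f w - g w = 0" if "w \<in> U" for w using that eq by (auto simp: U_def)
  qed (use open_upper_half convex_upper_half convex_connected z lim in blast)+
  then show ?thesis by simp
qed

lemma nome_holomorphic [holomorphic_intros]: "f holomorphic_on S \<Longrightarrow> (\<lambda>z. nome (f z)) holomorphic_on S"
  unfolding nome_def by (intro holomorphic_intros)

lemma holomorphic_on_disc_compose:
  assumes "f holomorphic_on ball 0 1" "g holomorphic_on S" "\<And>z. z \<in> S \<Longrightarrow> norm (g z) < 1"
  shows "(\<lambda>z. f (g z)) holomorphic_on S"
  using holomorphic_on_compose_gen[OF assms(2,1)] assms(3) by (auto simp: o_def image_subset_iff)

lemma inv_factor_holomorphic: "inv_factor holomorphic_on upper_half"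
  unfolding inv_factor_def by (intro holomorphic_intros) (auto simp: upper_half_def complex_nonpos_Reals_iff)

lemma inv_factor_imaginary: "0 < t \<Longrightarrow> inv_factor (\<i> * of_real t) = of_real (sqrt t)"
proof -
  assume t: "0 < t"
  have "- (\<i> * (\<i> * of_real t)) = complex_of_real t" by (simp add: complex_eq_iff)
  then show ?thesis using t by (simp add: inv_factor_def)
qed

lemma norm_inv_factor_8: "norm (inv_factor z) ^ 8 = norm z ^ 4"
proof -
  have "norm (inv_factor z) ^ 8 = norm (inv_factor z ^ 2) ^ 4" by (simp add: norm_power flip: power_mult)
  then show ?thesis by (simp add: inv_factor_def norm_mult)
qed

lemma inv_factor_nonzero: "z \<in> upper_half \<Longrightarrow> inv_factor z \<noteq> 0" by (auto simp: inv_factor_def upper_half_def)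

lemma inversion_imaginary: "0 < t \<Longrightarrow> - 1 / (\<i> * complex_of_real t) = \<i> * of_real (1 / t)"
  by (simp add: field_simps)

lemma inversion_holomorphic: "(\<lambda>z. - 1 / z) holomorphic_on upper_half"
  by (intro holomorphic_intros) (auto simp: upper_half_def)

text \<open>
  Poisson summation gives the transformation law on the imaginary axis; both sides are holomorphic
  in the half-plane. The sign c covers the series with alternating signs.
\<close>

lemma inversion_extends:
  assumes f: "f holomorphic_on ball 0 1" and g: "g holomorphic_on upper_half"
    and c: "c = 1 \<or> c = - 1"
    and eq: "\<And>t. 0 < t \<Longrightarrow> f (c * of_real (exp (- pi / t))) = of_real (sqrt t ^ n) * g (\<i> * of_real t)"
    and z: "z \<in> upper_half"
  shows "f (c * nome (- 1 / z)) = inv_factor z ^ n * g z"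
proof (rule identity_on_upper_half[OF _ _ _ z])
  have nc: "norm c = 1" using c by auto
  show "(\<lambda>z. f (c * nome (- 1 / z))) holomorphic_on upper_half"
    by (rule holomorphic_on_disc_compose[OF f])
       (auto intro!: holomorphic_intros inversion_holomorphic norm_nome_less_1 upper_half_inversion simp: norm_mult nc simp del: divide_minus_left)
  show "(\<lambda>z. inv_factor z ^ n * g z) holomorphic_on upper_half"
    by (intro holomorphic_intros inv_factor_holomorphic g)
  fix t :: real assume t: "0 < t"
  have "nome (- 1 / (\<i> * of_real t)) = of_real (exp (- pi / t))"
    unfolding inversion_imaginary[OF t] nome_imaginary by simp
  then show "f (c * nome (- 1 / (\<i> * of_real t))) = inv_factor (\<i> * of_real t) ^ n * g (\<i> * of_real t)"
    using eq[OF t] by (simp add: inv_factor_imaginary[OF t])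
qed

definition theta3 :: "complex \<Rightarrow> complex" where "theta3 z = theta_sq (nome z)"
definition theta4 :: "complex \<Rightarrow> complex" where "theta4 z = theta_sq (- nome z)"
definition theta2 :: "complex \<Rightarrow> complex" where "theta2 z = nome (z / 4) * theta_pronic (nome z)"

lemma theta_sq_holomorphic: "theta_sq holomorphic_on ball 0 1"
  unfolding theta_sq_def by (rule wt_series_holomorphic[OF wt_summable_squares])

lemma theta_pronic_holomorphic: "theta_pronic holomorphic_on ball 0 1"
  unfolding theta_pronic_def by (rule wt_series_holomorphic[OF wt_summable_pronic])

text \<open>
  The third law is the second one read backwards at -1/z.
\<close>

lemma theta_inversion:
  assumes z: "z \<in> upper_half"
  shows "theta3 (- 1 / z) = inv_factor z * theta3 z" "theta4 (- 1 / z) = inv_factor z * theta2 z" "theta2 (- 1 / z) = inv_factor z * theta4 z"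
proof -
  have hol: "(\<lambda>z. theta_sq (nome z)) holomorphic_on upper_half" "(\<lambda>z. nome (z / 4) * theta_pronic (nome z)) holomorphic_on upper_half"
    by (auto intro!: holomorphic_intros holomorphic_on_disc_compose[OF theta_sq_holomorphic] holomorphic_on_disc_compose[OF theta_pronic_holomorphic] norm_nome_less_1)
  show "theta3 (- 1 / z) = inv_factor z * theta3 z"
    using inversion_extends[OF theta_sq_holomorphic hol(1), of 1 1 z] theta_inversion_real(1) z
    by (simp add: theta3_def nome_imaginary)
  have T4i: "theta4 (- 1 / z) = inv_factor z * theta2 z" if "z \<in> upper_half" for z
  proof -
    have "theta_sq (- 1 * nome (- 1 / z)) = inv_factor z ^ 1 * (nome (z / 4) * theta_pronic (nome z))"
    proof (rule inversion_extends[OF theta_sq_holomorphic hol(2) _ _ that])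
      fix t :: real assume t: "0 < t"
      have "nome (\<i> * of_real t / 4) = of_real (exp (- pi * t / 4))"
        using nome_imaginary[of "t / 4"] by simp
      then show "theta_sq (- 1 * of_real (exp (- pi / t))) = of_real (sqrt t ^ 1) * (nome (\<i> * of_real t / 4) * theta_pronic (nome (\<i> * of_real t)))"
        using theta_inversion_real(2)[OF t] by (simp add: nome_imaginary)
    qed simp
    then show ?thesis by (simp add: theta4_def theta2_def)
  qed
  then show "theta4 (- 1 / z) = inv_factor z * theta2 z" using z by blast
  have inv: "- 1 / (- 1 / z) = z" by simp
  have "inv_factor z * inv_factor (- 1 / z) = 1"
  proof (rule identity_on_upper_half[OF _ _ _ z])
    show "(\<lambda>z. inv_factor z * inv_factor (- 1 / z)) holomorphic_on upper_half"
      using holomorphic_on_compose_gen[OF inversion_holomorphic inv_factor_holomorphic] upper_half_inversion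
      by (intro holomorphic_intros inv_factor_holomorphic) (auto simp: o_def image_subset_iff)
    show "inv_factor (\<i> * of_real t) * inv_factor (- 1 / (\<i> * of_real t)) = 1" if "0 < t" for t
    proof -
      have "sqrt t * sqrt (1 / t) = 1" using that by (simp add: real_sqrt_divide)
      then show ?thesis unfolding inversion_imaginary[OF that] using that
        by (simp add: inv_factor_imaginary del: of_real_divide flip: of_real_mult)
    qed
  qed (intro holomorphic_intros)
  moreover have "theta4 z = inv_factor (- 1 / z) * theta2 (- 1 / z)" using T4i[OF upper_half_inversion[OF z]] unfolding inv .
  ultimately show "theta2 (- 1 / z) = inv_factor z * theta4 z" by (simp only: mult.assoc[symmetric] mult_1_left)
qed

lemma theta_shift: "theta3 (z + 1) = theta4 z" "theta4 (z + 1) = theta3 z"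
  by (simp_all add: theta3_def theta4_def nome_add nome_1)

lemma theta_pronic_even: "theta_pronic (- q) = theta_pronic q"
proof -
  have "even (nat (k\<^sup>2 + k))" for k :: int by (simp add: even_nat_iff[OF pronic_nonneg])
  then show ?thesis unfolding theta_pronic_def wt_series_def by (intro infsum_cong) simp
qed

lemma theta2_shift: "theta2 (z + 1) = nome (1 / 4) * theta2 z"
  by (simp add: theta2_def add_divide_distrib nome_add nome_1 theta_pronic_even mult_ac)

lemma theta4_nonzero: "z \<in> upper_half \<Longrightarrow> theta4 z \<noteq> 0"
  unfolding theta4_def by (intro theta_sq_nonzero) (simp add: norm_nome_less_1)

lemma theta2_nonzero: "z \<in> upper_half \<Longrightarrow> theta2 z \<noteq> 0"
  using theta_inversion(2)[of z] theta4_nonzero[OF upper_half_inversion[of z]] by auto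

lemma theta_pronic_0: "theta_pronic 0 = 2"
proof -
  have "((\<lambda>k::int. (0::complex) ^ nat (k\<^sup>2 + k)) has_sum (\<Sum>k\<in>{0,-1}. (0::complex) ^ nat (k\<^sup>2 + k))) UNIV"
  proof (rule has_sum_finite_neutralI)
    fix k :: int assume "k \<in> UNIV - {0, -1}"
    then have "k * (k + 1) > 0" by (cases "k > 0") (auto intro: mult_pos_pos mult_neg_neg)
    then show "(0::complex) ^ nat (k\<^sup>2 + k) = 0" by (simp add: power_0_left power2_eq_square algebra_simps)
  qed auto
  then show ?thesis unfolding theta_pronic_def wt_series_def by (simp add: infsumI)
qed

text \<open>
  Inversion carries theta_2 to theta_4, whose zeros are those of theta_sq.
\<close>

lemma theta_pronic_nonzero:
  assumes "norm q < 1"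
  shows "theta_pronic q \<noteq> 0"
proof (cases "q = 0")
  case False
  then obtain z where "z \<in> upper_half" "nome z = q" using nome_surj[of q] assms by auto
  then show ?thesis using theta2_nonzero[of z] by (auto simp: theta2_def)
qed (simp add: theta_pronic_0)

section \<open>The theta series of the lattice and norms of characteristic vectors modulo 8\<close>

lemma lattice_theta_inversion:
  fixes L :: "(real ^ 'n) set"
  assumes L: "integral_unimodular_lattice L" and z: "z \<in> upper_half"
  shows "wt_series L sqnorm (nome (- 1 / z)) = inv_factor z ^ CARD('n) * wt_series L sqnorm (nome z)"
    and "wt_series L sqnorm (- nome (- 1 / z)) = inv_factor z ^ CARD('n) * wt_series (characteristic_vectors L) sqnorm (nome (z / 4))"
proof -
  note hL = wt_series_holomorphic[OF wt_summable_lattice[OF L]]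
  note hC = wt_series_holomorphic[OF wt_summable_characteristic[OF L]]
  have "wt_series L sqnorm (1 * nome (- 1 / z)) = inv_factor z ^ CARD('n) * wt_series L sqnorm (nome z)"
  proof (rule inversion_extends[OF hL _ _ _ z])
    show "(\<lambda>z. wt_series L sqnorm (nome z)) holomorphic_on upper_half"
      by (auto intro!: holomorphic_intros holomorphic_on_disc_compose[OF hL] norm_nome_less_1)
    show "wt_series L sqnorm (1 * of_real (exp (- pi / t))) = of_real (sqrt t ^ CARD('n)) * wt_series L sqnorm (nome (\<i> * of_real t))" if "0 < t" for t
      using lattice_theta_inversion_real(1)[OF L that] by (simp add: nome_imaginary)
  qed simp
  then show "wt_series L sqnorm (nome (- 1 / z)) = inv_factor z ^ CARD('n) * wt_series L sqnorm (nome z)" by simp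
  have "wt_series L sqnorm (- 1 * nome (- 1 / z)) = inv_factor z ^ CARD('n) * wt_series (characteristic_vectors L) sqnorm (nome (z / 4))"
  proof (rule inversion_extends[OF hL _ _ _ z])
    show "(\<lambda>z. wt_series (characteristic_vectors L) sqnorm (nome (z / 4))) holomorphic_on upper_half"
      by (auto intro!: holomorphic_intros holomorphic_on_disc_compose[OF hC] norm_nome_less_1 upper_half_shift)
    fix t :: real assume t: "0 < t"
    have "nome (\<i> * of_real t / 4) = of_real (exp (- pi * t / 4))"
      using nome_imaginary[of "t / 4"] by simp
    then show "wt_series L sqnorm (- 1 * of_real (exp (- pi / t))) =
       of_real (sqrt t ^ CARD('n)) * wt_series (characteristic_vectors L) sqnorm (nome (\<i> * of_real t / 4))"
      using lattice_theta_inversion_real(2)[OF L t] by simp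
  qed simp
  then show "wt_series L sqnorm (- nome (- 1 / z)) = inv_factor z ^ CARD('n) * wt_series (characteristic_vectors L) sqnorm (nome (z / 4))" by simp
qed

text \<open>
  The quotient of A by theta_3^n is invariant under the theta group. With x = 1 - 1/z one has
  1 - 1/(z + 1) = -1/(x - 2), so at the cusp 1 invariance means periodicity under z -> z + 1 of the
  quotient of the characteristic-vector series by theta_2^n. There theta_2 acquires the
  factor nome (1/4), an eighth root of unity, and comparing coefficients shows that only the
  exponents congruent to n modulo 8 occur.
\<close>

lemma characteristic_norm_mod_8:
  fixes L :: "(real ^ 'n) set"
  assumes L: "integral_unimodular_lattice L" and w: "w \<in> characteristic_vectors L"
  shows "\<exists>k::int. int (sqnorm w) = int CARD('n) + 8 * k"
proof -
  define n where "n = CARD('n)"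
  define A where "A = wt_series L sqnorm"
  define C where "C = wt_series (characteristic_vectors L) sqnorm"
  define h where "h z = A (nome z) / theta3 z ^ n" for z
  have h2: "h (z + 2) = h z" for z
    using nome_int[of 1] by (simp add: h_def theta3_def nome_add)
  have hS: "h (- 1 / z) = h z" if z: "z \<in> upper_half" for z
    using lattice_theta_inversion(1)[OF L z] theta_inversion(1)[OF z] inv_factor_nonzero[OF z]
    by (simp add: h_def A_def n_def power_mult_distrib)
  have hc: "h (1 - 1 / z) = C (nome (z / 4)) / theta2 z ^ n" if z: "z \<in> upper_half" for z
  proof -
    have e: "1 - 1 / z = - 1 / z + 1" by simp
    show ?thesis unfolding e h_def theta_shift(1) nome_add nome_1
      using lattice_theta_inversion(2)[OF L z] theta_inversion(2)[OF z] inv_factor_nonzero[OF z]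
      by (simp add: A_def C_def n_def power_mult_distrib)
  qed
  define \<zeta> where "\<zeta> = nome (1 / 4)"
  have TC: "C (\<zeta> * nome (z / 4)) = \<zeta> ^ n * C (nome (z / 4))" if z: "z \<in> upper_half" for z
  proof -
    define x where "x = 1 - 1 / z"
    have "0 \<notin> upper_half" by (simp add: upper_half_def)
    then have zn: "z \<noteq> 0" "z + 1 \<noteq> 0" using z upper_half_shift(1)[OF z] by metis+
    have xU: "x \<in> upper_half" using upper_half_inversion[OF z] by (simp add: x_def upper_half_def)
    (* The points 1 - 1/z and 1 - 1/(z + 1) are equivalent under the theta group. *)
    have "h (1 - 1 / (z + 1)) = h (- 1 / (x + - 2))"
    proof -
      have "x + -2 = - (z + 1) / z" using zn by (simp add: x_def field_simps)
      then have "- 1 / (x + - 2) = z / (z + 1)" using zn by (simp add: minus_divide_right)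
      also have "\<dots> = 1 - 1 / (z + 1)" using zn by (simp add: field_simps)
      finally show ?thesis by simp
    qed
    also have "\<dots> = h (x + - 2)" by (rule hS) (use xU in \<open>simp add: upper_half_def\<close>)
    also have "\<dots> = h x" using h2[of "x + - 2"] by simp
    finally have "C (nome ((z + 1) / 4)) / theta2 (z + 1) ^ n = C (nome (z / 4)) / theta2 z ^ n"
      unfolding x_def hc[OF z] hc[OF upper_half_shift(1)[OF z]] .
    moreover have "nome ((z + 1) / 4) = \<zeta> * nome (z / 4)" by (simp add: \<zeta>_def add_divide_distrib nome_add)
    ultimately show ?thesis
      unfolding theta2_shift using theta2_nonzero[OF z] nome_nonzero[of "1/4"]
      by (simp add: \<zeta>_def power_mult_distrib field_simps)
  qed
  define b where "b m = complex_of_nat (card {v \<in> characteristic_vectors L. sqnorm v = m})" for m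
  note gC = wt_summable_characteristic[OF L]
  have n\<zeta>: "norm \<zeta> = 1" by (simp add: \<zeta>_def norm_nome)
  define f where "f X = C (\<zeta> * X) - \<zeta> ^ n * C X" for X
  have sf: "(\<lambda>m. (b m * (\<zeta> ^ m - \<zeta> ^ n)) * X ^ m) sums f X" if "norm X < 1" for X
  proof -
    have 1: "(\<lambda>m. b m * (\<zeta> * X) ^ m) sums C (\<zeta> * X)"
      unfolding b_def C_def by (rule wt_series_sums[OF gC]) (use that n\<zeta> in \<open>simp add: norm_mult\<close>)
    have 2: "(\<lambda>m. \<zeta> ^ n * (b m * X ^ m)) sums (\<zeta> ^ n * C X)"
      unfolding b_def C_def by (intro sums_mult wt_series_sums[OF gC] that)
    show ?thesis using sums_diff[OF 1 2] unfolding f_def by (simp add: algebra_simps power_mult_distrib)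
  qed
  have f0: "f X = 0" if X: "X \<noteq> 0" "norm X < 1" for X
  proof -
    obtain y where y: "y \<in> upper_half" "nome y = X" using nome_surj[of X] X by auto
    have "4 * y \<in> upper_half" using y(1) by (simp add: upper_half_def)
    from TC[OF this] show ?thesis using y(2) by (simp add: f_def)
  qed
  define m where "m = sqnorm w"
  define c where "c m = b m * (\<zeta> ^ m - \<zeta> ^ n)" for m
  define p where "p = (\<Sum>i<Suc m. monom (c i) i)"
  have rem: "(\<lambda>q. f q - (\<Sum>i<Suc m. c i * q ^ i)) \<in> O[at 0](\<lambda>q. q ^ Suc m)"
    by (rule power_series_remainder_bigo) (use sf in \<open>simp add: c_def\<close>)
  have "eventually (\<lambda>q. f q = 0) (at 0)"
    unfolding eventually_at by (rule exI[of _ 1]) (auto intro: f0)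
  then have ev: "eventually (\<lambda>q. f q - (\<Sum>i<Suc m. c i * q ^ i) = 0 - poly p q) (at 0)"
    by eventually_elim (simp add: p_def poly_sum poly_monom)
  have "(\<lambda>q. 0 - poly p q) \<in> O[at 0](\<lambda>q. q ^ Suc m)"
    using landau_o.big.in_cong[OF ev] rem by blast
  then have "jet (at 0) (\<lambda>q. q) (Suc m) (\<lambda>_. 0) p" by (simp add: jet_def)
  then have "coeff p m = 0"
    by (intro jet_unique_zero[of "\<lambda>q. q" "at 0" "Suc m" p m]) (auto simp: filterlim_ident)
  then have "c m = 0" by (simp add: p_def coeff_sum)
  moreover have "b m \<noteq> 0"
    using wt_summable_finite[OF gC, of m] w by (auto simp: b_def m_def card_eq_0_iff)
  ultimately have "\<zeta> ^ m = \<zeta> ^ n" by (simp add: c_def)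
  then have "nome (of_nat m / 4) = nome (of_nat n / 4)" by (simp add: \<zeta>_def nome_power)
  then have "nome (of_nat m / 4 + - (of_nat n / 4)) = nome (of_nat n / 4 + - (of_nat n / 4))"
    unfolding nome_add by simp
  then have "nome (of_nat m / 4 - of_nat n / 4) = 1" by (simp add: nome_def)
  then obtain k :: int where "complex_of_nat m / 4 - of_nat n / 4 = 2 * of_int k" unfolding nome_eq_1_iff by blast
  then have "complex_of_int (int m) = of_int (int n + 8 * k)" by (simp add: field_simps)
  then have "int m = int n + 8 * k" by (simp only: of_int_eq_iff)
  then show ?thesis unfolding m_def n_def by blast
qed

section \<open>Expansions at the two cusps\<close>

lemma jet_compose:
  assumes "jet F u N f p" "filterlim g F F'"
  shows "jet F' (\<lambda>x. u (g x)) N (\<lambda>x. f (g x)) p"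
  using assms unfolding jet_def by (rule landau_o.big.compose)

lemma small_int_square:
  fixes k :: int
  assumes "nat (k\<^sup>2) \<le> 3"
  shows "k \<in> {-1,0,1}"
proof -
  have "\<bar>k\<bar> \<le> 1"
  proof (rule ccontr)
    assume "\<not> \<bar>k\<bar> \<le> 1"
    then have "2 * 2 \<le> \<bar>k\<bar> * \<bar>k\<bar>" by (intro mult_mono) auto
    then have "4 \<le> k\<^sup>2" by (simp add: power2_eq_square)
    then show False using assms by linarith
  qed
  then show ?thesis by auto
qed

lemma small_int_pronic:
  fixes k :: int
  assumes "nat (k\<^sup>2 + k) \<le> 3"
  shows "k \<in> {-2,-1,0,1}"
proof (rule ccontr)
  assume "k \<notin> {-2,-1,0,1}"
  then consider "k \<ge> 2" | "- k \<ge> 3" by force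
  then have "6 \<le> k\<^sup>2 + k"
  proof cases
    case 1
    then have "2 * 3 \<le> k * (k + 1)" by (intro mult_mono) auto
    then show ?thesis by (simp add: power2_eq_square algebra_simps)
  next
    case 2
    then have "3 * 2 \<le> (- k) * (- k - 1)" by (intro mult_mono) auto
    then show ?thesis by (simp add: power2_eq_square algebra_simps)
  qed
  then show False using assms by linarith
qed

lemma jet_theta_sq: "jet (at 0) (\<lambda>q. q) 4 theta_sq [:1, 2:]"
proof -
  have key: "{k::int. nat (k\<^sup>2) = m} = {k \<in> {-1,0,1}. nat (k\<^sup>2) = m}" if "m \<le> 3" for m
    using small_int_square that by auto
  have c: "{k::int. nat (k\<^sup>2) = 0} = {0}" "{k::int. nat (k\<^sup>2) = 1} = {1,-1}"
    "{k::int. nat (k\<^sup>2) = 2} = {}" "{k::int. nat (k\<^sup>2) = 3} = {}"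
    by (subst key, simp, force)+
  have s4: "{..<4::nat} = {0,1,2,3}" by auto
  have "(\<lambda>q. theta_sq q - (\<Sum>m<4. of_nat (card {k \<in> UNIV::int set. nat (k\<^sup>2) = m}) * q ^ m)) \<in> O[at 0](\<lambda>q. q ^ 4)"
    unfolding theta_sq_def by (rule wt_series_remainder[OF wt_summable_squares])
  moreover have "(\<Sum>m<4. of_nat (card {k \<in> UNIV::int set. nat (k\<^sup>2) = m}) * q ^ m) = poly [:1, 2:] q" for q :: complex
    unfolding s4 by (simp add: c del: One_nat_def)
  ultimately show ?thesis by (simp add: jet_def)
qed

lemma jet_theta_pronic: "jet (at 0) (\<lambda>q. q) 4 theta_pronic [:2, 0, 2:]"
proof -
  have key: "{k::int. nat (k\<^sup>2 + k) = m} = {k \<in> {-2,-1,0,1}. nat (k\<^sup>2 + k) = m}" if "m \<le> 3" for m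
    using small_int_pronic that by auto
  have c: "{k::int. nat (k\<^sup>2 + k) = 0} = {0,-1}" "{k::int. nat (k\<^sup>2 + k) = 1} = {}"
    "{k::int. nat (k\<^sup>2 + k) = 2} = {1,-2}" "{k::int. nat (k\<^sup>2 + k) = 3} = {}"
    by (subst key, simp, force)+
  have s4: "{..<4::nat} = {0,1,2,3}" by auto
  have "(\<lambda>q. theta_pronic q - (\<Sum>m<4. of_nat (card {k \<in> UNIV::int set. nat (k\<^sup>2 + k) = m}) * q ^ m)) \<in> O[at 0](\<lambda>q. q ^ 4)"
    unfolding theta_pronic_def by (rule wt_series_remainder[OF wt_summable_pronic])
  moreover have "(\<Sum>m<4. of_nat (card {k \<in> UNIV::int set. nat (k\<^sup>2 + k) = m}) * q ^ m) = poly [:2, 0, 2:] q" for q :: complex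
    unfolding s4 by (simp add: c c(1)[simplified] del: One_nat_def) (simp add: power2_eq_square)
  ultimately show ?thesis by (simp add: jet_def)
qed

lemma jet_theta_sq_minus: "jet (at 0) (\<lambda>q. q) 4 (\<lambda>q. theta_sq (- q)) [:1, -2:]"
proof -
  have "filterlim (\<lambda>q::complex. - q) (at 0) (at 0)"
    by (auto simp: filterlim_at eventually_at intro!: tendsto_eq_intros exI[of _ 1])
  from jet_compose[OF jet_theta_sq this] show ?thesis by (simp add: jet_def)
qed

lemma filterlim_power_at_0: "0 < k \<Longrightarrow> filterlim (\<lambda>x::complex. x ^ k) (at 0) (at 0)"
  by (auto simp: filterlim_at eventually_at intro!: tendsto_eq_intros exI[of _ 1])

lemma jet_theta_sq_product: "jet (at 0) (\<lambda>X. X ^ 8) 2 (\<lambda>X. theta_sq (X ^ 4) * theta_sq (- (X ^ 4))) [:1, -4:]"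
proof -
  have f: "filterlim (\<lambda>X::complex. X ^ 4) (at 0) (at 0)" by (rule filterlim_power_at_0) simp
  have t: "((\<lambda>X::complex. X ^ 4) \<longlongrightarrow> 0) (at 0)" by (auto intro!: tendsto_eq_intros)
  have "jet (at 0) (\<lambda>X. X ^ 4) 4 (\<lambda>X. theta_sq (X ^ 4) * theta_sq (- (X ^ 4))) ([:1,2:] * [:1,-2:])"
    by (rule jet_mult[OF t jet_compose[OF jet_theta_sq f] jet_compose[OF jet_theta_sq_minus f]])
  then show ?thesis by (simp add: jet_def power_mult[symmetric] algebra_simps power_add[symmetric])
qed

lemma jet_theta_pronic_cusp: "jet (at 0) (\<lambda>X. X ^ 8) 2 (\<lambda>X. theta_pronic (X ^ 4)) [:2, 2:]"
proof -
  have f: "filterlim (\<lambda>X::complex. X ^ 4) (at 0) (at 0)" by (rule filterlim_power_at_0) simp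
  show ?thesis using jet_compose[OF jet_theta_pronic f]
    by (simp add: jet_def power_mult[symmetric] algebra_simps power_add[symmetric])
qed

text \<open>
  Near the puncture the expansion bounds K, and the remaining annulus is compact.
\<close>

lemma bounded_near_puncture:
  fixes K :: "complex \<Rightarrow> complex"
  assumes cont: "continuous_on (ball 0 1 - {0}) K" and big: "K \<in> O[at 0](\<lambda>_. 1)" and r: "r < 1"
  obtains C where "C > 0" "\<And>X. X \<noteq> 0 \<Longrightarrow> norm X \<le> r \<Longrightarrow> norm (K X) \<le> C"
proof -
  from big obtain c where c: "c > 0" "eventually (\<lambda>X. norm (K X) \<le> c * norm (1::complex)) (at 0)" by (rule landau_o.bigE)
  then obtain d where d: "d > 0" "\<And>X. X \<noteq> 0 \<Longrightarrow> norm X < d \<Longrightarrow> norm (K X) \<le> c"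
    unfolding eventually_at by (auto simp: dist_norm)
  have "compact (cball 0 r - ball (0::complex) d)" by (intro compact_diff) auto
  moreover have "continuous_on (cball 0 r - ball 0 d) K"
    by (rule continuous_on_subset[OF cont]) (use r d in auto)
  ultimately have "bounded (K ` (cball 0 r - ball 0 d))" by (intro compact_imp_bounded compact_continuous_image)
  then obtain c' where c'0: "c' > 0" "\<forall>x\<in>K ` (cball 0 r - ball 0 d). norm x \<le> c'"
    unfolding bounded_pos by blast
  have c': "norm (K X) \<le> c'" if "norm X \<le> r" "norm X \<ge> d" for X using c'0(2) that by simp
  show ?thesis
  proof (rule that[of "max c c'"])
    show "norm (K X) \<le> max c c'" if "X \<noteq> 0" "norm X \<le> r" for X
      using d(2)[of X] c'[of X] that by (cases "norm X < d") auto
  qed (use c in auto)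
qed

text \<open>
  The maximum principle on the disc of radius r bounds k q by C (ln r)^2, which tends to 0 as r
  tends to 1.
\<close>

lemma vanish_of_log_bound:
  fixes k :: "complex \<Rightarrow> complex"
  assumes hol: "k holomorphic_on ball 0 1"
    and bd: "\<And>q. q \<noteq> 0 \<Longrightarrow> norm q < 1 \<Longrightarrow> norm (k q) \<le> C * (ln (norm q))\<^sup>2" and q: "norm q < 1"
  shows "k q = 0"
proof -
  have le: "norm (k q) \<le> C * (ln r)\<^sup>2" if r: "norm q < r" "r < 1" for r
  proof (rule maximum_modulus_frontier[of k "ball 0 r"])
    have r0: "0 < r" using r norm_ge_zero[of q] by linarith
    show "k holomorphic_on interior (ball 0 r)" by (rule holomorphic_on_subset[OF hol]) (use r in auto)
    show "continuous_on (closure (ball 0 r)) k"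
      by (rule continuous_on_subset[OF holomorphic_on_imp_continuous_on[OF hol]]) (use r r0 in auto)
    show "norm (k z) \<le> C * (ln r)\<^sup>2" if "z \<in> frontier (ball 0 r)" for z
      using bd[of z] that r r0 by (auto simp: frontier_ball)
  qed (use r in auto)
  have "((\<lambda>r. C * (ln r)\<^sup>2) \<longlongrightarrow> C * (ln 1)\<^sup>2) (at_left 1)"
    by (intro tendsto_intros) auto
  moreover have "eventually (\<lambda>r. norm (k q) \<le> C * (ln r)\<^sup>2) (at_left 1)"
    using eventually_at_left_real[OF q] by eventually_elim (use le in auto)
  ultimately have "norm (k q) \<le> C * (ln 1)\<^sup>2"
    by (intro tendsto_lowerbound[of "\<lambda>r. C * (ln r)\<^sup>2" _ "at_left 1"]) auto
  then show ?thesis by simp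
qed

lemma Im_one_minus_inverse: "Im (1 - 1 / w) = Im w / (norm w)\<^sup>2"
  using Im_inversion[of w] by simp

lemma sum_single_shift:
  fixes b :: "nat \<Rightarrow> complex"
  assumes "0 < d"
  shows "(\<Sum>m<n. if m + d = n then b m * c else 0) = (if d \<le> n then b (n - d) else 0) * c"
proof (cases "d \<le> n")
  case True
  have "(\<Sum>m<n. if m + d = n then b m * c else 0) = (\<Sum>m<n. if m = n - d then b m * c else 0)"
    by (rule sum.cong) (use True in auto)
  then show ?thesis using True assms by simp
qed (auto intro!: sum.neutral)

text \<open>
  Among the exponents below n, only n - 16 and n - 8 occur, by the lower bound on the norms and
  the congruence modulo 8. The factor X^(16 - n), written with a division since n may be larger than
  16, moves them to the exponents 0 and 8.
\<close>

lemma jet_characteristic: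
  fixes L :: "(real ^ 'n) set"
  assumes L: "integral_unimodular_lattice L"
    and low: "\<And>w. w \<in> characteristic_vectors L \<Longrightarrow> CARD('n) \<le> sqnorm w + 16"
  shows "jet (at 0) (\<lambda>X. X ^ 8) 2 (\<lambda>X. X ^ 16 * wt_series (characteristic_vectors L) sqnorm X / X ^ CARD('n))
    [:of_nat (card {w \<in> characteristic_vectors L. sqnorm w + 16 = CARD('n)}),
      of_nat (card {w \<in> characteristic_vectors L. sqnorm w + 8 = CARD('n)}):]"
proof -
  define n where "n = CARD('n)"
  define Ch where "Ch = characteristic_vectors L"
  define b where "b m = complex_of_nat (card {w \<in> Ch. sqnorm w = m})" for m
  define A where "A = complex_of_nat (card {w \<in> Ch. sqnorm w + 16 = n})"
  define B where "B = complex_of_nat (card {w \<in> Ch. sqnorm w + 8 = n})"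
  have A: "A = (if 16 \<le> n then b (n - 16) else 0)"
  proof -
    have "{w \<in> Ch. sqnorm w + 16 = n} = (if 16 \<le> n then {w \<in> Ch. sqnorm w = n - 16} else {})" by auto
    then show ?thesis by (simp add: A_def b_def)
  qed
  have B: "B = (if 8 \<le> n then b (n - 8) else 0)"
  proof -
    have "{w \<in> Ch. sqnorm w + 8 = n} = (if 8 \<le> n then {w \<in> Ch. sqnorm w = n - 8} else {})" by auto
    then show ?thesis by (simp add: B_def b_def)
  qed
  have b0: "b m = 0" if m: "m < n" "m + 16 \<noteq> n" "m + 8 \<noteq> n" for m
  proof -
    have "sqnorm w \<noteq> m" if w: "w \<in> Ch" for w
    proof
      assume e: "sqnorm w = m"
      obtain k :: int where "int (sqnorm w) = int n + 8 * k"
        using characteristic_norm_mod_8[OF L] w unfolding Ch_def n_def by blast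
      moreover have "n \<le> sqnorm w + 16" using low w unfolding Ch_def n_def by blast
      ultimately show False using m e by presburger
    qed
    then have "{w \<in> Ch. sqnorm w = m} = {}" by blast
    then show ?thesis unfolding b_def by (simp only: card.empty of_nat_0)
  qed
  have sum: "X ^ 16 * (\<Sum>m<n. b m * X ^ m) = (A + B * X ^ 8) * X ^ n" for X
  proof -
    have "X ^ 16 * (\<Sum>m<n. b m * X ^ m) = (\<Sum>m<n. (if m + 16 = n then b m * X ^ n else 0) + (if m + 8 = n then b m * (X ^ 8 * X ^ n) else 0))"
      unfolding sum_distrib_left
    proof (rule sum.cong[OF refl])
      fix m assume "m \<in> {..<n}"
      then have m: "m < n" by simp
      consider "m + 16 = n" | "m + 8 = n" | "m + 16 \<noteq> n" "m + 8 \<noteq> n" by blast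
      then show "X ^ 16 * (b m * X ^ m) = (if m + 16 = n then b m * X ^ n else 0) + (if m + 8 = n then b m * (X ^ 8 * X ^ n) else 0)"
      proof cases
        case 1
        then show ?thesis by (simp add: power_add[symmetric] mult.left_commute[of "X ^ 16"]) (simp add: add.commute)
      next
        case 2
        have "16 + m = 8 + n" using 2 by simp
        then have "X ^ 16 * X ^ m = X ^ 8 * X ^ n" by (simp only: power_add[symmetric])
        then show ?thesis using 2 by (simp add: mult.left_commute[of "X ^ 16"])
      next
        case 3
        then show ?thesis using b0[OF m] by simp
      qed
    qed
    also have "\<dots> = A * X ^ n + B * (X ^ 8 * X ^ n)"
      unfolding sum.distrib A B by (simp only: sum_single_shift zero_less_numeral)
    finally show ?thesis by (simp add: algebra_simps)
  qed
  define c where "c = wt_series Ch sqnorm"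
  have rem: "(\<lambda>X. c X - (\<Sum>m<n. b m * X ^ m)) \<in> O[at 0](\<lambda>X. X ^ n)"
    unfolding c_def b_def Ch_def by (rule wt_series_remainder[OF wt_summable_characteristic[OF L]])
  have prd: "(\<lambda>X. X ^ 16 / X ^ n * (c X - (\<Sum>m<n. b m * X ^ m))) \<in> O[at 0](\<lambda>X. X ^ 16 / X ^ n * X ^ n)"
    by (rule landau_o.big.mult[OF landau_o.big_refl rem])
  have ev1: "eventually (\<lambda>X. X ^ 16 / X ^ n * (c X - (\<Sum>m<n. b m * X ^ m)) = X ^ 16 * c X / X ^ n - poly [:A, B:] (X ^ 8)) (at 0)"
    unfolding eventually_at
  proof (intro exI[of _ 1] conjI ballI impI)
    fix X :: complex assume "X \<noteq> 0 \<and> dist X 0 < 1"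
    then have X: "X \<noteq> 0" by simp
    have "X ^ 16 / X ^ n * (c X - (\<Sum>m<n. b m * X ^ m)) = (X ^ 16 * c X - X ^ 16 * (\<Sum>m<n. b m * X ^ m)) / X ^ n"
      by (simp add: right_diff_distrib diff_divide_distrib)
    also have "\<dots> = X ^ 16 * c X / X ^ n - poly [:A, B:] (X ^ 8)"
      unfolding sum using X by (simp add: field_simps)
    finally show "X ^ 16 / X ^ n * (c X - (\<Sum>m<n. b m * X ^ m)) = X ^ 16 * c X / X ^ n - poly [:A, B:] (X ^ 8)" .
  qed simp
  have ev2: "eventually (\<lambda>X::complex. X ^ 16 / X ^ n * X ^ n = (X ^ 8) ^ 2) (at 0)"
    unfolding eventually_at by (intro exI[of _ 1]) (auto simp flip: power_mult)
  have "(\<lambda>X. X ^ 16 * c X / X ^ n - poly [:A, B:] (X ^ 8)) \<in> O[at 0](\<lambda>X. (X ^ 8) ^ 2)"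
    using landau_o.big.in_cong[OF ev1, THEN iffD1, OF prd] unfolding landau_o.big.cong[OF ev2] .
  then show ?thesis unfolding jet_def c_def A_def B_def Ch_def n_def .
qed

section \<open>The lattice theta series as a polynomial in a modular function\<close>

lemma lattice_theta_0:
  assumes L: "integral_unimodular_lattice L"
  shows "wt_series L sqnorm 0 = 1"
proof -
  have z: "0 \<in> L" using L lattice_closed(1) by (auto simp: integral_unimodular_lattice_def)
  have "((\<lambda>v. (0::complex) ^ sqnorm v) has_sum 1) L"
  proof (rule has_sum_finite_neutralI[of "{0}"])
    fix v assume v: "v \<in> L - {0}"
    then have "real (sqnorm v) > 0" using of_nat_sqnorm[OF L, of v] by simp
    then show "(0::complex) ^ sqnorm v = 0" by simp
  qed (use z in \<open>auto simp: sqnorm_def\<close>)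
  then show ?thesis by (simp add: wt_series_def infsumI)
qed

text \<open>
  The function (theta_2 theta_4)^4 / (16 theta_3^8), a generator of the field of modular functions for the
  theta group, written in terms of the nome.
\<close>

definition hauptmodul :: "complex \<Rightarrow> complex" where
  "hauptmodul q = q * (theta_pronic q * theta_sq (- q)) ^ 4 / (16 * theta_sq q ^ 8)"

lemma theta_sq_minus_holomorphic: "(\<lambda>q. theta_sq (- q)) holomorphic_on ball 0 1"
  by (rule holomorphic_on_disc_compose[OF theta_sq_holomorphic]) (auto intro!: holomorphic_intros)

lemma hauptmodul_holomorphic: "hauptmodul holomorphic_on ball 0 1"
  unfolding hauptmodul_def
  by (intro holomorphic_intros theta_sq_holomorphic theta_pronic_holomorphic theta_sq_minus_holomorphic) (auto simp: theta_sq_nonzero)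

lemma hauptmodul_nome: "hauptmodul (nome z) = (theta2 z * theta4 z) ^ 4 / (16 * theta3 z ^ 8)"
proof -
  have "nome (z / 4) ^ 4 = nome z" by (simp add: nome_power)
  then show ?thesis by (simp add: hauptmodul_def theta2_def theta3_def theta4_def power_mult_distrib)
qed

lemma hauptmodul_inversion:
  assumes z: "z \<in> upper_half"
  shows "hauptmodul (nome (- 1 / z)) = hauptmodul (nome z)"
proof -
  have e: "(inv_factor z * theta4 z * (inv_factor z * theta2 z)) ^ 4 = inv_factor z ^ 8 * (theta2 z * theta4 z) ^ 4"
    by (simp add: power_mult_distrib mult_ac flip: power_add)
  show ?thesis
    unfolding hauptmodul_nome theta_inversion[OF z] e using inv_factor_nonzero[OF z]
    by (simp add: power_mult_distrib[of "inv_factor z" "theta3 z"])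
qed

lemma theta_at_cusp:
  assumes z: "z \<in> upper_half"
  shows "theta3 (1 - 1 / z) = inv_factor z * theta2 z" "theta4 (1 - 1 / z) = inv_factor z * theta3 z"
    "theta2 (1 - 1 / z) = nome (1 / 4) * (inv_factor z * theta4 z)"
proof -
  have e: "1 - 1 / z = - 1 / z + 1" by simp
  show "theta3 (1 - 1 / z) = inv_factor z * theta2 z" "theta4 (1 - 1 / z) = inv_factor z * theta3 z"
    "theta2 (1 - 1 / z) = nome (1 / 4) * (inv_factor z * theta4 z)"
    unfolding e theta_shift theta2_shift theta_inversion[OF z] by simp_all
qed

lemma hauptmodul_cusp:
  assumes z: "z \<in> upper_half"
  shows "hauptmodul (nome (1 - 1 / z)) = - ((theta3 z * theta4 z) ^ 4 / (16 * theta2 z ^ 8))"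
proof -
  have e4: "nome (1 / 4) ^ 4 = - 1" by (simp add: nome_power nome_1)
  have "(nome (1 / 4) * (inv_factor z * theta4 z) * (inv_factor z * theta3 z)) ^ 4 = nome (1 / 4) ^ 4 * (inv_factor z ^ 8 * (theta3 z * theta4 z) ^ 4)"
    by (simp add: power_mult_distrib mult_ac flip: power_add)
  then show ?thesis
    unfolding hauptmodul_nome theta_at_cusp[OF z] e4 using inv_factor_nonzero[OF z] by (simp add: power_mult_distrib)
qed

lemma isCont_ball_0: "f holomorphic_on ball 0 1 \<Longrightarrow> isCont f 0"
  by (metis centre_in_ball continuous_on_eq_continuous_at holomorphic_on_imp_continuous_on open_ball zero_less_one)

text \<open>
  The form E = (theta_2 theta_4)^4 has weight 4, so |f| / (y^2 |E|) is invariant under the theta group.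
  It is bounded near infinity because f vanishes there to the same order as E, and near the
  cusp 1 because f is bounded and E does not vanish there. Hence it is bounded on the whole
  half-plane. Therefore f divided by the nonvanishing function (theta_pronic q * theta_sq (- q))^4 is bounded by
  a multiple of y^2, which tends to 0 at the boundary of the disc.
\<close>

lemma modular_function_zero:
  assumes f: "f holomorphic_on ball 0 1" "f 0 = 0"
    and inv: "\<And>z. z \<in> upper_half \<Longrightarrow> f (nome (- 1 / z)) = f (nome z)"
    and cusp: "\<And>w. Im w \<ge> 1 / 2 \<Longrightarrow> norm (f (nome (1 - 1 / w))) \<le> C"
    and q: "norm q < 1"
  shows "f q = 0"
proof -
  have nz: "theta_pronic q \<noteq> 0" "theta_sq q \<noteq> 0" "theta_sq (- q) \<noteq> 0" if "norm q < 1" for q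
    using that by (auto simp: theta_pronic_nonzero theta_sq_nonzero)
  define G where "G z = norm (f (nome z)) / ((Im z)\<^sup>2 * norm (theta2 z * theta4 z) ^ 4)" for z
  define K1 where "K1 q = f q / q / (theta_pronic q * theta_sq (- q)) ^ 4" for q
  have contK1: "continuous_on (ball 0 1 - {0}) K1"
    unfolding K1_def
    by (intro continuous_intros continuous_on_subset[OF holomorphic_on_imp_continuous_on[OF f(1)]]
          continuous_on_subset[OF holomorphic_on_imp_continuous_on[OF theta_pronic_holomorphic]]
          continuous_on_subset[OF holomorphic_on_imp_continuous_on[OF theta_sq_minus_holomorphic]])
       (auto simp: nz)
  have bigK1: "K1 \<in> O[at 0](\<lambda>_. 1)"
  proof -
    have "(f has_field_derivative deriv f 0) (at 0)"
      by (rule holomorphic_derivI[OF f(1) open_ball]) simp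
    then have "((\<lambda>q. f q / q) \<longlongrightarrow> deriv f 0) (at 0)"
      using f(2) by (simp add: has_field_derivative_iff)
    moreover have "(theta_pronic \<longlongrightarrow> theta_pronic 0) (at 0)" using isCont_ball_0[OF theta_pronic_holomorphic] by (simp add: isCont_def)
    moreover have "((\<lambda>q. theta_sq (- q)) \<longlongrightarrow> theta_sq (- 0)) (at 0)" using isCont_ball_0[OF theta_sq_minus_holomorphic] by (simp add: isCont_def)
    ultimately have "(K1 \<longlongrightarrow> deriv f 0 / (theta_pronic 0 * theta_sq (- 0)) ^ 4) (at 0)"
      unfolding K1_def by (intro tendsto_intros) (auto simp: theta_pronic_0 theta_sq_0)
    then show ?thesis by (intro bigoI_tendsto[where c = "deriv f 0 / (theta_pronic 0 * theta_sq (- 0)) ^ 4"]) auto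
  qed
  obtain C1 where C1: "C1 > 0" "\<And>q. q \<noteq> 0 \<Longrightarrow> norm q \<le> exp (- pi) \<Longrightarrow> norm (K1 q) \<le> C1"
    using bounded_near_puncture[OF contK1 bigK1, of "exp (- pi)"] by auto
  define K2 where "K2 q = 1 / (theta_sq q * theta_sq (- q)) ^ 4" for q
  have holK2: "K2 holomorphic_on ball 0 1" unfolding K2_def
    by (intro holomorphic_intros theta_sq_holomorphic theta_sq_minus_holomorphic) (auto simp: nz)
  obtain C2 where C2: "C2 > 0" "\<And>q. q \<noteq> 0 \<Longrightarrow> norm q \<le> exp (- pi / 2) \<Longrightarrow> norm (K2 q) \<le> C2"
  proof (rule bounded_near_puncture)
    show "continuous_on (ball 0 1 - {0}) K2"
      by (rule continuous_on_subset[OF holomorphic_on_imp_continuous_on[OF holK2]]) auto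
    show "K2 \<in> O[at 0](\<lambda>_. 1)"
      using isCont_ball_0[OF holK2] by (intro bigoI_tendsto[where c = "K2 0"]) (auto simp: isCont_def)
  qed auto
  define C3 where "C3 = max C1 (4 * C * C2)"
  have GK: "G z = norm (K1 (nome z)) / (Im z)\<^sup>2" for z
  proof -
    have "norm (theta2 z * theta4 z) ^ 4 = norm (nome (z / 4) ^ 4 * (theta_pronic (nome z) * theta_sq (- nome z)) ^ 4)"
      by (simp add: theta2_def theta4_def norm_mult norm_power power_mult_distrib)
    also have "nome (z / 4) ^ 4 = nome z" by (simp add: nome_power)
    finally show ?thesis by (simp add: G_def K1_def norm_mult norm_divide mult_ac)
  qed
  have bound: "G z \<le> C3" if z: "Im z > 0" for z
  proof (rule theta_group_bound[OF _ _ _ _ z])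
    fix z :: complex assume z: "Im z > 0"
    have zU: "z \<in> upper_half" using z by (simp add: upper_half_def)
    have "nome (z + 2) = nome z" using nome_int[of 1] by (simp add: nome_add)
    then show "G (z + 2) = G z" unfolding GK by simp
    have "(Im (- 1 / z))\<^sup>2 * norm (theta2 (- 1 / z) * theta4 (- 1 / z)) ^ 4 = (Im z)\<^sup>2 * norm (theta2 z * theta4 z) ^ 4"
    proof -
      have "norm (inv_factor z * theta4 z * (inv_factor z * theta2 z)) ^ 4 = norm (inv_factor z) ^ 8 * norm (theta2 z * theta4 z) ^ 4"
        by (simp add: norm_mult power_mult_distrib mult_ac flip: power_add)
      moreover have "norm z > 0" using z by auto
      ultimately show ?thesis unfolding theta_inversion[OF zU] Im_inversion norm_inv_factor_8
        by (simp add: power_divide flip: power_mult)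
    qed
    then show "G (- 1 / z) = G z" unfolding G_def inv[OF zU] by simp
  next
    fix z :: complex assume z: "Im z \<ge> 1"
    have "norm (nome z) \<le> exp (- pi)" using z by (simp add: norm_nome)
    then have "norm (K1 (nome z)) \<le> C1" by (intro C1(2) nome_nonzero)
    moreover have "1 \<le> (Im z)\<^sup>2" using z by simp
    ultimately have "norm (K1 (nome z)) / (Im z)\<^sup>2 \<le> C1 / 1" using C1(1) by (intro frac_le) auto
    then show "G z \<le> C3" by (simp add: GK C3_def)
  next
    fix w :: complex assume w: "Im w \<ge> 1 / 2"
    then have wU: "w \<in> upper_half" by (simp add: upper_half_def)
    have nw: "norm w > 0" using w by auto
    have "norm (nome (1/4) * (inv_factor w * theta4 w) * (inv_factor w * theta3 w)) ^ 4 = norm (inv_factor w) ^ 8 * norm (theta3 w * theta4 w) ^ 4"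
      by (simp add: norm_mult norm_nome power_mult_distrib mult_ac flip: power_add)
    then have d: "(Im (1 - 1 / w))\<^sup>2 * norm (theta2 (1 - 1 / w) * theta4 (1 - 1 / w)) ^ 4 = (Im w)\<^sup>2 * norm (theta3 w * theta4 w) ^ 4"
      unfolding theta_at_cusp[OF wU] Im_one_minus_inverse norm_inv_factor_8 using nw by (simp add: power_divide flip: power_mult)
    have "norm (nome w) \<le> exp (- pi / 2)" using w by (simp add: norm_nome)
    then have "norm (K2 (nome w)) \<le> C2" by (intro C2(2) nome_nonzero)
    then have k2: "1 / norm (theta3 w * theta4 w) ^ 4 \<le> C2" by (simp add: K2_def theta3_def theta4_def norm_divide norm_power)
    have C0: "0 \<le> C" using cusp[OF w] norm_ge_zero order_trans by blast
    have i: "1 / (Im w)\<^sup>2 \<le> 4"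
    proof -
      have "(1/2)\<^sup>2 \<le> (Im w)\<^sup>2" using w by (intro power_mono) auto
      then show ?thesis using w by (simp add: field_simps power2_eq_square)
    qed
    have "G (1 - 1 / w) = norm (f (nome (1 - 1 / w))) * (1 / (Im w)\<^sup>2 * (1 / norm (theta3 w * theta4 w) ^ 4))"
      unfolding G_def d by simp
    also have "\<dots> \<le> C * (4 * C2)"
      using cusp[OF w] k2 i C0 C2(1) by (intro mult_mono) auto
    finally show "G (1 - 1 / w) \<le> C3" by (simp add: C3_def)
  qed
  define k where "k q = f q / (theta_pronic q * theta_sq (- q)) ^ 4" for q
  have "k q = 0"
  proof (rule vanish_of_log_bound[OF _ _ q])
    show "k holomorphic_on ball 0 1" unfolding k_def
      by (intro holomorphic_intros f(1) theta_pronic_holomorphic theta_sq_minus_holomorphic) (auto simp: nz)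
    fix q :: complex assume q: "q \<noteq> 0" "norm q < 1"
    then obtain z where z: "z \<in> upper_half" "nome z = q" "Im z = - ln (norm q) / pi" using nome_surj[of q] by auto
    have Iz: "Im z > 0" using z(1) by (simp add: upper_half_def)
    have "norm (K1 q) \<le> C3 * (Im z)\<^sup>2"
      using bound[OF Iz] Iz unfolding GK z(2) by (simp add: divide_le_eq)
    also have "\<dots> = C3 / pi\<^sup>2 * (ln (norm q))\<^sup>2" unfolding z(3) by (simp add: power_divide)
    finally have "norm (K1 q) \<le> C3 / pi\<^sup>2 * (ln (norm q))\<^sup>2" .
    moreover have "norm (k q) = norm q * norm (K1 q)"
      using q(1) by (simp add: k_def K1_def norm_divide norm_mult)
    moreover have "norm q * norm (K1 q) \<le> 1 * norm (K1 q)" using q(2) by (intro mult_right_mono) auto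
    ultimately show "norm (k q) \<le> C3 / pi\<^sup>2 * (ln (norm q))\<^sup>2" by linarith
  qed
  then show ?thesis using nz[OF q] by (simp add: k_def)
qed

lemma coeff_linear_power_0: "coeff ([:a, b:] ^ m) 0 = (a::complex) ^ m"
  by (simp add: coeff_linear_poly_power)

lemma coeff_linear_power_1: "coeff ([:1, b:] ^ m) (Suc 0) = of_nat m * (b::complex)"
  by (cases "m = 0") (simp_all add: coeff_linear_poly_power Suc_le_eq)

lemma linear_power_scale: "[:2, 2:] ^ m = smult (2 ^ m) ([:1, 1:] ^ m :: complex poly)"
proof -
  have "[:2, 2::complex:] = smult 2 [:1, 1:]" by simp
  then show ?thesis by (simp only: smult_power)
qed

text \<open>
  The constants are the ones that cancel the poles at the cusp 1. In the local parameter
  X = exp(pi i w / 4) there, with u = X^8, the lattice quotient is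
  2^(-n) (A u^(-2) + (B - n A) u^(-1) + ...), and the modular function is -2^(-12) (u^(-1) - 24 + ...).
\<close>

theorem lattice_theta_identity:
  fixes L :: "(real ^ 'n) set"
  assumes L: "integral_unimodular_lattice L"
    and low: "\<And>w. w \<in> characteristic_vectors L \<Longrightarrow> CARD('n) \<le> sqnorm w + 16"
  defines "A \<equiv> complex_of_nat (card {w \<in> characteristic_vectors L. sqnorm w + 16 = CARD('n)})"
    and "B \<equiv> complex_of_nat (card {w \<in> characteristic_vectors L. sqnorm w + 8 = CARD('n)})"
  defines "\<beta> \<equiv> - (2 ^ 12 * (B + (48 - of_nat CARD('n)) * A) / 2 ^ CARD('n))"
    and "\<gamma> \<equiv> 2 ^ 24 * A / 2 ^ CARD('n)"
  assumes q: "norm q < 1"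
  shows "wt_series L sqnorm q = theta_sq q ^ CARD('n) * (1 + \<beta> * hauptmodul q + \<gamma> * hauptmodul q ^ 2)"
proof -
  define n where "n = CARD('n)"
  note hL = wt_series_holomorphic[OF wt_summable_lattice[OF L]]
  note hC = wt_series_holomorphic[OF wt_summable_characteristic[OF L]]
  define c where "c = wt_series (characteristic_vectors L) sqnorm"
  define f where "f q = wt_series L sqnorm q / theta_sq q ^ n - 1 - \<beta> * hauptmodul q - \<gamma> * hauptmodul q ^ 2" for q
  have nz: "theta_pronic q \<noteq> 0" "theta_sq q \<noteq> 0" "theta_sq (- q) \<noteq> 0" if "norm q < 1" for q
    using that by (auto simp: theta_pronic_nonzero theta_sq_nonzero)
  define U where "U X = theta_sq (X ^ 4) * theta_sq (- (X ^ 4))" for X :: complex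
  define P where "P X = theta_pronic (X ^ 4)" for X :: complex
  define K where "K X = c X / (X * P X) ^ n - 1 + \<beta> * (U X ^ 4 / (16 * (X * P X) ^ 8)) - \<gamma> * (U X ^ 4 / (16 * (X * P X) ^ 8)) ^ 2" for X
  have fK: "f (nome (1 - 1 / w)) = K (nome (w / 4))" if w: "w \<in> upper_half" for w
  proof -
    have e: "nome (w / 4) ^ 4 = nome w" by (simp add: nome_power)
    have U: "U (nome (w / 4)) = theta3 w * theta4 w" by (simp add: U_def e theta3_def theta4_def)
    have P: "nome (w / 4) * P (nome (w / 4)) = theta2 w" by (simp add: P_def e theta2_def)
    have "wt_series L sqnorm (nome (1 - 1 / w)) = inv_factor w ^ n * c (nome (w / 4))"
      using lattice_theta_inversion(2)[OF L w] nome_add[of "- 1 / w" 1] by (simp add: nome_1 n_def c_def)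
    moreover have "theta_sq (nome (1 - 1 / w)) = inv_factor w * theta2 w" using theta_at_cusp(1)[OF w] by (simp add: theta3_def)
    ultimately have "wt_series L sqnorm (nome (1 - 1 / w)) / theta_sq (nome (1 - 1 / w)) ^ n = c (nome (w / 4)) / theta2 w ^ n"
      using inv_factor_nonzero[OF w] by (simp add: power_mult_distrib)
    then show ?thesis unfolding f_def K_def U P hauptmodul_cusp[OF w] by simp
  qed
  have n4: "norm (X ^ 4) < 1" if "norm X < 1" for X :: complex
    using that by (simp add: norm_power power_less_one_iff)
  have hP: "P holomorphic_on ball 0 1" unfolding P_def
    by (rule holomorphic_on_disc_compose[OF theta_pronic_holomorphic]) (auto intro!: holomorphic_intros n4)
  have hU: "U holomorphic_on ball 0 1" unfolding U_def
    by (intro holomorphic_intros holomorphic_on_disc_compose[OF theta_sq_holomorphic]) (auto intro!: holomorphic_intros n4)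
  have PX: "P X \<noteq> 0" if "norm X < 1" for X unfolding P_def using nz(1)[OF n4[OF that]] .
  have contK: "continuous_on (ball 0 1 - {0}) K"
    unfolding K_def c_def
    by (intro continuous_intros continuous_on_subset[OF holomorphic_on_imp_continuous_on[OF hC]]
          continuous_on_subset[OF holomorphic_on_imp_continuous_on[OF hP]]
          continuous_on_subset[OF holomorphic_on_imp_continuous_on[OF hU]])
       (auto simp: PX)
  have bigK: "K \<in> O[at 0](\<lambda>_. 1)"
  proof -
    define u where "u X = X ^ 8" for X :: complex
    define V where "V X = X ^ 16 * c X / X ^ n" for X
    (* W is K multiplied by X^16 P^(n + 16), which clears all denominators. *)
    define W where "W X = V X * P X ^ 16 - u X ^ 2 * P X ^ (n + 16) + \<beta> / 16 * (u X * U X ^ 4 * P X ^ (n + 8)) - \<gamma> / 256 * (U X ^ 8 * P X ^ n)" for X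
    have ut: "(u \<longlongrightarrow> 0) (at 0)" unfolding u_def by (auto intro!: tendsto_eq_intros)
    have jV: "jet (at 0) u 2 V [:A, B:]"
      using jet_characteristic[OF L low] unfolding u_def V_def c_def A_def B_def n_def .
    have jP: "jet (at 0) u 2 P [:2, 2:]" unfolding u_def P_def by (rule jet_theta_pronic_cusp)
    have jU: "jet (at 0) u 2 U [:1, -4:]" unfolding u_def U_def by (rule jet_theta_sq_product)
    have ju: "jet (at 0) u 2 u [:0, 1:]" using jet_poly[of "at 0" u 2 "[:0, 1:]"] by simp
    define p where "p = [:A, B:] * [:2, 2:] ^ 16 - [:0, 1:] ^ 2 * [:2, 2:] ^ (n + 16)
       + [:\<beta> / 16:] * ([:0, 1:] * [:1, -4:] ^ 4 * [:2, 2:] ^ (n + 8)) - [:\<gamma> / 256:] * ([:1, -4:] ^ 8 * [:2, 2:] ^ n)"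
    have jW: "jet (at 0) u 2 W p"
      unfolding W_def p_def
      by (intro jet_add jet_diff jet_mult[OF ut] jet_power[OF ut] jet_const jV jP jU ju)
    have "coeff p 0 = 0"
      by (simp add: p_def coeff_mult_0 linear_power_scale coeff_linear_power_0 \<gamma>_def n_def)
    moreover have "coeff p (Suc 0) = 0"
    proof -
      have "coeff p (Suc 0) = 2 ^ 16 * (B + 16 * A) + \<beta> / 16 * 2 ^ (n + 8) - \<gamma> / 256 * (2 ^ n * (of_nat n - 32))"
        by (simp add: p_def coeff_mult_0 coeff_mult linear_power_scale coeff_linear_power_0 coeff_linear_power_1 power2_eq_square algebra_simps)
           (simp add: field_simps)
      also have "\<dots> = 0"
        by (simp add: \<beta>_def \<gamma>_def n_def power_add field_simps)
      finally show ?thesis .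
    qed
    ultimately have "coeff p i = 0" if "i < 2" for i using that by (cases i) (auto simp: less_Suc_eq numeral_2_eq_2)
    then have bW: "W \<in> O[at 0](\<lambda>X. u X ^ 2)" by (rule jet_zero_bigo[OF ut jW])
    have "isCont P 0" by (rule isCont_ball_0[OF hP])
    then have tP: "(P \<longlongrightarrow> P 0) (at 0)" by (simp add: isCont_def)
    have bP: "(\<lambda>X. 1 / P X ^ (n + 16)) \<in> O[at 0](\<lambda>_. 1)"
    proof (rule bigoI_tendsto[where c = "1 / P 0 ^ (n + 16)"])
      show "((\<lambda>X. 1 / P X ^ (n + 16) / 1) \<longlongrightarrow> 1 / P 0 ^ (n + 16)) (at 0)"
        using PX[of 0] by (auto intro!: tendsto_intros tP)
    qed auto
    have iu: "(\<lambda>X. 1 / u X ^ 2) \<in> O[at 0](\<lambda>X. 1 / u X ^ 2)" by simp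
    have prd: "(\<lambda>X. W X * (1 / u X ^ 2) * (1 / P X ^ (n + 16))) \<in> O[at 0](\<lambda>X. u X ^ 2 * (1 / u X ^ 2) * 1)"
      by (rule landau_o.big.mult[OF landau_o.big.mult[OF bW iu] bP])
    have ev2: "eventually (\<lambda>X. u X ^ 2 * (1 / u X ^ 2) * 1 = 1) (at 0)"
      unfolding eventually_at by (intro exI[of _ 1]) (auto simp: u_def)
    have ev1: "eventually (\<lambda>X. W X * (1 / u X ^ 2) * (1 / P X ^ (n + 16)) = K X) (at 0)"
      unfolding eventually_at
    proof (intro exI[of _ 1] conjI ballI impI)
      fix X :: complex assume "X \<noteq> 0 \<and> dist X 0 < 1"
      then have X: "X \<noteq> 0" "norm X < 1" by auto
      note Pn = PX[OF X(2)]
      have u2: "u X ^ 2 = X ^ 16" by (simp add: u_def flip: power_mult)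
      have t1: "V X * P X ^ 16 / (X ^ 16 * P X ^ (n + 16)) = c X / (X * P X) ^ n"
        using X Pn by (simp add: V_def power_add power_mult_distrib field_simps)
      have t2: "u X ^ 2 * P X ^ (n + 16) / (X ^ 16 * P X ^ (n + 16)) = 1" unfolding u2 using X Pn by simp
      have t3: "u X * U X ^ 4 * P X ^ (n + 8) / (X ^ 16 * P X ^ (n + 16)) = U X ^ 4 / (X * P X) ^ 8"
      proof -
        have e1: "X ^ 16 = X ^ 8 * X ^ 8" by (simp flip: power_add)
        have e2: "P X ^ (n + 16) = P X ^ (n + 8) * P X ^ 8"
          using power_add[of "P X" "n + 8" 8] by (simp add: add.assoc)
        have "x * y * z / (x * x * (z * w)) = y / (x * w)" if "x \<noteq> 0" "z \<noteq> 0" for x y z w :: complex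
          using that by (simp add: field_simps)
        from this[of "X ^ 8" "P X ^ (n + 8)" "U X ^ 4" "P X ^ 8"] show ?thesis
          unfolding e1 e2 u_def power_mult_distrib using X Pn by simp
      qed
      have t4: "U X ^ 8 * P X ^ n / (X ^ 16 * P X ^ (n + 16)) = (U X ^ 4 / (X * P X) ^ 8) ^ 2"
        using X Pn by (simp add: power_divide power_mult_distrib power_add flip: power_mult)
      have "W X * (1 / u X ^ 2) * (1 / P X ^ (n + 16)) = W X / (X ^ 16 * P X ^ (n + 16))"
        unfolding u2 by simp
      also have "\<dots> = V X * P X ^ 16 / (X ^ 16 * P X ^ (n + 16)) - u X ^ 2 * P X ^ (n + 16) / (X ^ 16 * P X ^ (n + 16))
         + \<beta> / 16 * (u X * U X ^ 4 * P X ^ (n + 8) / (X ^ 16 * P X ^ (n + 16))) - \<gamma> / 256 * (U X ^ 8 * P X ^ n / (X ^ 16 * P X ^ (n + 16)))"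
        unfolding W_def by (simp only: add_divide_distrib diff_divide_distrib times_divide_eq_right)
      also have "\<dots> = K X" unfolding t1 t2 t3 t4 K_def by (simp add: power_divide)
      finally show "W X * (1 / u X ^ 2) * (1 / P X ^ (n + 16)) = K X" .
    qed simp
    show ?thesis
      using landau_o.big.in_cong[OF ev1, THEN iffD1, OF prd] unfolding landau_o.big.cong[OF ev2] .
  qed
  obtain C where C: "C > 0" "\<And>X. X \<noteq> 0 \<Longrightarrow> norm X \<le> exp (- pi / 8) \<Longrightarrow> norm (K X) \<le> C"
    using bounded_near_puncture[OF contK bigK, of "exp (- pi / 8)"] by auto
  have "f q = 0"
  proof (rule modular_function_zero[OF _ _ _ _ q])
    show "f holomorphic_on ball 0 1" unfolding f_def
      by (intro holomorphic_intros hL theta_sq_holomorphic hauptmodul_holomorphic) (auto simp: nz)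
    show "f 0 = 0" by (simp add: f_def lattice_theta_0[OF L] theta_sq_0 hauptmodul_def)
    show "f (nome (- 1 / z)) = f (nome z)" if z: "z \<in> upper_half" for z
    proof -
      have "theta_sq (nome (- 1 / z)) = inv_factor z * theta_sq (nome z)" using theta_inversion(1)[OF z] by (simp add: theta3_def)
      then show ?thesis unfolding f_def hauptmodul_inversion[OF z]
        using lattice_theta_inversion(1)[OF L z] inv_factor_nonzero[OF z] by (simp add: power_mult_distrib n_def)
    qed
    show "norm (f (nome (1 - 1 / w))) \<le> C" if w: "Im w \<ge> 1 / 2" for w
    proof -
      have "w \<in> upper_half" using w by (simp add: upper_half_def)
      moreover have "norm (nome (w / 4)) \<le> exp (- pi / 8)" using w by (simp add: norm_nome)
      ultimately show ?thesis using C(2)[OF nome_nonzero] fK by simp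
    qed
  qed
  then show ?thesis using nz(2)[OF q] by (simp add: f_def n_def field_simps)
qed

section \<open>Vectors of norm 2\<close>

lemma vectors_of_norm_eq_sqnorm:
  assumes "integral_unimodular_lattice L" "S \<subseteq> L"
  shows "vectors_of_norm S (real m) = {v \<in> S. sqnorm v = m}"
proof -
  have "v \<bullet> v = real m \<longleftrightarrow> sqnorm v = m" if "v \<in> S" for v
    using of_nat_sqnorm[OF assms(1), of v] assms(2) that by auto
  then show ?thesis by (auto simp: vectors_of_norm_def)
qed

lemma jet_weaken: "jet F u N f p \<Longrightarrow> (u \<longlongrightarrow> 0) F \<Longrightarrow> M \<le> N \<Longrightarrow> jet F u M f p"
proof -
  assume j: "jet F u N f p" and u: "(u \<longlongrightarrow> 0) F" and le: "M \<le> N"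
  have "(\<lambda>x. poly (monom 1 (N - M)) (u x)) \<in> O[F](\<lambda>_. 1)" by (rule poly_in_bigo_1[OF u])
  then have "(\<lambda>x. u x ^ M * poly (monom 1 (N - M)) (u x)) \<in> O[F](\<lambda>x. u x ^ M * 1)"
    by (rule landau_o.big.mult[OF landau_o.big_refl])
  then have "(\<lambda>x. u x ^ N) \<in> O[F](\<lambda>x. u x ^ M)"
    using le by (simp add: poly_monom flip: power_add)
  then show ?thesis using j unfolding jet_def by (rule landau_o.big_trans[rotated])
qed

lemma coeff_linear_power_2: "coeff ([:1, b:] ^ m) 2 = of_nat (m choose 2) * (b::complex)\<^sup>2"
proof (cases "2 \<le> m")
  case False
  have "degree ([:1, b:] ^ m) \<le> degree [:1, b:] * m" by (rule degree_power_le)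
  also have "\<dots> \<le> 1 * m" by (intro mult_right_mono) auto
  finally have "coeff ([:1, b:] ^ m) 2 = 0" using False by (intro coeff_eq_0) auto
  then show ?thesis using False by (simp add: binomial_eq_0)
qed (simp add: coeff_linear_poly_power)

text \<open>
  Only the coefficients of q and q^2 are compared, after clearing denominators.
\<close>

theorem theta_coefficients:
  fixes L :: "(real ^ 'n) set"
  assumes L: "integral_unimodular_lattice L"
    and id: "\<And>q. norm q < 1 \<Longrightarrow>
      wt_series L sqnorm q = theta_sq q ^ CARD('n) * (1 + \<beta> * hauptmodul q + \<gamma> * hauptmodul q ^ 2)"
    and N1: "{v \<in> L. sqnorm v = 1} = {}"
  shows "\<beta> = - 2 * of_nat CARD('n)"
    and "of_nat (card {v \<in> L. sqnorm v = 2}) = 2 * of_nat CARD('n) * (23 - of_nat CARD('n)) + \<gamma>"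
proof -
  define n where "n = CARD('n)"
  define N2 where "N2 = complex_of_nat (card {v \<in> L. sqnorm v = 2})"
  have ut: "((\<lambda>q::complex. q) \<longlongrightarrow> 0) (at 0)" by (rule tendsto_ident_at)
  have jL: "jet (at 0) (\<lambda>q. q) 3 (wt_series L sqnorm) [:1, 0, N2:]"
  proof -
    have "0 \<in> L" using L lattice_closed(1) by (auto simp: integral_unimodular_lattice_def)
    moreover have "v = 0" if "v \<in> L" "sqnorm v = 0" for v using of_nat_sqnorm[OF L that(1)] that(2) by simp
    ultimately have c0: "{v \<in> L. sqnorm v = 0} = {0}" by (auto simp: sqnorm_def)
    have c1: "card {v \<in> L. sqnorm v = 1} = 0" unfolding N1 by simp
    have s3: "{..<3::nat} = {0,1,2}" by auto
    have "(\<Sum>m<3. of_nat (card {v \<in> L. sqnorm v = m}) * q ^ m) = poly [:1, 0, N2:] q" for q :: complex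
      unfolding s3 by (simp add: c0 c1 N2_def power2_eq_square del: One_nat_def)
    then show ?thesis using wt_series_remainder[OF wt_summable_lattice[OF L], of 3] by (simp add: jet_def)
  qed
  have jth: "jet (at 0) (\<lambda>q. q) 3 theta_sq [:1, 2:]" by (rule jet_weaken[OF jet_theta_sq ut]) simp
  have jthm: "jet (at 0) (\<lambda>q. q) 3 (\<lambda>q. theta_sq (- q)) [:1, -2:]" by (rule jet_weaken[OF jet_theta_sq_minus ut]) simp
  have jps: "jet (at 0) (\<lambda>q. q) 3 theta_pronic [:2, 0, 2:]" by (rule jet_weaken[OF jet_theta_pronic ut]) simp
  have jq: "jet (at 0) (\<lambda>q. q) 3 (\<lambda>q. q) [:0, 1:]" using jet_poly[of "at 0" "\<lambda>q. q" 3 "[:0, 1:]"] by simp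
  define W where "W q = 256 * (wt_series L sqnorm q * theta_sq q ^ 16) - (256 * theta_sq q ^ (n + 16)
     + 16 * \<beta> * (q * (theta_pronic q ^ 4 * (theta_sq (- q) ^ 4 * theta_sq q ^ (n + 8))))
     + \<gamma> * (q ^ 2 * (theta_pronic q ^ 8 * (theta_sq (- q) ^ 8 * theta_sq q ^ n))))" for q
  define p where "p = [:256:] * ([:1, 0, N2:] * [:1, 2:] ^ 16) - ([:256:] * [:1, 2:] ^ (n + 16)
     + [:16 * \<beta>:] * ([:0, 1:] * ([:2, 0, 2:] ^ 4 * ([:1, -2:] ^ 4 * [:1, 2:] ^ (n + 8))))
     + [:\<gamma>:] * ([:0, 1:] ^ 2 * ([:2, 0, 2:] ^ 8 * ([:1, -2:] ^ 8 * [:1, 2:] ^ n))))"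
  have jW: "jet (at 0) (\<lambda>q. q) 3 W p"
    unfolding W_def p_def
    by (intro jet_add jet_diff jet_mult[OF ut] jet_power[OF ut] jet_const jL jth jthm jps jq)
  have W0: "W q = 0" if q: "norm q < 1" for q
  proof -
    have t0: "theta_sq q \<noteq> 0" by (rule theta_sq_nonzero[OF q])
    define a where "a = q * (theta_pronic q * theta_sq (- q)) ^ 4"
    have h: "hauptmodul q = a / (16 * theta_sq q ^ 8)" by (simp add: hauptmodul_def a_def)
    have p8: "theta_sq q ^ (n + 8) = theta_sq q ^ n * theta_sq q ^ 8" "theta_sq q ^ (n + 16) = theta_sq q ^ n * (theta_sq q ^ 8) ^ 2" "theta_sq q ^ 16 = (theta_sq q ^ 8) ^ 2"
      by (simp_all add: power_add flip: power_mult)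
    have a1: "q * (theta_pronic q ^ 4 * (theta_sq (- q) ^ 4 * x)) = a * x" for x by (simp add: a_def power_mult_distrib)
    have a2: "q ^ 2 * (theta_pronic q ^ 8 * (theta_sq (- q) ^ 8 * x)) = a ^ 2 * x" for x
      by (simp add: a_def power_mult_distrib flip: power_mult)
    define T where "T = theta_sq q ^ 8"
    have T0: "T \<noteq> 0" using t0 by (simp add: T_def)
    show ?thesis
      unfolding W_def a1 a2 id[OF q] h p8 n_def[symmetric] T_def[symmetric]
      using T0 by (simp add: field_simps power2_eq_square)
  qed
  have "eventually (\<lambda>q. W q - poly p q = 0 - poly p q) (at 0)"
    unfolding eventually_at by (intro exI[of _ 1]) (auto simp: W0)
  from landau_o.big.in_cong[OF this] have j0: "jet (at 0) (\<lambda>q. q) 3 (\<lambda>_. 0) p"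
    using jW unfolding jet_def by blast
  have cp: "coeff p i = 0" if "i < 3" for i
    by (rule jet_unique_zero[OF _ _ j0 that]) (auto simp: filterlim_ident)
  have quart: "[:2, 0, 2::complex:] ^ 4 = [:16, 0, 64:] + monom 1 3 * [:0, 96, 0, 64, 0, 16:]"
    by (simp add: eval_nat_numeral monom_Suc monom_0 algebra_simps)
  have c4: "coeff ([:2, 0, 2::complex:] ^ 4) 0 = 16" "coeff ([:2, 0, 2::complex:] ^ 4) (Suc 0) = 0"
    unfolding quart by (simp_all add: coeff_monom_mult)
  have c8: "coeff ([:2, 0, 2::complex:] ^ 8) 0 = 256"
    by (simp add: poly_0_coeff_0[symmetric])
  have "coeff p (Suc 0) = 256 * (32 - 2 * (of_nat n + 16) - \<beta>)"
    by (simp add: p_def coeff_mult coeff_mult_0 coeff_linear_power_0 coeff_linear_power_1 c4 c8 power2_eq_square algebra_simps)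
  with cp[of 1] have b: "\<beta> = - 2 * of_nat n" by (simp add: algebra_simps)
  then show "\<beta> = - 2 * of_nat CARD('n)" by (simp add: n_def)
  have ch: "2 * complex_of_nat (m choose 2) = of_nat m * (of_nat m - 1)" for m
  proof -
    have "2 * (m choose 2) = m * (m - 1)" unfolding choose_two by (cases m) auto
    then have "complex_of_nat (2 * (m choose 2)) = of_nat (m * (m - 1))" by simp
    then show ?thesis by (cases m) (auto simp: algebra_simps)
  qed
  have c16: "16 choose Suc (Suc 0) = (120::nat)" by (simp add: choose_two numeral_2_eq_2[symmetric])
  have cp2: "coeff p 2 = 256 * (N2 + 480 - 4 * of_nat ((n + 16) choose 2) - \<beta> * (2 * (of_nat n + 8) - 8) - \<gamma>)"
    by (simp add: p_def coeff_mult coeff_mult_0 coeff_linear_power_0 coeff_linear_power_1 coeff_linear_power_2[unfolded numeral_2_eq_2] c4 c8 c16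
       numeral_2_eq_2 power2_eq_square algebra_simps)
  have "N2 + 480 - 4 * of_nat ((n + 16) choose 2) - \<beta> * (2 * (of_nat n + 8) - 8) - \<gamma> = 0"
    using cp[of 2] unfolding cp2 by (simp only: mult_eq_0_iff) simp
  then have "N2 = 2 * (2 * of_nat ((n + 16) choose 2)) - 480 + \<beta> * (2 * (of_nat n + 8) - 8) + \<gamma>"
    by (simp add: algebra_simps)
  then have "N2 = 2 * of_nat n * (23 - of_nat n) + \<gamma>"
    unfolding ch b by (simp add: algebra_simps)
  then show "of_nat (card {v \<in> L. sqnorm v = 2}) = 2 * of_nat CARD('n) * (23 - of_nat CARD('n)) + \<gamma>"
    by (simp add: N2_def n_def)
qed

text \<open>
  The case distinction is at n = 23. Up to there, norms of characteristic vectors are nonnegative and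
  congruent to n modulo 8, so none is below n - 16. Beyond, 2n(23 - n) is negative, hence never attained.
\<close>

theorem theorem1:
  fixes L :: "(real ^ 'n) set"
  assumes "integral_unimodular_lattice L"
    and "vectors_of_norm L 1 = {}"
  shows "int (card (vectors_of_norm L 2)) \<ge> 2 * int CARD('n) * (23 - int CARD('n)) \<and>
    (int (card (vectors_of_norm L 2)) = 2 * int CARD('n) * (23 - int CARD('n)) \<longleftrightarrow>
      \<not> (\<exists>w \<in> characteristic_vectors L. w \<bullet> w < real CARD('n) - 8)) \<and>
    (int (card (vectors_of_norm L 2)) = 2 * int CARD('n) * (23 - int CARD('n)) \<longrightarrow>
      real (card (vectors_of_norm (characteristic_vectors L) (real CARD('n) - 8)))
        = 2 powi (int CARD('n) - 11) * real CARD('n))"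
proof -
  note L = assms(1)
  define n where "n = CARD('n)"
  have n0: "n > 0" by (simp add: n_def)
  define Ch where "Ch = characteristic_vectors L"
  define a where "a = card {w \<in> Ch. sqnorm w + 16 = n}"
  define b where "b = card {w \<in> Ch. sqnorm w + 8 = n}"
  define N2 where "N2 = card (vectors_of_norm L 2)"
  have N2: "N2 = card {v \<in> L. sqnorm v = 2}"
    using vectors_of_norm_eq_sqnorm[OF L subset_refl, of 2] by (simp add: N2_def)
  have N1: "{v \<in> L. sqnorm v = 1} = {}"
    using vectors_of_norm_eq_sqnorm[OF L subset_refl, of 1] assms(2) by simp
  have nvw: "real (sqnorm w) = w \<bullet> w" if "w \<in> Ch" for w
    using of_nat_sqnorm[OF L] characteristic_subset that unfolding Ch_def by blast
  have bcard: "card (vectors_of_norm Ch (real n - 8)) = b"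
  proof -
    have "w \<bullet> w = real n - 8 \<longleftrightarrow> sqnorm w + 8 = n" if "w \<in> Ch" for w
      using nvw[OF that] by linarith
    then have "vectors_of_norm Ch (real n - 8) = {w \<in> Ch. sqnorm w + 8 = n}"
      by (auto simp: vectors_of_norm_def)
    then show ?thesis by (simp add: b_def)
  qed
  have short: "w \<bullet> w < real n - 8 \<longleftrightarrow> sqnorm w + 8 < n" if "w \<in> Ch" for w
    using nvw[OF that] by linarith
  have mod8: "\<exists>k::int. int (sqnorm w) = int n + 8 * k" if "w \<in> Ch" for w
    using characteristic_norm_mod_8[OF L] that unfolding Ch_def n_def by blast
  have fa: "finite {w \<in> Ch. sqnorm w + 16 = n}"
  proof (rule finite_subset)
    show "finite {w \<in> Ch. sqnorm w = n - 16}" unfolding Ch_def by (rule wt_summable_finite[OF wt_summable_characteristic[OF L]])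
  qed auto
  (* The two coefficient identities, multiplied by 2^n to make them integral. *)
  have main: "int N2 * 2 ^ n = 2 * int n * (23 - int n) * 2 ^ n + 2 ^ 24 * int a"
      "2 * int n * 2 ^ n = 2 ^ 12 * (int b + (48 - int n) * int a)"
    if low: "\<And>w. w \<in> Ch \<Longrightarrow> n \<le> sqnorm w + 16"
  proof -
    define \<beta> where "\<beta> = - (2 ^ 12 * (complex_of_nat b + (48 - of_nat n) * of_nat a) / 2 ^ n)"
    define \<gamma> where "\<gamma> = 2 ^ 24 * complex_of_nat a / 2 ^ n"
    have "wt_series L sqnorm q = theta_sq q ^ CARD('n) * (1 + \<beta> * hauptmodul q + \<gamma> * hauptmodul q ^ 2)" if "norm q < 1" for q
      using lattice_theta_identity[OF L _ that] low
      unfolding \<beta>_def \<gamma>_def a_def b_def Ch_def n_def by blast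
    note co = theta_coefficients[OF L this N1, folded n_def N2]
    have "complex_of_int (2 * int n * 2 ^ n) = of_int (2 ^ 12 * (int b + (48 - int n) * int a))"
      using co(1) by (simp add: \<beta>_def field_simps)
    then show "2 * int n * 2 ^ n = 2 ^ 12 * (int b + (48 - int n) * int a)" by (simp only: of_int_eq_iff)
    have "complex_of_int (int N2 * 2 ^ n) = of_int (2 * int n * (23 - int n) * 2 ^ n + 2 ^ 24 * int a)"
      using co(2) by (simp add: \<gamma>_def field_simps)
    then show "int N2 * 2 ^ n = 2 * int n * (23 - int n) * 2 ^ n + 2 ^ 24 * int a" by (simp only: of_int_eq_iff)
  qed
  have low_small: "n \<le> sqnorm w + 16" if "n \<le> 23" "w \<in> Ch" for w
    using mod8[OF that(2)] that(1) by presburger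
  have i: "int N2 \<ge> 2 * int n * (23 - int n)"
  proof (cases "n \<le> 23")
    case True
    have "2 * int n * (23 - int n) * 2 ^ n \<le> int N2 * 2 ^ n" using main(1)[OF low_small[OF True]] by simp
    then show ?thesis by simp
  next
    case False
    then have "2 * int n * (23 - int n) \<le> 0" by (intro mult_nonneg_nonpos) auto
    then show ?thesis by linarith
  qed
  have n23: "n \<le> 23" if "int N2 = 2 * int n * (23 - int n)"
  proof (rule ccontr)
    assume "\<not> n \<le> 23"
    then have "2 * int n * (23 - int n) < 0" using n0 by (intro mult_pos_neg) auto
    then show False using that by linarith
  qed
  have a0: "a = 0" if e: "int N2 = 2 * int n * (23 - int n)"
    using main(1)[OF low_small[OF n23[OF e]]] e by simp
  have ii: "int N2 = 2 * int n * (23 - int n) \<longleftrightarrow> \<not> (\<exists>w \<in> Ch. sqnorm w + 8 < n)"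
  proof
    assume e: "int N2 = 2 * int n * (23 - int n)"
    show "\<not> (\<exists>w \<in> Ch. sqnorm w + 8 < n)"
    proof
      assume "\<exists>w \<in> Ch. sqnorm w + 8 < n"
      then obtain w where w: "w \<in> Ch" "sqnorm w + 8 < n" by blast
      have "sqnorm w + 16 = n" using mod8[OF w(1)] w(2) low_small[OF n23[OF e] w(1)] by presburger
      then have "w \<in> {w \<in> Ch. sqnorm w + 16 = n}" using w(1) by simp
      then show False using a0[OF e] fa unfolding a_def by (metis card_eq_0_iff empty_iff)
    qed
  next
    assume ns: "\<not> (\<exists>w \<in> Ch. sqnorm w + 8 < n)"
    have low: "n \<le> sqnorm w + 16" if "w \<in> Ch" for w using ns that by force
    have "{w \<in> Ch. sqnorm w + 16 = n} = {}" using ns by force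
    then have "a = 0" unfolding a_def by (simp only: card.empty)
    then show "int N2 = 2 * int n * (23 - int n)" using main(1)[OF low] by simp
  qed
  have iii: "real b = 2 powi (int n - 11) * real n" if e: "int N2 = 2 * int n * (23 - int n)"
  proof -
    have "2 * int n * 2 ^ n = 2 ^ 12 * int b" using main(2)[OF low_small[OF n23[OF e]]] a0[OF e] by simp
    then have "real_of_int (2 * int n * 2 ^ n) = real_of_int (2 ^ 12 * int b)" by (simp only:)
    then have "real b = 2 ^ n / 2 ^ 11 * real n" by (simp add: mult.commute)
    also have "(2::real) ^ n / 2 ^ 11 = 2 powi (int n - 11)" by (simp add: power_int_diff)
    finally show ?thesis .
  qed
  show ?thesis
    using i ii iii short bcard unfolding N2_def n_def Ch_def by auto
qed

end
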